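(* Assume that the ergodic degree $d$ exists. For all finite $d>-1$ the zeta function $\zeta(\varphi,z)=\exp\sum_{n\ge1}\frac{z^n}{n}Q_n$ is holomorphic in $\{|z|<1\}$ and extends continuously to $\{|z|\le1\}\setminus\{1\}$, whereas at $z=1$ it has a non-polar singularity. More specifically, it can be written as $$\zeta(\varphi,z)=\frac{A(z)\cdot L(z)}{1-z},$$ where $A(z)=\big(1-\sum_{n\ge1}\rho(A_n)z^n\big)^{-1}$ and $L(z)$ is continuous on the unit circle $|z|=1$, with $L(1)\ne0$.
   Context: Shift and potential. $\Omega=\{0,1\}^{\{0,1,2,\dots\}}$, $T$ is the left shift, $0^\infty=(000\dots)$, $\tau(\omega)=1+\inf\{i\ge 0:\omega_i=1\}$ (with $\inf\emptyset=\infty$), $A_k=\{\omega:\tau(\omega)=k\}$ for $k\ge1$. Let $\Omega_*$ be the set of $\omega\in\Omega$ with infinitely many $1$'s. For $\omega\in\Omega_*$ the times between passages are $\sigma_k(\omega)=\tau\big((T^\tau)^k\omega\big)$, $k\ge 0$, where $T^\tau\omega=T^{\tau(\omega)}\omega$. A potential $V:\Omega\to\mathbb R$ is given, with induced version $W(\omega)=\sum_{k=0}^{\tau(\omega)-1}V(T^k\omega)$, satisfying: (1) $V$ is continuous, $-C_1\le V\le 0$ for some constant $C_1>0$, and $V(0^\infty)=0$; (2) $\sum_{n\ge1}\exp(\sup_{A_n}W)<C_2$ for some constant $C_2$; (3) for some $0<\theta<1$ and $C_3>0$, for all $n\ge1$, $\mathrm{Var}_nW\le C_3\theta^n$, where $\mathrm{Var}_nW=\sup\{|W(\omega)-W(\omega')|:\inf\{k\ge0:\sigma_k(\omega)\ne\sigma_k(\omega')\}=n\}$;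 (4) the limit $\lim_n\frac1n\log\sum_{\omega_0,\dots,\omega_{n-1}}\exp\big(\sup_{\omega'\in\Omega}\sum_{i=0}^{n-1}V(\omega_i\dots\omega_{n-1}\omega')\big)$ exists and equals $0$. Induced operator and measures. Put $\varphi=e^V$, $\psi=e^W$. $\mathcal F_\theta$ is the Banach space of bounded complex functions on $\Omega_*$ which are Lipschitz for $d_\theta(\omega,\omega')=\theta^{\inf\{j\ge0:\sigma_j(\omega)\neq\sigma_j(\omega')\}}$, normed by sup norm plus least Lipschitz constant. The operator $(\mathcal Mf)(\omega)=\sum_{n\ge1}\psi(0^{n-1}1\omega)f(0^{n-1}1\omega)$ on $\mathcal F_\theta$ has a unique positive $h\in\mathcal F_\theta$ and Borel probability measure $\nu$ on $\Omega_*$ with $\mathcal Mh=h$, $\mathcal M^*\nu=\nu$, $\int h\,d\nu=1$. Let $\rho=h\cdot\nu$, a probability measure. Ergodic degree. $M_\gamma=\sum_{k\ge1}k^\gamma\rho(A_k)$ for $\gamma\ge0$. The ergodic degree is the real number $d$ with $M_{d+1}=\infty$ but $M_{d+1-\epsilon}<\infty$ for all $\epsilon>0$ (necessarily $d>-1$). Zeta function. $Q_n=\sum_{\omega\in\Omega:\,T^n\omega=\omega}\prod_{k=0}^{n-1}\varphi(T^k\omega)$. *)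

theory Defs
  imports "HOL-Complex_Analysis.Complex_Analysis" "HOL-Probability.Probability_Measure"
    "HOL-Library.Omega_Words_Fun"
begin

text \<open>
  Points of the full shift are functions \<open>nat \<Rightarrow> bool\<close>, with \<open>True\<close> for the symbol 1 and \<open>False\<close>
  for 0. Continuity and Borel sets refer to the library's product topology on this type
  (\<open>bool\<close> being discrete), and \<open>w \<frown> \<omega>\<close> prefixes the finite word \<open>w\<close> to \<open>\<omega>\<close>.
\<close>

type_synonym point = "nat \<Rightarrow> bool"

definition shift :: "point \<Rightarrow> point" where
  "shift \<omega> = (\<lambda>i. \<omega> (Suc i))"

definition zero_point :: point where
  "zero_point = (\<lambda>_. False)"

definition passage_time :: "point \<Rightarrow> enat" where
  "passage_time \<omega> = 1 + (INF i\<in>{i. \<omega> i}. enat i)"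

definition level_set :: "nat \<Rightarrow> point set" where
  "level_set k = {\<omega>. passage_time \<omega> = enat k}"

definition Omega_star :: "point set" where
  "Omega_star = {\<omega>. infinite {i. \<omega> i}}"

definition induced_shift :: "point \<Rightarrow> point" where
  "induced_shift \<omega> = (shift ^^ the_enat (passage_time \<omega>)) \<omega>"

definition sigma_time :: "nat \<Rightarrow> point \<Rightarrow> enat" where
  "sigma_time k \<omega> = passage_time ((induced_shift ^^ k) \<omega>)"

definition first_diff :: "point \<Rightarrow> point \<Rightarrow> enat" where
  "first_diff \<omega> \<omega>' = (INF k\<in>{k. sigma_time k \<omega> \<noteq> sigma_time k \<omega>'}. enat k)"

text \<open>
  At \<open>zero_point\<close> the index set below is infinite and the sum is 0 by convention; this is the
  correct value for potentials with \<open>V zero_point = 0\<close>.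
\<close>

definition induced_potential :: "(point \<Rightarrow> real) \<Rightarrow> point \<Rightarrow> real" where
  "induced_potential V \<omega> = (\<Sum>k\<in>{k. enat k < passage_time \<omega>}. V ((shift ^^ k) \<omega>))"

text \<open>
  The variation is an extended real, so that an upper bound on it asserts boundedness.
\<close>

definition variation :: "nat \<Rightarrow> (point \<Rightarrow> real) \<Rightarrow> ereal" where
  "variation n W =
     (SUP (\<omega>, \<omega>') \<in> {(\<omega>, \<omega>'). \<omega> \<in> Omega_star \<and> \<omega>' \<in> Omega_star \<and> first_diff \<omega> \<omega>' = enat n}.
        ereal \<bar>W \<omega> - W \<omega>'\<bar>)"

definition partition_sum :: "(point \<Rightarrow> real) \<Rightarrow> nat \<Rightarrow> real" where
  "partition_sum V n =
     (\<Sum>w\<in>{w :: bool list. length w = n}. exp (SUP \<omega>'. \<Sum>i<n. V (drop i w \<frown> \<omega>')))"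

definition d_theta :: "real \<Rightarrow> point \<Rightarrow> point \<Rightarrow> real" where
  "d_theta \<theta> \<omega> \<omega>' = (case first_diff \<omega> \<omega>' of enat n \<Rightarrow> \<theta> ^ n | \<infinity> \<Rightarrow> 0)"

text \<open>
  Functions on \<open>Omega_star\<close> are represented by total functions whose values off \<open>Omega_star\<close>
  are irrelevant.
\<close>

definition F_theta :: "real \<Rightarrow> (point \<Rightarrow> complex) set" where
  "F_theta \<theta> = {f. (\<exists>B. \<forall>\<omega>\<in>Omega_star. norm (f \<omega>) \<le> B) \<and>
     (\<exists>L. \<forall>\<omega>\<in>Omega_star. \<forall>\<omega>'\<in>Omega_star. norm (f \<omega> - f \<omega>') \<le> L * d_theta \<theta> \<omega> \<omega>')}"

text \<open>
  The sum over \<open>n \<ge> 1\<close> is indexed from 0 here, so that its \<open>n\<close>-th term involves the word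
  consisting of \<open>n\<close> zeros and a one.
\<close>

definition induced_operator :: "(point \<Rightarrow> real) \<Rightarrow> (point \<Rightarrow> complex) \<Rightarrow> point \<Rightarrow> complex" where
  "induced_operator V f \<omega> =
     (\<Sum>n. complex_of_real (exp (induced_potential V ((replicate n False @ [True]) \<frown> \<omega>)))
            * f ((replicate n False @ [True]) \<frown> \<omega>))"

text \<open>
  The measures below have space \<open>Omega_star\<close>, of which \<open>level_set k\<close> is not a subset; hence
  the intersection.
\<close>

definition passage_prob :: "point measure \<Rightarrow> nat \<Rightarrow> real" where
  "passage_prob \<rho> k = measure \<rho> (level_set k \<inter> Omega_star)"

definition passage_moment :: "point measure \<Rightarrow> real \<Rightarrow> ennreal" where
  "passage_moment \<rho> \<gamma> = (\<Sum>k. ennreal (real (Suc k) powr \<gamma> * passage_prob \<rho> (Suc k)))"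

text \<open>
  For negative exponents the moment of a probability measure is at most 1, so nothing is added
  by letting \<open>d + 1 - \<epsilon>\<close> become negative.
\<close>

definition ergodic_degree :: "point measure \<Rightarrow> real \<Rightarrow> bool" where
  "ergodic_degree \<rho> d \<longleftrightarrow>
     passage_moment \<rho> (d + 1) = \<infinity> \<and> (\<forall>\<epsilon>>0. passage_moment \<rho> (d + 1 - \<epsilon>) < \<infinity>)"

definition periodic_sum :: "(point \<Rightarrow> real) \<Rightarrow> nat \<Rightarrow> real" where
  "periodic_sum \<phi> n = (\<Sum>\<omega>\<in>{\<omega>. (shift ^^ n) \<omega> = \<omega>}. \<Prod>k<n. \<phi> ((shift ^^ k) \<omega>))"

definition zeta_term :: "(point \<Rightarrow> real) \<Rightarrow> complex \<Rightarrow> nat \<Rightarrow> complex" where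
  "zeta_term \<phi> z n = z ^ n / of_nat n * of_real (periodic_sum \<phi> n)"

definition dyn_zeta :: "(point \<Rightarrow> real) \<Rightarrow> complex \<Rightarrow> complex" where
  "dyn_zeta \<phi> z = exp (\<Sum>n. zeta_term \<phi> z (Suc n))"

definition passage_gf :: "point measure \<Rightarrow> complex \<Rightarrow> complex" where
  "passage_gf \<rho> z = (\<Sum>n. of_real (passage_prob \<rho> (Suc n)) * z ^ Suc n)"

definition renewal_factor :: "point measure \<Rightarrow> complex \<Rightarrow> complex" where
  "renewal_factor \<rho> z = inverse (1 - passage_gf \<rho> z)"

text \<open>
  A function \<open>f\<close> given on an open set \<open>U\<close> may be regular at a boundary point \<open>p\<close>, or have a pole
  there, in the sense of analytic continuation from \<open>U\<close> to a full (punctured) neighbourhood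
  of \<open>p\<close>. A non-polar singularity is one of any other kind.
\<close>

definition continues_regularly :: "(complex \<Rightarrow> complex) \<Rightarrow> complex set \<Rightarrow> complex \<Rightarrow> bool" where
  "continues_regularly f U p \<longleftrightarrow>
     (\<exists>g r. r > 0 \<and> g holomorphic_on ball p r \<and> (\<forall>z\<in>U \<inter> ball p r. g z = f z))"

definition continues_with_pole :: "(complex \<Rightarrow> complex) \<Rightarrow> complex set \<Rightarrow> complex \<Rightarrow> bool" where
  "continues_with_pole f U p \<longleftrightarrow>
     (\<exists>g r. r > 0 \<and> g holomorphic_on (ball p r - {p}) \<and> is_pole g p \<and>
        (\<forall>z\<in>U \<inter> ball p r. g z = f z))"

definition nonpolar_singularity :: "(complex \<Rightarrow> complex) \<Rightarrow> complex set \<Rightarrow> complex \<Rightarrow> bool" where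
  "nonpolar_singularity f U p \<longleftrightarrow> \<not> continues_regularly f U p \<and> \<not> continues_with_pole f U p"

end

theory Submission
  imports Defs "HOL-Library.Landau_Symbols"
begin

text \<open>
  A point of the shift is coded by its passage times, and the transfer operator of the induced
  system is \<open>M_z = \<Sum>n. z\<^sup>n L_n\<close>. Distortion control yields a cone of log-Lipschitz functions from which
  every \<open>L_n\<close> can be reduced by a multiple of the functional \<open>f \<mapsto> L_n f(\<omega>\<^sub>0)\<close> to an operator \<open>N_n \<le> r L_n\<close>,
  \<open>r < 1\<close>, that still preserves the cone. So \<open>M_z = N_z + c 1 \<otimes> \<ell>_z\<close>, where all products of the \<open>N_n\<close> are
  exponentially small uniformly in the closed disc, and formally
  \<open>det (1 - M_z) = (1 - a(z)) det (1 - N_z)\<close> with a genuine renewal sequence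
  \<open>a(z) = c \<ell>_z (1 - N_z)\<^sup>-\<^sup>1 1\<close>, \<open>a(1) = 1\<close>. Telescoping the periodic sums word by word makes this
  rigorous: \<open>\<zeta>(z) (1 - z) (1 - a(z)) = exp (G z)\<close>, where the coefficients of \<open>G\<close> have all the moments
  that the passage probabilities have.

  Integrating the resolvent equations against the conformal measure compares \<open>1 - a(z)\<close> with
  \<open>1 - P(z)\<close>, \<open>P\<close> being the generating function of the passage probabilities \<open>p_n\<close>: they are
  proportional up to an error \<open>O((\<Sum>n. p_n |1 - z\<^sup>n|)\<^sup>2) = o(|1 - P(z)|)\<close>. If the zeta function had a pole at 1,
  the \<open>k\<close>-th derivative of \<open>1 - a = q exp G\<close>, with \<open>k\<close> the least integer such that \<open>\<Sum>n. n\<^sup>k p_n = \<infinity>\<close>,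
  would be \<open>O(1) + o(\<Sum>n. n\<^sup>k p_n x\<^sup>n)\<close> as \<open>x\<close> increases to 1, which contradicts \<open>a_n \<ge> const p_n\<close>.
\<close>

section \<open>Coding of points by passage times\<close>

text \<open>The obstacle is the circle |z| = 1. Estimates there are made word by word with absolute
  values. This works because each \<open>N_n\<close> separately, not just their sum, is positive: a
  product of the \<open>N_n\<close> applied to 1 is nonnegative, so its terms in the closed disc are
  bounded by those at z = 1. The functional evaluates at the fixed point \<open>ones\<close>, so a
  return to the constant 1 restarts a word at the same place and weights multiply under
  concatenation. The determinant identity is that of a rank-one perturbation; its logarithm is
  obtained from Newton's identities between traces and renewal weights, for |z| < 1 only. The factor
  1 - z stems from \<open>zero_point\<close>, the one periodic point without passages, which adds 1
  to every \<open>Q_n\<close>. If the zeta function had a pole at 1, then q = 1 / ((1 - z) \<zeta>)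
  would be holomorphic there with q(1) = 0, and this zero damps the only derivative of exp G that
  can be unbounded.\<close>

definition cons :: "nat \<Rightarrow> point \<Rightarrow> point" where
  "cons n \<omega> = (replicate n False @ [True]) \<frown> \<omega>"

definition first_one :: "point \<Rightarrow> nat" where
  "first_one \<omega> = (LEAST i. \<omega> i)"

text \<open>Letter n stands for the block of n zeros and a one, that is for passage time n + 1;
  hence the \<open>Suc\<close>. The total is the length of the coded binary word and the exponent of
  z attached to it.\<close>

definition tot :: "nat list \<Rightarrow> nat" where
  "tot u = (\<Sum>n\<leftarrow>u. Suc n)"

definition prepend :: "nat list \<Rightarrow> point \<Rightarrow> point" where
  "prepend u \<omega> = foldr cons u \<omega>"

definition ones :: point where
  "ones = (\<lambda>_. True)"

definition periodic_point :: "nat list \<Rightarrow> point" where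
  "periodic_point u = (concat (map (\<lambda>n. replicate n False @ [True]) u))\<^sup>\<omega>"

lemma tot_simps [simp]: "tot [] = 0" "tot (n # u) = Suc n + tot u" "tot (u @ v) = tot u + tot v"
  by (simp_all add: tot_def)

lemma length_le_tot: "length u \<le> tot u"
  by (induction u) auto

lemma letter_less_tot: "n \<in> set u \<Longrightarrow> n < tot u"
  by (induction u) auto

lemma tot_eq_0_iff [simp]: "tot u = 0 \<longleftrightarrow> u = []"
  by (cases u) auto

lemma finite_tot_eq [simp]: "finite {u. tot u = n}"
proof (rule finite_subset)
  show "{u. tot u = n} \<subseteq> {u. set u \<subseteq> {..<n} \<and> length u \<le> n}"
    using letter_less_tot length_le_tot by auto
  show "finite {u. set u \<subseteq> {..<n} \<and> length u \<le> n}"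
    by (rule finite_lists_length_le) auto
qed

lemma tot_rotate [simp]: "tot (rotate j u) = tot u"
  by (metis add.commute append_take_drop_id rotate_drop_take tot_simps(3))

lemma prepend_simps [simp]: "prepend [] \<omega> = \<omega>" "prepend (n # u) \<omega> = cons n (prepend u \<omega>)"
  "prepend (u @ v) \<omega> = prepend u (prepend v \<omega>)"
  by (simp_all add: prepend_def)

lemma cons_nth: "cons n \<omega> i = (if i < n then False else if i = n then True else \<omega> (i - Suc n))"
  unfolding cons_def conc_def by (auto simp: nth_append)

lemma cons_nth_add [simp]: "cons n \<omega> (Suc n + i) = \<omega> i"
  by (simp add: cons_nth)

lemma first_one_cons [simp]: "first_one (cons n \<omega>) = n"
  unfolding first_one_def by (rule Least_equality) (auto simp: cons_nth split: if_splits)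

lemma shift_pow: "(shift ^^ k) \<omega> = (\<lambda>i. \<omega> (k + i))"
proof (induction k arbitrary: \<omega>)
  case 0
  then show ?case by simp
next
  case (Suc k)
  have "(shift ^^ Suc k) \<omega> = shift ((shift ^^ k) \<omega>)" by simp
  also have "\<dots> = (\<lambda>i. \<omega> (Suc k + i))" by (simp only: Suc) (simp add: shift_def)
  finally show ?case .
qed

lemma shift_pow_cons [simp]: "(shift ^^ Suc n) (cons n \<omega>) = \<omega>"
  unfolding shift_pow by (simp only: cons_nth_add)

lemma cons_inject [simp]: "cons n \<omega> = cons m \<omega>' \<longleftrightarrow> n = m \<and> \<omega> = \<omega>'"
  by (metis first_one_cons shift_pow_cons)

lemma cons_first_one: "\<exists>i. \<omega> i \<Longrightarrow> cons (first_one \<omega>) ((shift ^^ Suc (first_one \<omega>)) \<omega>) = \<omega>"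
proof
  fix j assume "\<exists>i. \<omega> i"
  then have 1: "\<omega> (first_one \<omega>)" unfolding first_one_def by (rule LeastI_ex)
  have 2: "\<not> \<omega> j" if "j < first_one \<omega>"
    using that unfolding first_one_def by (rule not_less_Least)
  show "cons (first_one \<omega>) ((shift ^^ Suc (first_one \<omega>)) \<omega>) j = \<omega> j"
    using 1 2 by (cases "j < first_one \<omega>") (auto simp: cons_nth shift_pow simp del: funpow.simps)
qed

lemma passage_time_eq: "\<exists>i. \<omega> i \<Longrightarrow> passage_time \<omega> = enat (Suc (first_one \<omega>))"
proof -
  assume "\<exists>i. \<omega> i"
  then have 1: "\<omega> (first_one \<omega>)" unfolding first_one_def by (rule LeastI_ex)
  have 2: "first_one \<omega> \<le> j" if "\<omega> j" for j
    using that unfolding first_one_def by (rule Least_le)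
  have "(INF i\<in>{i. \<omega> i}. enat i) = enat (first_one \<omega>)"

  proof (rule antisym)
    show "(INF i\<in>{i. \<omega> i}. enat i) \<le> enat (first_one \<omega>)" using 1 by (intro INF_lower) simp
    show "enat (first_one \<omega>) \<le> (INF i\<in>{i. \<omega> i}. enat i)" using 2 by (intro INF_greatest) simp
  qed
  then show ?thesis
    by (simp add: passage_time_def one_enat_def)
qed

lemma passage_time_cons [simp]: "passage_time (cons n \<omega>) = enat (Suc n)"
  using passage_time_eq[of "cons n \<omega>"] cons_nth[of n \<omega> n] by auto

lemma level_set_Suc: "level_set (Suc n) = range (cons n)"
proof
  show "range (cons n) \<subseteq> level_set (Suc n)" by (auto simp: level_set_def)
  show "level_set (Suc n) \<subseteq> range (cons n)"
  proof
    fix \<omega> assume *: "\<omega> \<in> level_set (Suc n)"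
    have "\<exists>i. \<omega> i"
    proof (rule ccontr)
      assume "\<nexists>i. \<omega> i"
      then have "passage_time \<omega> = \<infinity>" by (simp add: passage_time_def top_enat_def)
      with * show False by (simp add: level_set_def)
    qed
    note i = this
    with * have "first_one \<omega> = n" using passage_time_eq[OF i] by (simp add: level_set_def)
    with cons_first_one[OF i] show "\<omega> \<in> range (cons n)" by (metis rangeI)
  qed
qed

lemma induced_shift_cons [simp]: "induced_shift (cons n \<omega>) = \<omega>"
  by (simp add: induced_shift_def del: funpow.simps)

lemma cons_in_star [simp]: "cons n \<omega> \<in> Omega_star \<longleftrightarrow> \<omega> \<in> Omega_star"
proof -
  have "(infinite {i. cons n \<omega> i}) = (infinite {i. \<omega> i})"
    unfolding infinite_nat_iff_unbounded mem_Collect_eq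
  proof safe
    fix m assume "\<forall>m. \<exists>k>m. cons n \<omega> k"
    then obtain k where "k > Suc n + m" "cons n \<omega> k" by blast
    then show "\<exists>k>m. \<omega> k" by (intro exI[of _ "k - Suc n"]) (auto simp: cons_nth)
  next
    fix m assume "\<forall>m. \<exists>k>m. \<omega> k"
    then obtain k where "k > m" "\<omega> k" by blast
    then show "\<exists>k>m. cons n \<omega> k" by (intro exI[of _ "Suc n + k"]) (simp only: cons_nth_add, simp)
  qed
  then show ?thesis by (simp add: Omega_star_def)
qed

lemma prepend_in_star [simp]: "prepend u \<omega> \<in> Omega_star \<longleftrightarrow> \<omega> \<in> Omega_star"
  by (induction u) auto

lemma ones_in_star [simp]: "ones \<in> Omega_star"
  by (simp add: Omega_star_def ones_def)

lemma star_cases: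
  assumes "\<omega> \<in> Omega_star"
  obtains n \<omega>' where "\<omega> = cons n \<omega>'" "\<omega>' \<in> Omega_star"
proof -
  have i: "\<exists>i. \<omega> i"
    using assms by (metis (no_types, lifting) Omega_star_def infinite_imp_nonempty mem_Collect_eq empty_Collect_eq)
  from cons_first_one[OF i] assms cons_in_star that show thesis by metis
qed

section \<open>The metric in terms of coded points\<close>

lemma sigma_time_cons [simp]: "sigma_time 0 (cons n \<omega>) = enat (Suc n)"
  "sigma_time (Suc k) (cons n \<omega>) = sigma_time k \<omega>"
  by (simp_all add: sigma_time_def funpow_Suc_right del: funpow.simps)

lemma first_diff_cons_neq: "n \<noteq> m \<Longrightarrow> first_diff (cons n \<omega>) (cons m \<omega>') = 0"
proof -
  assume "n \<noteq> m"
  then have "first_diff (cons n \<omega>) (cons m \<omega>') \<le> enat 0"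
    unfolding first_diff_def by (intro INF_lower) auto
  then show ?thesis by (simp add: zero_enat_def[symmetric])
qed

text \<open>Passage times of the longer points are those of the shorter ones, moved by one index.
  This is the source of the contraction by \<open>\<theta>\<close> per common letter.\<close>

lemma first_diff_cons_eq: "first_diff (cons n \<omega>) (cons n \<omega>') = eSuc (first_diff \<omega> \<omega>')"
proof -
  have "{k. sigma_time k (cons n \<omega>) \<noteq> sigma_time k (cons n \<omega>')} = Suc ` {k. sigma_time k \<omega> \<noteq> sigma_time k \<omega>'}"
    (is "?A = Suc ` ?B")
  proof (intro set_eqI iffI)
    fix k assume "k \<in> ?A"
    then show "k \<in> Suc ` ?B" by (cases k) auto
  qed auto
  then have "first_diff (cons n \<omega>) (cons n \<omega>') = (INF k\<in>?B. eSuc (enat k))"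
    by (simp add: first_diff_def image_image eSuc_enat)
  also have "\<dots> = eSuc (INF k\<in>?B. enat k)"
  proof (rule antisym)
    show "eSuc (INF k\<in>?B. enat k) \<le> (INF k\<in>?B. eSuc (enat k))"
      by (rule INF_greatest) (simp add: INF_lower)
    \<comment> \<open>The infimum of a nonempty set in \<open>enat\<close> is attained, so
      \<open>eSuc\<close> passes through it; for the empty set both sides are infinite.\<close>
    show "(INF k\<in>?B. eSuc (enat k)) \<le> eSuc (INF k\<in>?B. enat k)"
    proof (cases "?B = {}")
      case True then show ?thesis by (simp add: top_enat_def)
    next
      case False
      then obtain j where "j \<in> ?B" by auto
      then have "(INF k\<in>?B. enat k) \<in> enat ` ?B" using wellorder_InfI[of "enat j" "enat ` ?B"] by blast
      then obtain k where "k \<in> ?B" "(INF k\<in>?B. enat k) = enat k" by auto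
      then show ?thesis using INF_lower[of k ?B "\<lambda>k. eSuc (enat k)"] by simp
    qed
  qed
  finally show ?thesis by (simp add: first_diff_def)
qed

text \<open>The first letters must agree; removing them keeps the first disagreement at infinity
  while the inspected position drops, so induction on the position applies.\<close>

lemma first_diff_infinity:
  assumes "first_diff \<omega> \<omega>' = \<infinity>" "\<omega> \<in> Omega_star" "\<omega>' \<in> Omega_star"
  shows "\<omega> = \<omega>'"
proof -
  have "\<omega> i = \<omega>' i" for i
    using assms
  proof (induction i arbitrary: \<omega> \<omega>' rule: less_induct)
    case (less i)
    obtain n x where x: "\<omega> = cons n x" "x \<in> Omega_star" using less.prems(2) by (rule star_cases)
    obtain m x' where x': "\<omega>' = cons m x'" "x' \<in> Omega_star" using less.prems(3) by (rule star_cases)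
    have "n = m" using less.prems(1) x x' first_diff_cons_neq[of n m x x'] by auto
    then have "first_diff x x' = \<infinity>" using less.prems(1) x x'
      by (cases "first_diff x x'") (auto simp: first_diff_cons_eq eSuc_enat)
    then have "x (i - Suc n) = x' (i - Suc n)" if "i > n"
      using less.IH[of "i - Suc n" x x'] x x' that by auto
    then show ?case using x x' \<open>n = m\<close> by (simp add: cons_nth)
  qed
  then show ?thesis by auto
qed

lemma d_theta_cons_eq [simp]: "d_theta \<theta> (cons n \<omega>) (cons n \<omega>') = \<theta> * d_theta \<theta> \<omega> \<omega>'"
  by (cases "first_diff \<omega> \<omega>'") (auto simp: d_theta_def first_diff_cons_eq eSuc_enat)

lemma d_theta_cons_neq: "n \<noteq> m \<Longrightarrow> d_theta \<theta> (cons n \<omega>) (cons m \<omega>') = 1"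
  by (simp add: d_theta_def first_diff_cons_neq zero_enat_def)

lemma d_theta_prepend [simp]:
  "d_theta \<theta> (prepend u \<omega>) (prepend u \<omega>') = \<theta> ^ length u * d_theta \<theta> \<omega> \<omega>'"
  by (induction u) auto

lemma d_theta_bounds: "0 < \<theta> \<Longrightarrow> \<theta> < 1 \<Longrightarrow> 0 \<le> d_theta \<theta> \<omega> \<omega>' \<and> d_theta \<theta> \<omega> \<omega>' \<le> 1"
  by (auto simp: d_theta_def power_le_one split: enat.split)

lemma d_theta_sym: "d_theta \<theta> \<omega> \<omega>' = d_theta \<theta> \<omega>' \<omega>"
  by (simp add: d_theta_def first_diff_def eq_commute)

text \<open>Letter 0 is the block made of a single one, so \<open>ones\<close> is the fixed point of
  its branch. Prepending zeros as letters thus brings any point close to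
  \<open>ones\<close>.\<close>

lemma ones_eq_prepend: "prepend (replicate p 0) ones = ones"
  by (induction p) (auto simp: fun_eq_iff cons_nth ones_def)

lemma passage_times_prefix:
  assumes "\<omega> \<in> Omega_star"
  obtains u \<omega>' where "length u = p" "\<omega> = prepend u \<omega>'" "\<omega>' \<in> Omega_star"
  using assms
proof (induction p arbitrary: \<omega> thesis)
  case 0
  then show ?case by (metis list.size(3) prepend_simps(1))
next
  case (Suc p)
  obtain n x where "\<omega> = cons n x" "x \<in> Omega_star" using Suc.prems(2) by (rule star_cases)
  moreover from this(2) obtain u y where "length u = p" "x = prepend u y" "y \<in> Omega_star"
    using Suc.IH by blast
  ultimately show ?case by (intro Suc.prems(1)[of "n # u" y]) auto
qed

lemma prepend_eq_conc:
  "prepend u \<omega> = concat (map (\<lambda>n. replicate n False @ [True]) u) \<frown> \<omega>"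
proof (induction u)
  case (Cons n u)
  then show ?case by (simp only: prepend_simps cons_def list.map concat.simps conc_conc)
qed simp

lemma prepend_nth_shift [simp]: "prepend u \<omega> (tot u + i) = \<omega> i"
proof (induction u)
  case (Cons n u)
  have "prepend (n # u) \<omega> (tot (n # u) + i) = cons n (prepend u \<omega>) (Suc n + (tot u + i))"
    by (simp add: add.assoc)
  then show ?case using Cons by (simp only: cons_nth_add)
qed simp

lemma shift_pow_prepend [simp]: "(shift ^^ tot u) (prepend u \<omega>) = \<omega>"
  by (simp add: shift_pow)

lemma prepend_nth_indep: "i < tot u \<Longrightarrow> prepend u \<omega> i = prepend u \<omega>' i"
  by (induction u arbitrary: i) (auto simp: cons_nth)

lemma prepend_nth_last: "u \<noteq> [] \<Longrightarrow> prepend u \<omega> (tot u - 1)"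
proof (induction u)
  case (Cons n u)
  then show ?case by (cases "u = []") (auto simp: cons_nth)
qed simp

text \<open>Each block contains exactly one symbol 1. Through this the number of ones in a period
  becomes the word length, the divisor in the trace formula.\<close>

lemma card_ones_prepend: "card {i. i < tot u \<and> prepend u \<omega> i} = length u"
proof (induction u)
  case (Cons n u)
  have "{i. i < tot (n # u) \<and> prepend (n # u) \<omega> i} =
      insert n ((+) (Suc n) ` {i. i < tot u \<and> prepend u \<omega> i})"
  proof (intro set_eqI iffI)
    fix i assume i: "i \<in> {i. i < tot (n # u) \<and> prepend (n # u) \<omega> i}"
    then have "i = n \<or> i > n" by (auto simp: cons_nth split: if_splits)
    then show "i \<in> insert n ((+) (Suc n) ` {i. i < tot u \<and> prepend u \<omega> i})"
    proof
      assume "i > n"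
      then have "i = Suc n + (i - Suc n)" by simp
      moreover have "i - Suc n \<in> {i. i < tot u \<and> prepend u \<omega> i}"
        using i \<open>i > n\<close> by (auto simp: cons_nth split: if_splits)
      ultimately show ?thesis by blast
    qed simp
  qed (auto simp: cons_nth)
  moreover have "n \<notin> (+) (Suc n) ` {i. i < tot u \<and> prepend u \<omega> i}" by auto
  moreover have "finite ((+) (Suc n) ` {i. i < tot u \<and> prepend u \<omega> i})" by simp
  moreover have "card ((+) (Suc n) ` {i. i < tot u \<and> prepend u \<omega> i}) = length u"
    using Cons by (subst card_image) auto
  ultimately show ?case by simp
qed simp

lemma prepend_inject:
  assumes "prepend u \<omega> = prepend v \<omega>'" "tot u = tot v"
  shows "u = v"
  using assms
proof (induction u arbitrary: v)
  case (Cons n u)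
  then obtain m v' where v: "v = m # v'" by (cases v) auto
  then have "n = m" "prepend u \<omega> = prepend v' \<omega>'" using Cons.prems by auto
  then show ?case using Cons v by auto
qed (metis tot_eq_0_iff)

text \<open>A one at position n - 1 makes the first n symbols a union of complete blocks; the word
  is found by cutting after the first one and inducting.\<close>

lemma ex_prepend:
  assumes "\<omega> (n - 1)" "n \<ge> 1"
  shows "\<exists>u. tot u = n \<and> u \<noteq> [] \<and> \<omega> = prepend u ((shift ^^ n) \<omega>)"
  using assms
proof (induction n arbitrary: \<omega> rule: less_induct)
  case (less n)
  define m where "m = first_one \<omega>"
  define x where "x = (shift ^^ Suc m) \<omega>"
  have mn: "m \<le> n - 1" unfolding m_def first_one_def using less.prems(1) by (rule Least_le)
  have \<omega>: "\<omega> = cons m x" unfolding m_def x_def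
    by (rule cons_first_one[symmetric]) (use less.prems(1) in blast)
  show ?case
  proof (cases "n = Suc m")
    case True
    then show ?thesis using \<omega> x_def by (intro exI[of _ "[m]"]) auto
  next
    case False
    then have gt: "n > Suc m" using mn less.prems by auto
    then have "x (n - Suc m - 1)" using less.prems \<omega> by (auto simp: cons_nth split: if_splits)
    moreover have "n - Suc m < n" "1 \<le> n - Suc m" using gt by auto
    ultimately obtain u where u: "tot u = n - Suc m" "x = prepend u ((shift ^^ (n - Suc m)) x)"
      using less.IH[of "n - Suc m" x] by blast
    have "(shift ^^ (n - Suc m)) x = (shift ^^ n) \<omega>"
      using gt unfolding x_def shift_pow by auto
    then show ?thesis using u \<omega> gt by (intro exI[of _ "m # u"]) auto
  qed
qed

section \<open>Periodic points as repeated words\<close>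

lemma periodic_point_fixed [simp]: "u \<noteq> [] \<Longrightarrow> prepend u (periodic_point u) = periodic_point u"
  unfolding prepend_eq_conc periodic_point_def by (subst iter_unroll[symmetric]) (cases u, auto)

text \<open>The first \<open>tot u\<close> symbols are dictated by u, and every later symbol copies
  an earlier one.\<close>

lemma fixed_point_unique:
  assumes u: "u \<noteq> []" and x: "prepend u x = x" and y: "prepend u y = y"
  shows "x = y"
proof -
  have pos: "tot u > 0" using u by (cases u) auto
  have "x i = y i" for i
  proof (induction i rule: less_induct)
    case (less i)
    show ?case
    proof (cases "i < tot u")
      case True
      then have "prepend u x i = prepend u y i" by (rule prepend_nth_indep)
      then show ?thesis by (simp only: x y)
    next
      case False
      define j where "j = i - tot u"
      have i: "i = tot u + j" using False by (simp add: j_def)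
      have "x i = x j" using prepend_nth_shift[of u x j] by (simp only: x i)
      moreover have "y i = y j" using prepend_nth_shift[of u y j] by (simp only: y i)
      moreover have "x j = y j" using less[of j] i pos by simp
      ultimately show ?thesis by simp
    qed
  qed
  then show ?thesis by auto
qed

lemma periodic_point_in_star [simp]: "u \<noteq> [] \<Longrightarrow> periodic_point u \<in> Omega_star"
proof -
  assume u: "u \<noteq> []"
  have "periodic_point u (Suc k * tot u - 1)" for k
  proof (induction k)
    case 0
    have "prepend u (periodic_point u) (tot u - 1)" using prepend_nth_last[OF u] .
    then show ?case using u by simp
  next
    case (Suc k)
    have "Suc (Suc k) * tot u - 1 = tot u + (Suc k * tot u - 1)"
      using u by (cases "tot u") auto
    then show ?case using Suc prepend_nth_shift[of u "periodic_point u" "Suc k * tot u - 1"] u by simp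
  qed
  moreover have "Suc k * tot u - 1 \<ge> k" for k using u by (cases "tot u") auto
  ultimately show ?thesis unfolding Omega_star_def infinite_nat_iff_unbounded_le by blast
qed

text \<open>A period window is parsed into whole blocks only if it ends with a one; the other
  nonzero periodic points are reached later by moving the window.\<close>

lemma bij_betw_periodic_point:
  assumes "n \<ge> 1"
  shows "bij_betw periodic_point {u. tot u = n} {\<omega>. (shift ^^ n) \<omega> = \<omega> \<and> \<omega> (n - 1)}"
proof (rule bij_betw_imageI)
  have ne: "u \<noteq> []" if "tot u = n" for u using that assms by auto
  show "inj_on periodic_point {u. tot u = n}"
  proof (rule inj_onI)
    fix u v assume *: "u \<in> {u. tot u = n}" "v \<in> {u. tot u = n}" "periodic_point u = periodic_point v"
    then have "prepend u (periodic_point u) = prepend v (periodic_point u)"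
      using periodic_point_fixed[OF ne, of u] periodic_point_fixed[OF ne, of v] by simp
    then show "u = v" using * prepend_inject by auto
  qed
  show "periodic_point ` {u. tot u = n} = {\<omega>. (shift ^^ n) \<omega> = \<omega> \<and> \<omega> (n - 1)}"
  proof (intro set_eqI iffI)
    fix \<omega> assume "\<omega> \<in> periodic_point ` {u. tot u = n}"
    then obtain u where u: "tot u = n" "\<omega> = periodic_point u" by auto
    then have "prepend u \<omega> = \<omega>" using ne by auto
    then show "\<omega> \<in> {\<omega>. (shift ^^ n) \<omega> = \<omega> \<and> \<omega> (n - 1)}"
      using shift_pow_prepend[of u \<omega>] prepend_nth_last[of u \<omega>] ne u by auto
  next
    fix \<omega> assume "\<omega> \<in> {\<omega>. (shift ^^ n) \<omega> = \<omega> \<and> \<omega> (n - 1)}"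
    then obtain u where "tot u = n" "u \<noteq> []" "\<omega> = prepend u \<omega>"
      using ex_prepend[of \<omega> n] assms by auto
    then have "\<omega> = periodic_point u" using fixed_point_unique[of u \<omega> "periodic_point u"] by auto
    then show "\<omega> \<in> periodic_point ` {u. tot u = n}" using \<open>tot u = n\<close> by auto
  qed
qed

section \<open>Power series on the closed unit disc\<close>

definition psum :: "(nat \<Rightarrow> complex) \<Rightarrow> complex \<Rightarrow> complex" where
  "psum C z = (\<Sum>n. C n * z ^ n)"

lemma norm_mult_power_le:
  fixes c z :: complex
  assumes "norm z \<le> 1"
  shows "norm (c * z ^ n) \<le> norm c"
proof -
  have "norm z ^ n \<le> 1" using assms by (simp add: power_le_one)
  then have "norm c * norm z ^ n \<le> norm c" by (rule mult_left_le) simp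
  then show ?thesis by (simp only: norm_mult norm_power)
qed

lemma psum_summable_norm:
  fixes z :: complex
  assumes "summable (\<lambda>n. norm (C n))" "norm z \<le> 1"
  shows "summable (\<lambda>n. norm (C n * z ^ n))"
proof (rule summable_comparison_test'[OF assms(1), of 0])
  show "norm (norm (C n * z ^ n)) \<le> norm (C n)" for n
    using norm_mult_power_le[OF assms(2)] by simp
qed

lemma continuous_on_psum:
  assumes "summable (\<lambda>n. norm (C n))"
  shows "continuous_on (cball 0 1) (psum C)"
proof -
  have "uniform_limit (cball 0 1) (\<lambda>N z. \<Sum>n<N. C n * z ^ n) (psum C) sequentially"
    unfolding psum_def
  proof (rule Weierstrass_m_test[OF _ assms])
    fix n z assume "z \<in> cball (0::complex) 1"
    then show "norm (C n * z ^ n) \<le> norm (C n)" by (intro norm_mult_power_le) simp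
  qed
  then show ?thesis
    by (rule uniform_limit_theorem[rotated]) (auto intro!: always_eventually continuous_intros)
qed

lemma holomorphic_on_psum:
  assumes "\<And>z. norm z < 1 \<Longrightarrow> summable (\<lambda>n. C n * z ^ n)"
  shows "psum C holomorphic_on ball 0 1"
proof (rule power_series_holomorphic)
  fix w :: complex assume "w \<in> ball 0 1"
  then show "(\<lambda>n. C n * (w - 0) ^ n) sums psum C w"
    using assms unfolding psum_def by (auto intro!: summable_sums)
qed

lemma summable_in_disc:
  assumes "summable (\<lambda>n. norm (C n :: complex))" "norm z < 1"
  shows "summable (\<lambda>n. C n * z ^ n)"
  by (rule summable_norm_cancel[OF psum_summable_norm[OF assms(1) less_imp_le[OF assms(2)]]])

section \<open>Derivatives of power series along the radius to 1\<close>

lemma higher_deriv_psum: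
  assumes "\<And>z. norm z < 1 \<Longrightarrow> summable (\<lambda>n. C n * z ^ n)" "norm z < 1"
  shows "summable (\<lambda>n. (diffs ^^ k) C n * z ^ n) \<and> (deriv ^^ k) (psum C) z = psum ((diffs ^^ k) C) z"
  using assms(2)
proof (induction k arbitrary: z)
  case 0
  then show ?case using assms(1) by simp
next
  case (Suc k)
  obtain r where r: "norm z < r" "r < 1" using Suc.prems dense by blast
  have sm: "summable (\<lambda>n. (diffs ^^ k) C n * of_real r ^ n)"
    using Suc.IH[of "of_real r"] r norm_ge_zero[of z] by simp
  have "((\<lambda>w. \<Sum>n. (diffs ^^ k) C n * w ^ n) has_field_derivative (\<Sum>n. diffs ((diffs ^^ k) C) n * z ^ n)) (at z)"
    by (rule termdiffs_strong[OF sm]) (use r norm_ge_zero[of z] in simp)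
  then have d: "deriv (psum ((diffs ^^ k) C)) z = psum ((diffs ^^ Suc k) C) z"
    unfolding psum_def by (simp add: DERIV_imp_deriv)
  have "(deriv ^^ Suc k) (psum C) z = deriv ((deriv ^^ k) (psum C)) z" by simp
  also have "\<dots> = deriv (psum ((diffs ^^ k) C)) z"
  proof (rule deriv_cong_ev)
    have "\<forall>\<^sub>F w in nhds z. w \<in> ball 0 1" using Suc.prems by (intro eventually_nhds_in_open) auto
    then show "\<forall>\<^sub>F w in nhds z. (deriv ^^ k) (psum C) w = psum ((diffs ^^ k) C) w"
      by eventually_elim (use Suc.IH in auto)
  qed simp
  finally have 1: "(deriv ^^ Suc k) (psum C) z = psum ((diffs ^^ Suc k) C) z" using d by simp
  have "summable (\<lambda>n. diffs ((diffs ^^ k) C) n * z ^ n)"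
    by (rule termdiff_converges[of _ 1]) (use Suc in auto)
  with 1 show ?case by simp
qed

lemma diffs_pow: "(diffs ^^ k) C n = of_nat (\<Prod>i=1..k. n + i) * (C (n + k) :: 'a :: comm_ring_1)"
proof (induction k arbitrary: n)
  case (Suc k)
  have "(\<Prod>i=1..Suc k. n + i) = (n + 1) * (\<Prod>i=1..k. Suc n + i)"
  proof (induction k)
    case (Suc k)
    have "(\<Prod>i=1..Suc (Suc k). n + i) = (\<Prod>i=1..Suc k. n + i) * (n + Suc (Suc k))"
      by (rule prod.cl_ivl_Suc[THEN trans]) simp
    also have "\<dots> = (n + 1) * ((\<Prod>i=1..k. Suc n + i) * (Suc n + Suc k))"
      by (simp only: Suc.IH mult.assoc add_Suc add_Suc_right)
    also have "(\<Prod>i=1..k. Suc n + i) * (Suc n + Suc k) = (\<Prod>i=1..Suc k. Suc n + i)"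
      by (rule prod.cl_ivl_Suc[THEN trans, symmetric]) simp
    finally show ?case .
  qed simp
  then show ?case using Suc[of "Suc n"] by (simp add: diffs_def algebra_simps)
qed simp

lemma summable_power_times:
  assumes "0 \<le> x" "x < (1::real)" "\<And>n. norm (p n :: real) \<le> M"
  shows "summable (\<lambda>n. real n ^ k * p n * x ^ n)"
proof -
  have "summable (\<lambda>n. real n ^ k * y ^ n)" if "norm y < 1" for y
    using that
  proof (induction k arbitrary: y)
    case (Suc k)
    have "summable (\<lambda>n. diffs (\<lambda>n. real n ^ k) n * y ^ n)"
      by (rule termdiff_converges[of _ 1]) (use Suc in auto)
    then have "summable (\<lambda>n. y * (diffs (\<lambda>n. real n ^ k) n * y ^ n))" by (rule summable_mult)
    then have "summable (\<lambda>n. real (Suc n) ^ Suc k * y ^ Suc n)"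
      by (simp add: diffs_def mult_ac)
    then show ?case by (subst (asm) summable_Suc_iff)
  qed (auto intro: summable_geometric)
  then have "summable (\<lambda>n. real n ^ k * x ^ n)" using assms by simp
  then have "summable (\<lambda>n. M * (real n ^ k * x ^ n))" by (rule summable_mult)
  then show ?thesis
  proof (rule summable_comparison_test')
    fix n :: nat
    show "norm (real n ^ k * p n * x ^ n) \<le> M * (real n ^ k * x ^ n)"
      using assms(1) assms(3)[of n] mult_right_mono[OF assms(3)[of n], of "real n ^ k * x ^ n"]
      by (simp add: abs_mult mult_ac)
  qed
qed

text \<open>Differentiation produces rising factorials, which are compared here with pure powers;
  the lower bound rests on \<open>n + k \<le> k * (n + i)\<close> for
  \<open>i \<ge> 1\<close>.\<close>

lemma prod_between:
  assumes "k \<ge> 1"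
  shows "(n + k) ^ k \<le> k ^ k * (\<Prod>i=1..k. n + i)" "(\<Prod>i=1..k. n + i) \<le> (n + k) ^ k"
proof -
  have "(\<Prod>i=1..k. n + k) \<le> (\<Prod>i=1..k. k * (n + i))"
  proof (rule prod_mono)
    fix i assume "i \<in> {1..k}"
    then have "k * (n + i) \<ge> k * (n + 1)" using assms by (intro mult_le_mono) auto
    moreover have "k * (n + 1) \<ge> n + k" using assms by (cases k) auto
    ultimately show "0 \<le> n + k \<and> n + k \<le> k * (n + i)" by linarith
  qed
  then show "(n + k) ^ k \<le> k ^ k * (\<Prod>i=1..k. n + i)" by (simp add: prod.distrib)
  have "(\<Prod>i=1..k. n + i) \<le> (\<Prod>i=1..k. n + k)" by (rule prod_mono) auto
  then show "(\<Prod>i=1..k. n + i) \<le> (n + k) ^ k" by simp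
qed

text \<open>Differentiating k times shifts the index by k; restoring the full power of x costs the
  factor \<open>x ^ k\<close> in the denominator, which is harmless near 1.\<close>

lemma norm_higher_deriv_psum_le:
  assumes "summable (\<lambda>n. norm (C n))" "0 < x" "x < 1"
  shows "norm ((deriv ^^ k) (psum C) (of_real x)) \<le> (\<Sum>n. real n ^ k * norm (C n) * x ^ n) / x ^ k"
proof -
  obtain M where M: "\<And>n. norm (norm (C n)) \<le> M"
    using summable_imp_bounded[OF assms(1)] unfolding bounded_iff by blast
  have sm: "summable (\<lambda>n. real n ^ k * norm (C n) * x ^ n)"
    by (rule summable_power_times) (use assms M in auto)
  have sm': "summable (\<lambda>n. real (n + k) ^ k * norm (C (n + k)) * x ^ (n + k))"
    using sm by (rule summable_ignore_initial_segment)
  have le: "(\<Sum>n. real (n + k) ^ k * norm (C (n + k)) * x ^ (n + k)) \<le> (\<Sum>n. real n ^ k * norm (C n) * x ^ n)"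
    using suminf_split_initial_segment[OF sm, of k] sum_nonneg[of "{..<k}" "\<lambda>n. real n ^ k * norm (C n) * x ^ n"] assms
    by simp
  have sm2: "summable (\<lambda>n. real (n + k) ^ k * norm (C (n + k)) * x ^ n)"
    using summable_divide[OF sm', of "x ^ k"] assms(2) by (simp add: power_add mult.assoc)
  then have eq: "(\<Sum>n. real (n + k) ^ k * norm (C (n + k)) * x ^ (n + k)) = (\<Sum>n. real (n + k) ^ k * norm (C (n + k)) * x ^ n) * x ^ k"
    by (subst suminf_mult2) (simp_all add: power_add mult_ac)
  have d: "(deriv ^^ k) (psum C) (of_real x) = psum ((diffs ^^ k) C) (of_real x)"
    using higher_deriv_psum[of C "of_real x" k] summable_in_disc[OF assms(1)] assms by auto
  have "norm (psum ((diffs ^^ k) C) (of_real x)) \<le> (\<Sum>n. real (n + k) ^ k * norm (C (n + k)) * x ^ n)"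
    unfolding psum_def
  proof (rule norm_suminf_le[OF _ sm2])
    fix n
    have "real (\<Prod>i=1..k. n + i) \<le> real (n + k) ^ k"
      using prod_between(2)[of k n] by (cases "k = 0") (simp_all only: of_nat_power[symmetric] of_nat_le_iff, simp_all)
    then show "norm ((diffs ^^ k) C n * of_real x ^ n) \<le> real (n + k) ^ k * norm (C (n + k)) * x ^ n"
      unfolding diffs_pow norm_mult norm_power norm_of_nat norm_of_real using assms(2)
      by (intro mult_mono power_mono) auto
  qed
  also have "\<dots> \<le> (\<Sum>n. real n ^ k * norm (C n) * x ^ n) / x ^ k"
    using le assms(2) unfolding eq by (simp only: pos_le_divide_eq zero_less_power)
  finally show ?thesis unfolding d .
qed

text \<open>For nonnegative coefficients the norm of the derivative at a positive x is the
  differentiated series itself, so it dominates the moment series of p. The first k terms are lost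
  to the index shift and bounded crudely by \<open>k ^ (k + 1)\<close>.\<close>

lemma suminf_powser_shift_le:
  fixes p :: "nat \<Rightarrow> real"
  assumes p: "\<And>n. 0 \<le> p n" "\<And>n. p n \<le> 1" and k: "k \<ge> 1" and x: "0 < x" "x < 1"
    and C: "\<And>n. C n = complex_of_real (a n)" "summable a" "\<And>n. c * p n \<le> a n" "\<And>n. 0 \<le> a n" and c: "c > 0"
  shows "(\<Sum>n. real n ^ k * p n * x ^ n) \<le> real k ^ (k + 1) + real k ^ k / c * norm ((deriv ^^ k) (psum C) (of_real x))"
proof -
  have smC: "summable (\<lambda>n. norm (C n))" using C by simp
  have sm: "summable (\<lambda>n. real n ^ k * p n * x ^ n)"
    by (rule summable_power_times[of _ _ 1]) (use assms in auto)
  have D: "summable (\<lambda>n. (diffs ^^ k) C n * of_real x ^ n)"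
    "(deriv ^^ k) (psum C) (of_real x) = psum ((diffs ^^ k) C) (of_real x)"
    using higher_deriv_psum[of C "of_real x" k] summable_in_disc[OF smC] x by auto
  define t where "t n = real (\<Prod>i=1..k. n + i) * a (n + k) * x ^ n" for n
  have t: "(diffs ^^ k) C n * of_real x ^ n = of_real (t n)" for n
    unfolding diffs_pow C(1) t_def by (simp only: of_real_mult of_real_of_nat_eq of_real_power)
  have smt: "summable t" using D(1) unfolding t summable_complex_of_real .
  have "psum ((diffs ^^ k) C) (of_real x) = of_real (suminf t)"
    unfolding psum_def t using smt by (simp add: suminf_of_real)
  moreover have t0: "0 \<le> t n" for n unfolding t_def using C(4) x by (intro mult_nonneg_nonneg of_nat_0_le_iff) auto
  ultimately have nd: "norm ((deriv ^^ k) (psum C) (of_real x)) = suminf t"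
    using D(2) suminf_nonneg[OF smt] by simp
  have "(\<Sum>n. real n ^ k * p n * x ^ n) =
      (\<Sum>n. real (n + k) ^ k * p (n + k) * x ^ (n + k)) + (\<Sum>n<k. real n ^ k * p n * x ^ n)"
    by (rule suminf_split_initial_segment[OF sm])
  also have "(\<Sum>n<k. real n ^ k * p n * x ^ n) \<le> (\<Sum>n<k. real k ^ k * 1 * 1)"
    using p x by (intro sum_mono mult_mono power_mono power_le_one) auto
  also have "\<dots> = real k ^ (k + 1)" by simp
  also have "(\<Sum>n. real (n + k) ^ k * p (n + k) * x ^ (n + k)) \<le> (\<Sum>n. real k ^ k / c * t n)"
  proof (rule suminf_le)
    show "summable (\<lambda>n. real (n + k) ^ k * p (n + k) * x ^ (n + k))"
      using sm by (rule summable_ignore_initial_segment)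
    show "summable (\<lambda>n. real k ^ k / c * t n)" using smt by (rule summable_mult)
    fix n
    have "real (n + k) ^ k \<le> real k ^ k * real (\<Prod>i=1..k. n + i)"
      using prod_between(1)[OF k, of n] by (simp only: of_nat_power[symmetric] of_nat_mult[symmetric] of_nat_le_iff)
    moreover have "p (n + k) \<le> a (n + k) / c" using C(3)[of "n + k"] c by (simp add: field_simps)
    moreover have "x ^ (n + k) \<le> x ^ n" using x by (intro power_decreasing) auto
    ultimately have "real (n + k) ^ k * p (n + k) * x ^ (n + k) \<le>
        real k ^ k * real (\<Prod>i=1..k. n + i) * (a (n + k) / c) * x ^ n"
      using p x C(4) c by (intro mult_mono mult_nonneg_nonneg) (auto intro!: prod_nonneg divide_nonneg_pos)
    then show "real (n + k) ^ k * p (n + k) * x ^ (n + k) \<le> real k ^ k / c * t n"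
      by (simp add: t_def)
  qed
  also have "(\<Sum>n. real k ^ k / c * t n) = real k ^ k / c * suminf t" using smt by (rule suminf_mult)
  finally show ?thesis unfolding nd by simp
qed

text \<open>With E = exp f one has E' = f' E, and Leibniz' rule expresses each derivative of E by
  lower derivatives of E and derivatives of f. The one of f of order k enters once, linearly and
  with the bounded factor E, and so sets the size at order k.\<close>

lemma higher_deriv_exp_bigo:
  fixes f :: "complex \<Rightarrow> complex"
  assumes hol: "f holomorphic_on S" "open S" and ev: "\<forall>\<^sub>F x in F. \<gamma> x \<in> S"
    and f0: "(\<lambda>x. exp (f (\<gamma> x))) \<in> O[F](\<lambda>_. 1)"
    and fi: "\<And>i. 1 \<le> i \<Longrightarrow> i < k \<Longrightarrow> (\<lambda>x. (deriv ^^ i) f (\<gamma> x)) \<in> O[F](\<lambda>_. 1)"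
  shows "i < k \<Longrightarrow> (\<lambda>x. (deriv ^^ i) (\<lambda>z. exp (f z)) (\<gamma> x)) \<in> O[F](\<lambda>_. 1)"
    and "k \<ge> 1 \<Longrightarrow> (\<lambda>x. (deriv ^^ k) (\<lambda>z. exp (f z)) (\<gamma> x)) \<in> O[F](\<lambda>x. complex_of_real (1 + norm ((deriv ^^ k) f (\<gamma> x))))"
proof -
  define E where "E = (\<lambda>z. exp (f z))"
  have holE: "E holomorphic_on S" unfolding E_def using hol by (intro holomorphic_intros)
  have hold: "deriv f holomorphic_on S" using hol by (rule holomorphic_deriv)
  have step: "\<forall>\<^sub>F x in F. (deriv ^^ Suc i) E (\<gamma> x) =
      (\<Sum>j=0..i. of_nat (i choose j) * (deriv ^^ Suc j) f (\<gamma> x) * (deriv ^^ (i - j)) E (\<gamma> x))" for i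
    using ev
  proof eventually_elim
    case (elim x)
    have "(deriv ^^ Suc i) E (\<gamma> x) = (deriv ^^ i) (deriv E) (\<gamma> x)" by (simp add: funpow_Suc_right del: funpow.simps)
    also have "\<dots> = (deriv ^^ i) (\<lambda>w. deriv f w * E w) (\<gamma> x)"
    proof (rule higher_deriv_transform_within_open[of _ S])
      show "deriv E holomorphic_on S" using holE hol(2) by (rule holomorphic_deriv)
      show "(\<lambda>w. deriv f w * E w) holomorphic_on S" using hold holE by (rule holomorphic_on_mult)
      fix w assume w: "w \<in> S"
      have "(f has_field_derivative deriv f w) (at w)" using hol w by (rule holomorphic_derivI)
      then show "deriv E w = deriv f w * E w" unfolding E_def
        by (intro DERIV_imp_deriv) (auto intro!: derivative_eq_intros)
    qed (use elim hol in auto)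
    also have "\<dots> = (\<Sum>j=0..i. of_nat (i choose j) * (deriv ^^ j) (deriv f) (\<gamma> x) * (deriv ^^ (i - j)) E (\<gamma> x))"
      by (rule higher_deriv_mult[OF hold holE hol(2) elim])
    finally show ?case by (simp add: funpow_Suc_right del: funpow.simps)
  qed
  have E: "(\<lambda>x. (deriv ^^ i) E (\<gamma> x)) \<in> O[F](\<lambda>_. 1)" if "i < k" for i
    using that
  proof (induction i rule: less_induct)
    case (less i)
    show ?case
    proof (cases i)
      case 0
      then show ?thesis using f0 by (simp add: E_def)
    next
      case (Suc m)
      have "(\<lambda>x. of_nat (m choose j) * (deriv ^^ Suc j) f (\<gamma> x) * (deriv ^^ (m - j)) E (\<gamma> x)) \<in> O[F](\<lambda>_. 1)"
        if "j \<in> {0..m}" for j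
        by (intro landau_o.big.mult_in_1 fi less.IH) (use that Suc less.prems in auto)
      then have "(\<lambda>x. \<Sum>j=0..m. of_nat (m choose j) * (deriv ^^ Suc j) f (\<gamma> x) * (deriv ^^ (m - j)) E (\<gamma> x)) \<in> O[F](\<lambda>_. 1)"
        by (rule big_sum_in_bigo)
      then show ?thesis unfolding Suc by (subst landau_o.big.in_cong[OF step])
    qed
  qed
  then show "i < k \<Longrightarrow> (\<lambda>x. (deriv ^^ i) (\<lambda>z. exp (f z)) (\<gamma> x)) \<in> O[F](\<lambda>_. 1)" for i
    unfolding E_def .
  show "(\<lambda>x. (deriv ^^ k) (\<lambda>z. exp (f z)) (\<gamma> x)) \<in> O[F](\<lambda>x. complex_of_real (1 + norm ((deriv ^^ k) f (\<gamma> x))))" if k: "k \<ge> 1"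
  proof -
    obtain m where m: "k = Suc m" using k by (cases k) auto
    let ?B = "\<lambda>x. complex_of_real (1 + norm ((deriv ^^ k) f (\<gamma> x)))"
    have one: "(\<lambda>_. 1) \<in> O[F](?B)"
      by (intro bigoI[of _ 1] always_eventually) (simp only: norm_of_real, simp)
    have big: "(\<lambda>x. (deriv ^^ Suc j) f (\<gamma> x)) \<in> O[F](?B)" if "j \<in> {0..m}" for j
    proof (cases "j = m")
      case True
      then show ?thesis unfolding m by (intro bigoI[of _ 1] always_eventually) (simp only: norm_of_real, simp)
    next
      case False
      then have "(\<lambda>x. (deriv ^^ Suc j) f (\<gamma> x)) \<in> O[F](\<lambda>_. 1)" using that m by (intro fi) auto
      then show ?thesis using one by (rule landau_o.big_trans)
    qed
    have "(\<lambda>x. of_nat (m choose j) * (deriv ^^ Suc j) f (\<gamma> x) * (deriv ^^ (m - j)) E (\<gamma> x)) \<in> O[F](?B)"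
      if "j \<in> {0..m}" for j
    proof -
      have "(\<lambda>x. of_nat (m choose j) * (deriv ^^ Suc j) f (\<gamma> x)) \<in> O[F](?B)"
        using big[OF that] by simp
      moreover have "(\<lambda>x. (deriv ^^ (m - j)) E (\<gamma> x)) \<in> O[F](\<lambda>_. 1)" using that m by (intro E) auto
      ultimately show ?thesis using landau_o.big.mult by fastforce
    qed
    then have "(\<lambda>x. \<Sum>j=0..m. of_nat (m choose j) * (deriv ^^ Suc j) f (\<gamma> x) * (deriv ^^ (m - j)) E (\<gamma> x)) \<in> O[F](?B)"
      by (rule big_sum_in_bigo)
    then show ?thesis unfolding m E_def[symmetric] by (subst landau_o.big.in_cong[OF step])
  qed
qed

text \<open>Here q is what a pole of the zeta function would provide. In the k-th derivative of q
  exp G every term is bounded except the one with the k-th derivative of exp G, and that one carries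
  the factor q = O(1 - x). As a dominates p, the moment series m satisfies m(x) \<le> const + o(1)
  m(x), hence stays bounded, against the divergence of the k-th moment.\<close>

lemma no_holomorphic_continuation:
  fixes p a :: "nat \<Rightarrow> real" and g :: "nat \<Rightarrow> complex" and q :: "complex \<Rightarrow> complex"
  assumes p: "\<And>n. 0 \<le> p n" "\<And>n. p n \<le> 1" and k: "k \<ge> 1" and nsm: "\<not> summable (\<lambda>n. real n ^ k * p n)"
    and a: "a sums 1" "\<And>n. c * p n \<le> a n" "\<And>n. 0 \<le> a n" and c: "c > 0"
    and g: "summable (\<lambda>n. norm (g n))" "summable (\<lambda>n. real n ^ (k - 1) * norm (g n))"
    and gk: "\<And>x. 0 < x \<Longrightarrow> x < 1 \<Longrightarrow> (\<Sum>n. real n ^ k * norm (g n) * x ^ n) \<le> K * (\<Sum>n. real n ^ k * p n * x ^ n)"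
    and \<rho>: "\<rho> > 0" and q: "q holomorphic_on ball 1 \<rho>"
    and eq: "\<And>z. z \<in> ball 0 1 \<inter> ball 1 \<rho> \<Longrightarrow> q z = (1 - psum (\<lambda>n. of_real (a n)) z) * exp (- psum g z)"
  shows False
proof -
  let ?F = "at_left (1::real)"
  let ?r = "complex_of_real"
  define A where "A = psum (\<lambda>n. of_real (a n))"
  define G where "G = psum g"
  define U where "U = ball (0::complex) 1 \<inter> ball 1 \<rho>"
  define m where "m x = (\<Sum>n. real n ^ k * p n * x ^ n)" for x
  have smm: "summable (\<lambda>n. real n ^ k * p n * x ^ n)" if "0 < x" "x < 1" for x
    by (rule summable_power_times[of _ _ 1]) (use p that in auto)
  have m0: "0 \<le> m x" if "0 < x" "x < 1" for x
    unfolding m_def by (rule suminf_nonneg[OF smm]) (use p that in auto)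
  have ev: "\<forall>\<^sub>F x in ?F. x \<in> {1/2<..<1}" by (rule eventually_at_left_real) simp
  have lim1: "(?r \<longlongrightarrow> 1) ?F"
    using tendsto_of_real[OF tendsto_ident_at[of "1::real" "{..<1}"], where 'a=complex] by simp
  have evU: "\<forall>\<^sub>F x in ?F. ?r x \<in> U"
  proof -
    have "\<forall>\<^sub>F x in ?F. ?r x \<in> ball 1 \<rho>" using lim1 \<rho> by (intro topological_tendstoD) auto
    with ev show ?thesis by eventually_elim (auto simp: U_def)
  qed
  have evb: "\<forall>\<^sub>F x in ?F. ?r x \<in> ball 0 1" using evU by eventually_elim (simp add: U_def)
  have holG: "G holomorphic_on ball 0 1" unfolding G_def
    by (rule holomorphic_on_psum) (rule summable_in_disc[OF g(1)])
  have sma: "summable (\<lambda>n. norm (?r (a n)))" using a by (simp add: sums_iff)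
  have holA: "A holomorphic_on ball 0 1" unfolding A_def
    by (rule holomorphic_on_psum) (rule summable_in_disc[OF sma])
  have E0: "(\<lambda>x. exp (G (?r x))) \<in> O[?F](\<lambda>_. 1)"
  proof (rule bigoI)
    show "\<forall>\<^sub>F x in ?F. norm (exp (G (?r x))) \<le> exp (\<Sum>n. norm (g n)) * norm (1::complex)"
      using evb
    proof eventually_elim
      case (elim x)
      have "norm (G (?r x)) \<le> (\<Sum>n. norm (g n))"
        unfolding G_def psum_def
        by (rule norm_suminf_le[OF _ g(1)]) (use elim in \<open>auto intro!: norm_mult_power_le\<close>)
      then show ?case using norm_exp[of "G (?r x)"] by (simp add: order_trans)
    qed
  qed
  \<comment> \<open>The restriction to x > 1/2 limits the loss \<open>1 / x ^ i\<close> to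
    \<open>2 ^ i\<close>.\<close>
  have bnd: "\<forall>\<^sub>F x in ?F. norm ((deriv ^^ i) G (?r x)) \<le> 2 ^ i * (\<Sum>n. real n ^ i * norm (g n) * x ^ n)" for i
    using ev
  proof eventually_elim
    case (elim x)
    have "norm ((deriv ^^ i) G (?r x)) \<le> (\<Sum>n. real n ^ i * norm (g n) * x ^ n) / x ^ i"
      unfolding G_def by (rule norm_higher_deriv_psum_le[OF g(1)]) (use elim in auto)
    also have "\<dots> \<le> (\<Sum>n. real n ^ i * norm (g n) * x ^ n) / (1/2) ^ i"
    proof -
      obtain M where M: "\<And>n. norm (norm (g n)) \<le> M"
        using summable_imp_bounded[OF g(1)] unfolding bounded_iff by blast
      have "0 \<le> (\<Sum>n. real n ^ i * norm (g n) * x ^ n)"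
        by (rule suminf_nonneg[OF summable_power_times[of _ _ M]]) (use elim M in auto)
      moreover have "(1/2) ^ i \<le> x ^ i" using elim by (intro power_mono) auto
      ultimately show ?thesis using elim by (intro divide_left_mono) auto
    qed
    finally show ?case by (simp add: field_simps)
  qed
  have fi: "(\<lambda>x. (deriv ^^ i) G (?r x)) \<in> O[?F](\<lambda>_. 1)" if i: "1 \<le> i" "i < k" for i
  proof (rule bigoI)
    show "\<forall>\<^sub>F x in ?F. norm ((deriv ^^ i) G (?r x)) \<le> 2 ^ i * (\<Sum>n. real n ^ (k - 1) * norm (g n)) * norm (1::complex)"
      using bnd[of i] ev
    proof eventually_elim
      case (elim x)
      have le: "real n ^ i * norm (g n) * x ^ n \<le> real n ^ (k - 1) * norm (g n)" for n
      proof (cases "n = 0")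
        case False
        have "real n ^ i * norm (g n) * x ^ n \<le> real n ^ (k - 1) * norm (g n) * 1"
          using elim i False by (intro mult_mono power_increasing power_le_one) auto
        then show ?thesis by simp
      qed (use i in \<open>simp add: power_0_left\<close>)
      have "(\<Sum>n. real n ^ i * norm (g n) * x ^ n) \<le> (\<Sum>n. real n ^ (k - 1) * norm (g n))"
      proof (rule suminf_le[OF le _ g(2)])
        show "summable (\<lambda>n. real n ^ i * norm (g n) * x ^ n)"
          by (rule summable_comparison_test'[OF g(2), of 0]) (use le elim in auto)
      qed
      then have "2 ^ i * (\<Sum>n. real n ^ i * norm (g n) * x ^ n) \<le> 2 ^ i * (\<Sum>n. real n ^ (k - 1) * norm (g n))"
        by (intro mult_left_mono) auto
      from order_trans[OF elim(1) this] show ?case by (simp only: norm_one mult_1_right)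
    qed
  qed
  have Ei: "(\<lambda>x. (deriv ^^ i) (\<lambda>z. exp (G z)) (?r x)) \<in> O[?F](\<lambda>_. 1)" if "i < k" for i
    using higher_deriv_exp_bigo(1)[OF holG open_ball evb E0 fi that] by simp
  have "(\<lambda>x. (deriv ^^ k) (\<lambda>z. exp (G z)) (?r x)) \<in> O[?F](\<lambda>x. ?r (1 + norm ((deriv ^^ k) G (?r x))))"
    using higher_deriv_exp_bigo(2)[OF holG open_ball evb E0 fi k] by simp
  also have "(\<lambda>x. ?r (1 + norm ((deriv ^^ k) G (?r x)))) \<in> O[?F](\<lambda>x. ?r (1 + m x))"
  proof (rule bigoI)
    show "\<forall>\<^sub>F x in ?F. norm (?r (1 + norm ((deriv ^^ k) G (?r x)))) \<le> (1 + 2 ^ k * \<bar>K\<bar>) * norm (?r (1 + m x))"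
      using bnd[of k] ev
    proof eventually_elim
      case (elim x)
      have "norm ((deriv ^^ k) G (?r x)) \<le> 2 ^ k * (\<Sum>n. real n ^ k * norm (g n) * x ^ n)" using elim by simp
      also have "\<dots> \<le> 2 ^ k * (K * m x)"
        using gk[of x] elim unfolding m_def by (intro mult_left_mono) auto
      also have "\<dots> \<le> 2 ^ k * (\<bar>K\<bar> * m x)"
        using m0[of x] elim by (intro mult_left_mono mult_right_mono) auto
      finally have "1 + norm ((deriv ^^ k) G (?r x)) \<le> 1 + 2 ^ k * \<bar>K\<bar> * m x" by (simp only: mult.assoc add_left_mono)
      also have "\<dots> \<le> (1 + 2 ^ k * \<bar>K\<bar>) * (1 + m x)"
        using m0[of x] elim by (simp add: distrib_left distrib_right)
      finally show ?case using m0[of x] elim unfolding norm_of_real by simp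
    qed
  qed
  finally have Ek: "(\<lambda>x. (deriv ^^ k) (\<lambda>z. exp (G z)) (?r x)) \<in> O[?F](\<lambda>x. ?r (1 + m x))" .

  have qj: "(\<lambda>x. (deriv ^^ j) q (?r x)) \<in> O[?F](\<lambda>_. 1)" for j
  proof -
    have "continuous_on (ball 1 \<rho>) ((deriv ^^ j) q)"
      by (intro holomorphic_on_imp_continuous_on holomorphic_higher_deriv q open_ball)
    then have "isCont ((deriv ^^ j) q) 1" using \<rho> by (simp add: continuous_on_eq_continuous_at)
    then have "((\<lambda>x. (deriv ^^ j) q (?r x)) \<longlongrightarrow> (deriv ^^ j) q 1) ?F"
      using lim1 by (rule isCont_tendsto_compose)
    then show ?thesis by (intro bigoI_tendsto[where c="(deriv ^^ j) q 1"]) auto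
  qed
  \<comment> \<open>Radially q tends to (1 - A 1) exp (- G 1), and A 1 = 1 because the coefficients
    a sum to 1.\<close>
  have q1: "q 1 = 0"
  proof -
    have "isCont q 1" using holomorphic_on_imp_continuous_on[OF q] \<rho>
      by (simp add: continuous_on_eq_continuous_at)
    then have l1: "((\<lambda>x. q (?r x)) \<longlongrightarrow> q 1) ?F" using lim1 by (rule isCont_tendsto_compose)
    have evc: "\<forall>\<^sub>F x in ?F. ?r x \<in> cball 0 1" using evb by eventually_elim auto
    have cA: "((\<lambda>x. A (?r x)) \<longlongrightarrow> A 1) ?F" unfolding A_def
      by (rule continuous_on_tendsto_compose[OF continuous_on_psum[OF sma] lim1]) (use evc in auto)
    have cG: "((\<lambda>x. G (?r x)) \<longlongrightarrow> G 1) ?F" unfolding G_def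
      by (rule continuous_on_tendsto_compose[OF continuous_on_psum[OF g(1)] lim1]) (use evc in auto)
    have "((\<lambda>x. (1 - A (?r x)) * exp (- G (?r x))) \<longlongrightarrow> (1 - A 1) * exp (- G 1)) ?F"
      by (intro tendsto_intros cA cG)
    moreover have "A 1 = 1"
      using a(1) unfolding A_def psum_def by (simp add: sums_iff suminf_of_real[symmetric])
    moreover have "\<forall>\<^sub>F x in ?F. (1 - A (?r x)) * exp (- G (?r x)) = q (?r x)"
      using evU by eventually_elim (simp add: eq U_def A_def G_def)
    ultimately have "((\<lambda>x. q (?r x)) \<longlongrightarrow> 0) ?F" using filterlim_cong by force
    then show ?thesis using tendsto_unique[OF _ l1] by simp
  qed
  have q0: "(\<lambda>x. q (?r x)) \<in> O[?F](\<lambda>x. ?r (1 - x))"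
  proof -
    have "(q has_field_derivative deriv q 1) (at 1)" using \<rho> q by (intro holomorphic_derivI) auto
    then have "((\<lambda>y. (q y - q 1) / (y - 1)) \<longlongrightarrow> deriv q 1) (at 1)"
      by (simp add: has_field_derivative_iff)
    moreover have "filterlim ?r (at 1) ?F"
      using lim1 ev by (auto simp: filterlim_at elim: eventually_mono)
    ultimately have "((\<lambda>x. (q (?r x) - q 1) / (?r x - 1)) \<longlongrightarrow> deriv q 1) ?F" by (rule filterlim_compose)
    then have "(\<lambda>x. q (?r x)) \<in> O[?F](\<lambda>x. ?r x - 1)"
      unfolding q1 by (intro bigoI_tendsto) (use ev in \<open>auto elim: eventually_mono\<close>)
    also have "(\<lambda>x. ?r x - 1) \<in> O[?F](\<lambda>x. ?r (1 - x))"
      by (intro bigoI[of _ 1] always_eventually) (simp add: norm_minus_commute)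
    finally show ?thesis .
  qed
  have der: "\<forall>\<^sub>F x in ?F. (deriv ^^ k) A (?r x) =
      - (\<Sum>i=0..k. of_nat (k choose i) * (deriv ^^ i) (\<lambda>z. exp (G z)) (?r x) * (deriv ^^ (k - i)) q (?r x))"
    using evU
  proof eventually_elim
    case (elim x)
    have oU: "open U" by (auto simp: U_def)
    have hE: "(\<lambda>z. exp (G z)) holomorphic_on U"
      by (rule holomorphic_on_subset[of _ "ball 0 1"]) (use holG in \<open>auto intro!: holomorphic_intros simp: U_def\<close>)
    have hq: "q holomorphic_on U" using q by (rule holomorphic_on_subset) (simp add: U_def)
    have hA: "A holomorphic_on U" using holA by (rule holomorphic_on_subset) (simp add: U_def)
    have hP: "(\<lambda>z. exp (G z) * q z) holomorphic_on U" using hE hq by (rule holomorphic_on_mult)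
    have "(deriv ^^ k) A (?r x) = (deriv ^^ k) (\<lambda>z. 1 - exp (G z) * q z) (?r x)"
    proof (rule higher_deriv_transform_within_open[OF hA _ oU elim])
      show "(\<lambda>z. 1 - exp (G z) * q z) holomorphic_on U" using hP by (intro holomorphic_on_diff) auto
      fix z assume "z \<in> U"
      then have "q z = (1 - A z) * exp (- G z)" unfolding A_def G_def U_def by (rule eq)
      then show "A z = 1 - exp (G z) * q z" by (simp add: exp_minus field_simps)
    qed
    also have "\<dots> = (deriv ^^ k) (\<lambda>z. 1) (?r x) - (deriv ^^ k) (\<lambda>z. exp (G z) * q z) (?r x)"
      by (rule higher_deriv_diff[OF _ hP oU elim]) simp
    also have "(deriv ^^ k) (\<lambda>z. exp (G z) * q z) (?r x) =
        (\<Sum>i=0..k. of_nat (k choose i) * (deriv ^^ i) (\<lambda>z. exp (G z)) (?r x) * (deriv ^^ (k - i)) q (?r x))"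
      by (rule higher_deriv_mult[OF hE hq oU elim])
    finally show ?case using k by simp
  qed
  \<comment> \<open>The second summand is the product of the bound 1 + m x for the k-th derivative
    of exp G with the bound 1 - x for q; everything else is O(1).\<close>
  let ?H = "\<lambda>x. ?r (1 + (1 - x) * (1 + m x))"
  have one: "(\<lambda>_. 1) \<in> O[?F](?H)"
  proof (rule bigoI[of _ 1], use ev in eventually_elim)
    case (elim x)
    then have "0 \<le> (1 - x) * (1 + m x)" using m0[of x] by (intro mult_nonneg_nonneg) auto
    then show ?case by (simp only: norm_of_real, simp)
  qed
  have "(\<lambda>x. of_nat (k choose i) * (deriv ^^ i) (\<lambda>z. exp (G z)) (?r x) * (deriv ^^ (k - i)) q (?r x)) \<in> O[?F](?H)"
    if "i \<in> {0..k}" for i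
  proof (cases "i = k")
    case False
    then have "(\<lambda>x. of_nat (k choose i) * (deriv ^^ i) (\<lambda>z. exp (G z)) (?r x) * (deriv ^^ (k - i)) q (?r x)) \<in> O[?F](\<lambda>_. 1)"
      using that by (intro landau_o.big.mult_in_1 Ei qj) auto
    then show ?thesis using one by (rule landau_o.big_trans)
  next
    case True
    have "(\<lambda>x. (deriv ^^ k) (\<lambda>z. exp (G z)) (?r x) * q (?r x)) \<in> O[?F](\<lambda>x. ?r (1 + m x) * ?r (1 - x))"
      using Ek q0 by (rule landau_o.big.mult)
    also have "(\<lambda>x. ?r (1 + m x) * ?r (1 - x)) \<in> O[?F](?H)"
    proof (rule bigoI[of _ 1], use ev in eventually_elim)
      case (elim x)
      then have "0 \<le> (1 + m x) * (1 - x)" using m0[of x] by (intro mult_nonneg_nonneg) auto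
      then show ?case unfolding of_real_mult[symmetric] norm_of_real by (simp add: mult.commute)
    qed
    finally show ?thesis by (simp add: True)
  qed
  then have "(\<lambda>x. \<Sum>i=0..k. of_nat (k choose i) * (deriv ^^ i) (\<lambda>z. exp (G z)) (?r x) * (deriv ^^ (k - i)) q (?r x)) \<in> O[?F](?H)"
    by (rule big_sum_in_bigo)
  then have "(\<lambda>x. (deriv ^^ k) A (?r x)) \<in> O[?F](?H)"
    by (subst landau_o.big.in_cong[OF der]) simp
  then obtain R where R: "R > 0" "\<forall>\<^sub>F x in ?F. norm ((deriv ^^ k) A (?r x)) \<le> R * norm (?H x)"
    by (rule landau_o.bigE)
  define c1 where "c1 = real k ^ (k + 1)"
  define c2 where "c2 = real k ^ k / c"
  have c12: "0 \<le> c1" "0 \<le> c2" using c by (auto simp: c1_def c2_def)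
  \<comment> \<open>Once \<open>(1 - x) * (c2 * R)\<close> is below 1/2, the term with m x on the
    right can be absorbed on the left; solving for m x gives \<open>Mb\<close>.\<close>
  have "((\<lambda>x. (1 - x) * (c2 * R)) \<longlongrightarrow> (1 - 1) * (c2 * R)) ?F" by (intro tendsto_intros)
  then have evs: "\<forall>\<^sub>F x in ?F. (1 - x) * (c2 * R) < 1/2" by (rule order_tendstoD) simp
  define Mb where "Mb = 2 * c1 + 2 * (c2 * R) + 1"
  have mb: "\<forall>\<^sub>F x in ?F. m x \<le> Mb"
    using R(2) evs ev
  proof eventually_elim
    case (elim x)
    have x: "0 < x" "x < 1" using elim by auto
    have "m x \<le> c1 + c2 * norm ((deriv ^^ k) A (?r x))"
      unfolding m_def c1_def c2_def A_def
      by (rule suminf_powser_shift_le[OF p k x]) (use a c in \<open>auto simp: sums_iff\<close>)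
    also have "c1 + c2 * norm ((deriv ^^ k) A (?r x)) \<le> c1 + c2 * (R * (1 + (1 - x) * (1 + m x)))"
    proof (intro add_left_mono mult_left_mono c12)
      have "0 \<le> (1 - x) * (1 + m x)" using m0[OF x] x by (intro mult_nonneg_nonneg) auto
      then show "norm ((deriv ^^ k) A (?r x)) \<le> R * (1 + (1 - x) * (1 + m x))"
        using elim unfolding norm_of_real by simp
    qed
    also have "c1 + c2 * (R * (1 + (1 - x) * (1 + m x))) = c1 + c2 * R + (1 - x) * (c2 * R) * (1 + m x)"
      by (simp add: algebra_simps)
    also have "(1 - x) * (c2 * R) * (1 + m x) \<le> 1/2 * (1 + m x)"
      using elim m0[OF x] by (intro mult_right_mono) auto
    finally have "m x \<le> c1 + c2 * R + 1/2 * (1 + m x)" by simp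
    moreover have "a \<le> b + e + 1/2 * (1 + a) \<Longrightarrow> a \<le> 2 * b + 2 * e + 1" for a b e :: real
      by (simp add: field_simps)
    ultimately show ?case unfolding Mb_def by blast
  qed
  \<comment> \<open>A bound on m uniform in x < 1 bounds every partial sum in the limit x =
    1.\<close>
  have "summable (\<lambda>n. real n ^ k * p n)"
  proof (rule summableI_nonneg_bounded)
    show "0 \<le> real n ^ k * p n" for n using p by simp
    fix N
    have "((\<lambda>x. \<Sum>n<N. real n ^ k * p n * x ^ n) \<longlongrightarrow> (\<Sum>n<N. real n ^ k * p n * 1 ^ n)) ?F"
      by (intro tendsto_intros)
    moreover have "\<forall>\<^sub>F x in ?F. (\<Sum>n<N. real n ^ k * p n * x ^ n) \<le> Mb"
      using mb ev
    proof eventually_elim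
      case (elim x)
      have "(\<Sum>n<N. real n ^ k * p n * x ^ n) \<le> m x" unfolding m_def
        by (rule sum_le_suminf[OF smm]) (use elim p in auto)
      then show ?case using elim by simp
    qed
    ultimately have "(\<Sum>n<N. real n ^ k * p n * 1 ^ n) \<le> Mb"
      by (rule tendsto_upperbound) simp
    then show "(\<Sum>n<N. real n ^ k * p n) \<le> Mb" by simp
  qed
  with nsm show False by simp
qed

section \<open>The defect 1 - P(z) of a probability generating function on the closed disc\<close>

lemma sum_terms_one_minus_power:
  fixes a :: "nat \<Rightarrow> real" and z :: complex
  assumes a: "a sums 1" "\<And>n. 0 \<le> a n" and z: "norm z \<le> 1"
  shows "(\<lambda>n. of_real (a n) * (1 - z ^ n)) sums (1 - psum (\<lambda>n. of_real (a n)) z)"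
    and "(\<lambda>n. a n * (1 - Re (z ^ n))) sums Re (1 - psum (\<lambda>n. of_real (a n)) z)"
    and "0 \<le> a n * (1 - Re (z ^ n))"
proof -
  have sma: "summable (\<lambda>n. norm (complex_of_real (a n)))" using a by (simp add: sums_iff)
  have "(\<lambda>n. complex_of_real (a n)) sums 1" using a(1) by (metis of_real_1 sums_of_real)
  moreover have "(\<lambda>n. of_real (a n) * z ^ n) sums psum (\<lambda>n. of_real (a n)) z"
    unfolding psum_def by (rule summable_sums[OF summable_norm_cancel[OF psum_summable_norm[OF sma z]]])
  ultimately have "(\<lambda>n. of_real (a n) - of_real (a n) * z ^ n) sums (1 - psum (\<lambda>n. of_real (a n)) z)"
    by (rule sums_diff)
  then show 1: "(\<lambda>n. of_real (a n) * (1 - z ^ n)) sums (1 - psum (\<lambda>n. of_real (a n)) z)"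
    by (simp add: algebra_simps)
  show "(\<lambda>n. a n * (1 - Re (z ^ n))) sums Re (1 - psum (\<lambda>n. of_real (a n)) z)"
    using sums_Re[OF 1] by simp
  have "Re (z ^ n) \<le> norm z ^ n" by (metis complex_Re_le_cmod norm_power)
  also have "\<dots> \<le> 1" using z by (simp add: power_le_one)
  finally show "0 \<le> a n * (1 - Re (z ^ n))" using a by simp
qed

text \<open>The real part of 1 - P is a sum of nonnegative terms, so its vanishing kills the term n
  = 1 by itself. The positive weight at 1 plays the part of aperiodicity: Re z = 1 leaves only z = 1
  in the closed disc.\<close>

lemma psum_ne_1:
  fixes a :: "nat \<Rightarrow> real" and z :: complex
  assumes a: "a sums 1" "\<And>n. 0 \<le> a n" "a 1 > 0" and z: "norm z \<le> 1" "z \<noteq> 1"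
  shows "psum (\<lambda>n. of_real (a n)) z \<noteq> 1"
proof
  assume "psum (\<lambda>n. of_real (a n)) z = 1"
  then have s: "(\<lambda>n. a n * (1 - Re (z ^ n))) sums 0"
    using sum_terms_one_minus_power(2)[OF a(1,2) z(1)] by simp
  have "(\<Sum>n\<in>{1}. a n * (1 - Re (z ^ n))) \<le> (\<Sum>n. a n * (1 - Re (z ^ n)))"
    by (rule sum_le_suminf[OF sums_summable[OF s]]) (use sum_terms_one_minus_power(3)[OF a(1,2) z(1)] in auto)
  then have "a 1 * (1 - Re (z ^ 1)) = 0"
    using s sum_terms_one_minus_power(3)[OF a(1,2) z(1), of 1] by (simp add: sums_iff)
  then have re: "Re z = 1" using a(3) by simp
  have "(Re z)\<^sup>2 + (Im z)\<^sup>2 \<le> 1" using z(1) by (simp add: cmod_def)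
  then have "Im z = 0" using re by simp
  with re z(2) show False by (simp add: complex_eq_iff)
qed

text \<open>The second bound links absolute values to real parts by |1 - w|^2 \<le> 2 (1 - Re w) for
  |w| \<le> 1; the averages of 1 - Re (z^n) add up to the real part of the defect.\<close>

lemma norm_one_minus_power_le:
  fixes z :: complex
  assumes "norm z \<le> 1"
  shows "norm (1 - z ^ n) \<le> real n * norm (1 - z)" "(norm (1 - z ^ n))\<^sup>2 \<le> 2 * (1 - Re (z ^ n))"
    "norm (1 - z ^ n) \<le> 2"
proof -
  have "1 - z ^ n = (1 - z) * (\<Sum>i<n. z ^ i)" by (rule one_diff_power_eq)
  moreover have "norm (\<Sum>i<n. z ^ i) \<le> (\<Sum>i<n. 1)"
    by (rule sum_norm_le) (use assms in \<open>simp add: norm_power power_le_one\<close>)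
  ultimately show "norm (1 - z ^ n) \<le> real n * norm (1 - z)"
    using mult_left_mono[of "norm (\<Sum>i<n. z ^ i)" "real n" "norm (1 - z)"]
    by (simp only: norm_mult) (simp add: mult.commute)
  have l: "norm (z ^ n) \<le> 1" using assms by (simp add: norm_power power_le_one)
  have "(norm (1 - z ^ n))\<^sup>2 = 1 - 2 * Re (z ^ n) + (norm (z ^ n))\<^sup>2"
    unfolding cmod_power2 by (simp add: power2_eq_square algebra_simps)
  moreover have "(norm (z ^ n))\<^sup>2 \<le> 1" using l by (simp add: power_le_one)
  ultimately show "(norm (1 - z ^ n))\<^sup>2 \<le> 2 * (1 - Re (z ^ n))" by simp
  show "norm (1 - z ^ n) \<le> 2" using norm_triangle_ineq4[of 1 "z ^ n"] l by simp
qed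

lemma sum_norm_square_le:
  fixes p :: "nat \<Rightarrow> real" and z :: complex
  assumes p: "p sums 1" "\<And>n. 0 \<le> p n" and z: "norm z \<le> 1" and "finite X"
  shows "(\<Sum>n\<in>X. p n * (norm (1 - z ^ n))\<^sup>2) \<le> 2 * norm (1 - psum (\<lambda>n. of_real (p n)) z)"
proof -
  have "(\<Sum>n\<in>X. p n * (norm (1 - z ^ n))\<^sup>2) \<le> (\<Sum>n\<in>X. p n * (2 * (1 - Re (z ^ n))))"
    using p z by (intro sum_mono mult_left_mono norm_one_minus_power_le) auto
  also have "\<dots> = 2 * (\<Sum>n\<in>X. p n * (1 - Re (z ^ n)))" by (simp add: sum_distrib_left mult_ac)
  also have "(\<Sum>n\<in>X. p n * (1 - Re (z ^ n))) \<le> Re (1 - psum (\<lambda>n. of_real (p n)) z)"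
  proof -
    note s = sum_terms_one_minus_power(2)[OF p z]
    have "(\<Sum>n\<in>X. p n * (1 - Re (z ^ n))) \<le> (\<Sum>n. p n * (1 - Re (z ^ n)))"
      by (rule sum_le_suminf[OF sums_summable[OF s] \<open>finite X\<close>]) (use sum_terms_one_minus_power(3)[OF p z] in auto)
    then show ?thesis using s by (simp only: sums_iff)
  qed
  also have "\<dots> \<le> norm (1 - psum (\<lambda>n. of_real (p n)) z)" by (rule complex_Re_le_cmod)
  finally show ?thesis by simp
qed

text \<open>With infinite second moment, finitely many n already carry a second moment above 2K, and
  for them |1 - z^n| is close to n |1 - z|. With finite second moment the mean is finite and 1 - P
  is 1 - z times a continuous function whose value at 1 is the positive mean. Either way |1 - z|^2
  is o(|1 - P(z)|).\<close>

lemma eventually_quadratic_lower_bound: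
  fixes p :: "nat \<Rightarrow> real"
  assumes p: "p sums 1" "\<And>n. 0 \<le> p n" "p 1 > 0" and K: "K > 0"
  shows "\<forall>\<^sub>F z in at 1 within cball (0::complex) 1. K * (norm (1 - z))\<^sup>2 \<le> norm (1 - psum (\<lambda>n. of_real (p n)) z)"
proof (cases "summable (\<lambda>n. (real n)\<^sup>2 * p n)")
  case False
  have "\<exists>N. 2 * K < (\<Sum>n<N. (real n)\<^sup>2 * p n)"
  proof (rule ccontr)
    assume "\<nexists>N. 2 * K < (\<Sum>n<N. (real n)\<^sup>2 * p n)"
    then have "summable (\<lambda>n. (real n)\<^sup>2 * p n)"
      using p(2) by (intro summableI_nonneg_bounded[of _ "2 * K"]) (auto simp: not_less)
    with False show False by simp
  qed
  then obtain N where N: "2 * K < (\<Sum>n<N. (real n)\<^sup>2 * p n)" by blast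
  have "((\<lambda>z. \<Sum>n<N. p n * (norm (\<Sum>i<n. z ^ i))\<^sup>2) \<longlongrightarrow> (\<Sum>n<N. p n * (norm (\<Sum>i<n. (1::complex) ^ i))\<^sup>2)) (at (1::complex) within cball 0 1)"
    by (intro tendsto_intros)
  then have "\<forall>\<^sub>F z in at (1::complex) within cball 0 1. 2 * K < (\<Sum>n<N. p n * (norm (\<Sum>i<n. z ^ i))\<^sup>2)"
    by (rule order_tendstoD) (use N in \<open>simp add: mult.commute\<close>)
  moreover have "\<forall>\<^sub>F z in at (1::complex) within cball 0 1. z \<in> cball 0 1"
    by (simp add: eventually_at_filter)
  ultimately show ?thesis
  proof eventually_elim
    case (elim z)
    have "2 * K * (norm (1 - z))\<^sup>2 \<le> (\<Sum>n<N. p n * (norm (\<Sum>i<n. z ^ i))\<^sup>2) * (norm (1 - z))\<^sup>2"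
      using elim by (intro mult_right_mono) auto
    also have "\<dots> = (\<Sum>n<N. p n * (norm (1 - z ^ n))\<^sup>2)"
      unfolding one_diff_power_eq norm_mult power_mult_distrib sum_distrib_right
      by (rule sum.cong) (simp_all only: mult_ac)
    also have "\<dots> \<le> 2 * norm (1 - psum (\<lambda>n. of_real (p n)) z)"
      by (rule sum_norm_square_le[OF p(1,2)]) (use elim in auto)
    finally show ?case by simp
  qed
next
  case True
  have sm: "summable (\<lambda>n. real n * p n)"
  proof (rule summable_comparison_test'[OF True, of 0])
    fix n
    have "real n \<le> (real n)\<^sup>2" by (cases n) (auto simp: power2_eq_square)
    then show "norm (real n * p n) \<le> (real n)\<^sup>2 * p n" using p(2)[of n] by (simp add: mult_right_mono)
  qed
  define \<mu> where "\<mu> = (\<Sum>n. real n * p n)"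
  have "1 * p 1 \<le> \<mu>" unfolding \<mu>_def using sum_le_suminf[OF sm, of "{1}"] p(2) by simp
  then have \<mu>: "\<mu> > 0" using p(3) by simp
  define m where "m z = (\<Sum>n. of_real (p n) * (\<Sum>i<n. z ^ i))" for z :: complex
  have bd: "norm (of_real (p n) * (\<Sum>i<n. z ^ i)) \<le> real n * p n" if "norm z \<le> 1" for n and z :: complex
  proof -
    have "norm (\<Sum>i<n. z ^ i) \<le> (\<Sum>i<n. 1)"
      by (rule sum_norm_le) (use that in \<open>simp add: norm_power power_le_one\<close>)
    then have "p n * norm (\<Sum>i<n. z ^ i) \<le> p n * real n" using p(2)[of n] by (intro mult_left_mono) auto
    then show ?thesis using p(2)[of n] by (simp add: norm_mult mult.commute)
  qed
  have "uniform_limit (cball 0 1) (\<lambda>N z. \<Sum>n<N. of_real (p n) * (\<Sum>i<n. z ^ i)) m sequentially"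
    unfolding m_def by (rule Weierstrass_m_test[OF _ sm]) (use bd in auto)
  then have "continuous_on (cball 0 1) m"
    by (rule uniform_limit_theorem[rotated]) (auto intro!: always_eventually continuous_intros)
  then have "(m \<longlongrightarrow> m 1) (at 1 within cball 0 1)" by (simp add: continuous_on_def)
  moreover have "m 1 = of_real \<mu>" unfolding m_def \<mu>_def
    by (simp add: suminf_of_real[OF sm] mult.commute)
  ultimately have "((\<lambda>z. norm (m z)) \<longlongrightarrow> \<mu>) (at 1 within cball 0 1)"
    using tendsto_norm \<mu> by fastforce
  then have "\<forall>\<^sub>F z in at 1 within cball 0 1. \<mu> / 2 < norm (m z)"
    by (rule order_tendstoD) (use \<mu> in simp)
  moreover have "\<forall>\<^sub>F z in at (1::complex) within cball 0 1. K * norm (1 - z) < \<mu> / 2"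
  proof -
    have "((\<lambda>z::complex. K * norm (1 - z)) \<longlongrightarrow> K * norm (1 - (1::complex))) (at 1 within cball 0 1)"
      by (intro tendsto_intros)
    then show ?thesis by (rule order_tendstoD) (use \<mu> in simp)
  qed
  moreover have "\<forall>\<^sub>F z in at (1::complex) within cball 0 1. z \<in> cball 0 1"
    by (simp add: eventually_at_filter)
  ultimately show ?thesis
  proof eventually_elim
    case (elim z)
    then have z: "norm z \<le> 1" by simp
    have "(\<lambda>n. of_real (p n) * (\<Sum>i<n. z ^ i)) sums m z"
      unfolding m_def by (rule summable_sums, rule summable_comparison_test'[OF sm, of 0]) (use bd[OF z] in auto)
    then have "(\<lambda>n. (1 - z) * (of_real (p n) * (\<Sum>i<n. z ^ i))) sums ((1 - z) * m z)" by (rule sums_mult)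
    then have "(\<lambda>n. of_real (p n) * (1 - z ^ n)) sums ((1 - z) * m z)"
      unfolding one_diff_power_eq by (simp add: mult_ac)
    then have e: "1 - psum (\<lambda>n. of_real (p n)) z = (1 - z) * m z"
      using sum_terms_one_minus_power(1)[OF p(1,2) z] sums_unique2 by blast
    have "K * (norm (1 - z))\<^sup>2 = norm (1 - z) * (K * norm (1 - z))" by (simp add: power2_eq_square)
    also have "\<dots> \<le> norm (1 - z) * norm (m z)" using elim by (intro mult_left_mono) auto
    finally show ?case unfolding e norm_mult .
  qed
qed

text \<open>Split the sum at N. The head is O(|1 - z|), whose square is negligible by the quadratic
  lower bound. For the tail, Cauchy-Schwarz with weights p bounds the square by the tail mass times
  2 |1 - P(z)|, and the tail mass is as small as desired.\<close>

lemma moment_square_over_defect_tendsto: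
  fixes p :: "nat \<Rightarrow> real"
  assumes p: "p sums 1" "\<And>n. 0 \<le> p n" "p 1 > 0"
  defines "\<eta> \<equiv> \<lambda>z::complex. \<Sum>n. p n * norm (1 - z ^ n)"
  shows "((\<lambda>z. (\<eta> z)\<^sup>2 / norm (1 - psum (\<lambda>n. of_real (p n)) z)) \<longlongrightarrow> 0) (at 1 within cball 0 1)"
proof (rule tendstoI)
  fix \<epsilon> :: real assume \<epsilon>: "\<epsilon> > 0"
  have smp: "summable p" using p(1) by (simp add: sums_iff)
  \<comment> \<open>The tail mass enters below as \<open>4 * \<delta> * D\<close>, so this threshold
    keeps its share under half of the target.\<close>
  obtain N where "\<forall>n\<ge>N. norm (\<Sum>i. p (i + n)) < \<epsilon> / 8"
    using suminf_exist_split[OF _ smp, of "\<epsilon> / 8"] \<epsilon> by auto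
  then have N: "(\<Sum>n. p (n + N)) < \<epsilon> / 8" by force
  define \<delta> where "\<delta> = (\<Sum>n. p (n + N))"
  have smN: "summable (\<lambda>n. p (n + N))" using smp by (rule summable_ignore_initial_segment)
  have \<delta>0: "0 \<le> \<delta>" unfolding \<delta>_def by (rule suminf_nonneg[OF smN]) (use p in auto)
  \<comment> \<open>Chosen so that the head, squared and doubled, is at most a quarter of the
    target; the summand 1 keeps K positive for N = 0.\<close>
  define K where "K = (2 * (real N)\<^sup>2 + 1) / (\<epsilon> / 4)"
  have K: "K > 0" unfolding K_def using \<epsilon> by (intro divide_pos_pos add_nonneg_pos) auto
  have "\<forall>\<^sub>F z in at (1::complex) within cball 0 1. z \<in> cball 0 1 \<and> z \<noteq> 1"
    by (simp add: eventually_at_filter)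
  with eventually_quadratic_lower_bound[OF p K]
  show "\<forall>\<^sub>F z in at 1 within cball 0 1. dist ((\<eta> z)\<^sup>2 / norm (1 - psum (\<lambda>n. of_real (p n)) z)) 0 < \<epsilon>"
  proof eventually_elim
    case (elim z)
    define D where "D = norm (1 - psum (\<lambda>n. of_real (p n)) z)"
    have z: "norm z \<le> 1" "z \<noteq> 1" using elim by auto
    have D: "D > 0" unfolding D_def using psum_ne_1[OF p z] by simp
    have sm: "summable (\<lambda>n. p n * norm (1 - z ^ n))"
      by (rule summable_comparison_test'[OF summable_mult2[OF smp, of 2], of 0])
        (use p norm_one_minus_power_le(3)[OF z(1)] in \<open>auto intro!: mult_left_mono simp: abs_mult\<close>)
    have "\<eta> z = (\<Sum>n. p (n + N) * norm (1 - z ^ (n + N))) + (\<Sum>n<N. p n * norm (1 - z ^ n))"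
      unfolding \<eta>_def by (rule suminf_split_initial_segment[OF sm])
    also have "(\<Sum>n<N. p n * norm (1 - z ^ n)) \<le> (\<Sum>n<N. p n * (real N * norm (1 - z)))"
    proof (intro sum_mono mult_left_mono)
      fix n assume "n \<in> {..<N}"
      then have "real n * norm (1 - z) \<le> real N * norm (1 - z)" by (intro mult_right_mono) auto
      with norm_one_minus_power_le(1)[OF z(1), of n] show "norm (1 - z ^ n) \<le> real N * norm (1 - z)" by linarith
    qed (use p in auto)
    also have "\<dots> = (\<Sum>n<N. p n) * (real N * norm (1 - z))" by (rule sum_distrib_right[symmetric])
    also have "\<dots> \<le> 1 * (real N * norm (1 - z))"
      using sum_le_suminf[OF smp, of "{..<N}"] p by (intro mult_right_mono) (auto simp: sums_iff)
    also have "(\<Sum>n. p (n + N) * norm (1 - z ^ (n + N))) \<le> sqrt (\<delta> * (2 * D))"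
    proof (rule suminf_le_const[OF summable_ignore_initial_segment[OF sm]])
      fix M
      have "(\<Sum>n<M. p (n + N) * norm (1 - z ^ (n + N)))\<^sup>2 =
          (\<Sum>n<M. sqrt (p (n + N)) * (sqrt (p (n + N)) * norm (1 - z ^ (n + N))))\<^sup>2"
        using p(2) by (simp add: mult.assoc[symmetric])
      also have "\<dots> \<le> (\<Sum>n<M. (sqrt (p (n + N)))\<^sup>2) * (\<Sum>n<M. (sqrt (p (n + N)) * norm (1 - z ^ (n + N)))\<^sup>2)"
        by (rule Cauchy_Schwarz_ineq_sum)
      also have "\<dots> = (\<Sum>n<M. p (n + N)) * (\<Sum>n<M. p (n + N) * (norm (1 - z ^ (n + N)))\<^sup>2)"
        using p(2) by (simp add: power_mult_distrib)
      also have "(\<Sum>n<M. p (n + N) * (norm (1 - z ^ (n + N)))\<^sup>2) = (\<Sum>n\<in>(\<lambda>n. n + N) ` {..<M}. p n * (norm (1 - z ^ n))\<^sup>2)"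
        by (subst sum.reindex) (auto simp: o_def)
      also have "(\<Sum>n<M. p (n + N)) * \<dots> \<le> \<delta> * (2 * D)"
        unfolding D_def \<delta>_def
        by (intro mult_mono sum_le_suminf sum_norm_square_le sum_nonneg mult_nonneg_nonneg suminf_nonneg smN p z(1)) (use p in auto)
      finally show "(\<Sum>n<M. p (n + N) * norm (1 - z ^ (n + N))) \<le> sqrt (\<delta> * (2 * D))"
        by (rule real_le_rsqrt)
    qed
    finally have le: "\<eta> z \<le> sqrt (\<delta> * (2 * D)) + real N * norm (1 - z)" by simp
    have "0 \<le> \<eta> z" unfolding \<eta>_def by (rule suminf_nonneg[OF sm]) (use p in auto)
    with le have "(\<eta> z)\<^sup>2 \<le> (sqrt (\<delta> * (2 * D)) + real N * norm (1 - z))\<^sup>2" by (intro power_mono) auto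
    also have "\<dots> \<le> 2 * (sqrt (\<delta> * (2 * D)))\<^sup>2 + 2 * (real N * norm (1 - z))\<^sup>2"
      using sum_squares_bound[of "sqrt (\<delta> * (2 * D))" "real N * norm (1 - z)"] by (simp add: power2_sum)
    also have "\<dots> = 4 * \<delta> * D + 2 * (real N)\<^sup>2 * (norm (1 - z))\<^sup>2"
      using \<delta>0 D by (simp add: power_mult_distrib)
    also have "4 * \<delta> * D < \<epsilon> / 2 * D" using N D unfolding \<delta>_def by (intro mult_strict_right_mono) auto
    also have "2 * (real N)\<^sup>2 * (norm (1 - z))\<^sup>2 \<le> \<epsilon> / 4 * D"
    proof -
      have "2 * (real N)\<^sup>2 * (norm (1 - z))\<^sup>2 \<le> (2 * (real N)\<^sup>2 + 1) * (norm (1 - z))\<^sup>2" by (intro mult_right_mono) auto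
      also have "\<dots> = \<epsilon> / 4 * (K * (norm (1 - z))\<^sup>2)" unfolding K_def using \<epsilon> by simp
      also have "\<dots> \<le> \<epsilon> / 4 * D" using elim \<epsilon> unfolding D_def by (intro mult_left_mono) auto
      finally show ?thesis .
    qed
    finally have "(\<eta> z)\<^sup>2 < \<epsilon> * D" using mult_pos_pos[OF \<epsilon> D] by (simp add: mult.commute[of D \<epsilon>])
    then have "(\<eta> z)\<^sup>2 / D < \<epsilon>" using D by (simp add: divide_less_eq)
    then show ?case using D unfolding D_def by simp
  qed
qed

text \<open>The hypothesis \<open>newton\<close> is the coefficient form of Y' (1 - A) = A', where A
  has coefficients \<open>\<alpha> p\<close> and Y has \<open>y p / of_nat p\<close>. Hence exp Y (1
  - A) has derivative 0 and keeps its value at 0; R > 1 puts the point 1 inside the disc of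
  convergence.\<close>

lemma exp_newton_sums:
  fixes \<alpha> y :: "nat \<Rightarrow> complex"
  assumes R: "R > 1" and \<alpha>: "\<alpha> 0 = 0" "summable (\<lambda>p. \<alpha> p * of_real R ^ p)"
    and y: "summable (\<lambda>p. y p / of_nat p * of_real R ^ p)"
    and newton: "\<And>n. y (Suc n) = of_nat (Suc n) * \<alpha> (Suc n) + (\<Sum>i<n. y (Suc i) * \<alpha> (n - i))"
  shows "exp (\<Sum>p. y p / of_nat p) * (1 - (\<Sum>p. \<alpha> p)) = 1"
proof -
  define A where "A = Abs_fps \<alpha>"
  define Y where "Y = Abs_fps (\<lambda>p. y p / of_nat p)"
  have rA: "ereal R \<le> fps_conv_radius A"
    using conv_radius_geI[OF \<alpha>(2)] R unfolding A_def fps_conv_radius_def by simp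
  have rY: "ereal R \<le> fps_conv_radius Y"
    using conv_radius_geI[OF y] R unfolding Y_def fps_conv_radius_def by simp
  have inA: "ereal (norm t) < fps_conv_radius A" if "t \<in> ball 0 R" for t :: complex
    using that rA less_le_trans[of "ereal (norm t)" "ereal R"] by simp
  have inY: "ereal (norm t) < fps_conv_radius Y" if "t \<in> ball 0 R" for t :: complex
    using that rY less_le_trans[of "ereal (norm t)" "ereal R"] by simp
  have eq: "fps_deriv Y * (1 - A) = fps_deriv A"
  proof (rule fps_ext)
    fix n
    have "(fps_deriv Y * (1 - A)) $ n = (\<Sum>i=0..n. y (Suc i) * (1 - A) $ (n - i))"
      by (simp add: fps_mult_nth Y_def del: of_nat_Suc)
    also have "\<dots> = y (Suc n) + (\<Sum>i<n. y (Suc i) * (1 - A) $ (n - i))"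
      by (simp add: atLeast0AtMost lessThan_Suc_atMost[symmetric] A_def \<alpha>)
    also have "(\<Sum>i<n. y (Suc i) * (1 - A) $ (n - i)) = - (\<Sum>i<n. y (Suc i) * \<alpha> (n - i))"
      unfolding sum_negf[symmetric] by (rule sum.cong) (auto simp: A_def)
    finally show "(fps_deriv Y * (1 - A)) $ n = fps_deriv A $ n"
      using newton[of n] by (simp add: A_def)
  qed
  have deq: "eval_fps (fps_deriv Y) t * (1 - eval_fps A t) = eval_fps (fps_deriv A) t" if t: "t \<in> ball 0 R" for t
  proof -
    have 1: "ereal (norm t) < fps_conv_radius (fps_deriv Y)" using inY[OF t] fps_conv_radius_deriv[of Y] by (simp add: less_le_trans)
    have 2: "ereal (norm t) < fps_conv_radius (1 - A)" using inA[OF t] fps_conv_radius_diff[of 1 A] by (simp add: less_le_trans)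
    have "eval_fps (fps_deriv Y * (1 - A)) t = eval_fps (fps_deriv Y) t * eval_fps (1 - A) t"
      using 1 2 by (rule eval_fps_mult)
    also have "eval_fps (1 - A) t = 1 - eval_fps A t" by (subst eval_fps_diff) (use inA[OF t] in auto)
    finally show ?thesis by (simp only: eq)
  qed
  define f where "f t = exp (eval_fps Y t) * (1 - eval_fps A t)" for t
  have "(f has_field_derivative 0) (at t)" if t: "t \<in> ball 0 R" for t
  proof -
    have "(f has_field_derivative (exp (eval_fps Y t) * eval_fps (fps_deriv Y) t * (1 - eval_fps A t) + exp (eval_fps Y t) * (0 - eval_fps (fps_deriv A) t))) (at t)"
      unfolding f_def using inA[OF t] inY[OF t]
      by (auto intro!: derivative_eq_intros has_field_derivative_eval_fps)
    then show ?thesis using deq[OF t] by (simp add: mult.assoc)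
  qed
  then have "\<exists>c. \<forall>t\<in>ball 0 R. f t = c"
    by (intro has_field_derivative_zero_constant convex_ball) (auto intro: has_field_derivative_at_within)
  then have "f 1 = f 0" using R by force
  \<comment> \<open>Both constant coefficients vanish: \<open>\<alpha> 0\<close> by hypothesis, and
    \<open>y 0 / of_nat 0\<close> by the convention for division by zero.\<close>
  moreover have "f 0 = 1" by (simp add: f_def eval_fps_at_0 A_def Y_def \<alpha>)
  ultimately show ?thesis by (simp add: f_def eval_fps_def A_def Y_def)
qed

section \<open>Transfer operators and the invariant cone\<close>

text \<open>The alphabet is infinite; cutting it at K makes the sums over words of length p finite,
  and bounds uniform in K take the place of convergence.\<close>

definition words :: "nat \<Rightarrow> nat \<Rightarrow> nat list set" where
  "words K p = {u. set u \<subseteq> {..<K} \<and> length u = p}"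

lemma finite_words [simp]: "finite (words K p)"
  unfolding words_def by (rule finite_lists_length_eq) simp

lemma words_0 [simp]: "words K 0 = {[]}"
  by (auto simp: words_def)

text \<open>The last letter is the one split off because its operator acts last, next to the point
  of evaluation.\<close>

lemma sum_words_Suc: "(\<Sum>u\<in>words K (Suc p). f u) = (\<Sum>n<K. \<Sum>u\<in>words K p. f (u @ [n]))"
proof -
  have "(\<Sum>n<K. \<Sum>u\<in>words K p. f (u @ [n])) = (\<Sum>(n, u)\<in>{..<K} \<times> words K p. f (u @ [n]))"
    by (rule sum.cartesian_product)
  also have "\<dots> = (\<Sum>u\<in>words K (Suc p). f u)"
  proof (rule sum.reindex_bij_witness[of _ "\<lambda>u. (last u, butlast u)" "\<lambda>(n, u). u @ [n]"])
    fix u assume u: "u \<in> words K (Suc p)"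
    then have ne: "u \<noteq> []" by (auto simp: words_def)
    then show "(case (last u, butlast u) of (n, u) \<Rightarrow> u @ [n]) = u" by simp
    have "last u \<in> set u" using ne by simp
    then show "(last u, butlast u) \<in> {..<K} \<times> words K p"
      using u by (auto simp: words_def dest: in_set_butlastD)
  qed (auto simp: words_def)
  finally show ?thesis by simp
qed

lemma finite_sum_words_le:
  assumes F: "\<And>u. 0 \<le> F u" "\<And>K p. (\<Sum>u\<in>words K p. F u) \<le> \<beta> p" and \<beta>: "summable \<beta>" "finite X"
  shows "(\<Sum>u\<in>X. F u) \<le> (suminf \<beta> :: real)"
proof -
  obtain K where K: "\<And>u n. u \<in> X \<Longrightarrow> n \<in> set u \<Longrightarrow> n < K"
  proof -
    have "finite (\<Union>u\<in>X. set u)" using \<beta>(2) by simp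
    then obtain K where "\<forall>n\<in>(\<Union>u\<in>X. set u). n < K"
      using finite_nat_set_iff_bounded by blast
    then show thesis using that by blast
  qed
  obtain P where P: "\<And>u. u \<in> X \<Longrightarrow> length u < P"
  proof -
    have "finite (length ` X)" using \<beta>(2) by simp
    then obtain P where "\<forall>n\<in>length ` X. n < P" using finite_nat_set_iff_bounded by blast
    then show thesis using that by blast
  qed
  have "X \<subseteq> (\<Union>p<P. words K p)" using K P by (auto simp: words_def)
  then have "(\<Sum>u\<in>X. F u) \<le> (\<Sum>u\<in>(\<Union>p<P. words K p). F u)"
    using F(1) by (intro sum_mono2) auto
  also have "\<dots> = (\<Sum>p<P. \<Sum>u\<in>words K p. F u)"
    by (rule sum.UNION_disjoint) (simp, simp, auto simp: words_def)
  also have "\<dots> \<le> (\<Sum>p<P. \<beta> p)" by (intro sum_mono F)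
  also have "\<dots> \<le> suminf \<beta>"
  proof (rule sum_le_suminf[OF \<beta>(1)])
    fix p
    show "0 \<le> \<beta> p" using F(2)[of 0 p] sum_nonneg[of "words 0 p" F] F(1) by (meson order_trans)
  qed simp
  finally show ?thesis .
qed

locale renewal_system =
  fixes V :: "point \<Rightarrow> real" and \<theta> C1 C3 :: real and h :: "point \<Rightarrow> real"
  assumes V_bounds: "\<And>\<omega>. - C1 \<le> V \<omega> \<and> V \<omega> \<le> 0"
    and W_summable: "summable (\<lambda>n. exp (SUP \<omega>\<in>level_set (Suc n). induced_potential V \<omega>))"
    and theta: "0 < \<theta>" "\<theta> < 1"
    and C3_pos: "C3 > 0"
    and W_variation: "\<And>n. n \<ge> 1 \<Longrightarrow> variation n (induced_potential V) \<le> ereal (C3 * \<theta> ^ n)"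
    and h_in: "(\<lambda>\<omega>. complex_of_real (h \<omega>)) \<in> F_theta \<theta>"
    and h_pos: "\<And>\<omega>. \<omega> \<in> Omega_star \<Longrightarrow> h \<omega> > 0"
    and h_eigen: "\<And>\<omega>. \<omega> \<in> Omega_star \<Longrightarrow>
                    induced_operator V (\<lambda>\<omega>'. complex_of_real (h \<omega>')) \<omega> = complex_of_real (h \<omega>)"
begin

section \<open>Transfer operators letter by letter and the eigenfunction\<close>

definition \<psi> :: "nat \<Rightarrow> point \<Rightarrow> real" where
  "\<psi> n \<omega> = exp (induced_potential V (cons n \<omega>))"

definition Lop :: "nat \<Rightarrow> (point \<Rightarrow> real) \<Rightarrow> point \<Rightarrow> real" where
  "Lop n f = (\<lambda>\<omega>. \<psi> n \<omega> * f (cons n \<omega>))"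

text \<open>Letters act from left to right, so that f is evaluated at \<open>prepend u y\<close>
  with the letters in their written order.\<close>

definition Lw :: "nat list \<Rightarrow> (point \<Rightarrow> real) \<Rightarrow> point \<Rightarrow> real" where
  "Lw u f = fold Lop u f"

text \<open>The log-Lipschitz condition is written multiplicatively, so that the zero function
  belongs to the cone.\<close>

definition cone :: "real \<Rightarrow> (point \<Rightarrow> real) \<Rightarrow> bool" where
  "cone B f \<longleftrightarrow> (\<forall>x\<in>Omega_star. 0 \<le> f x) \<and>
     (\<forall>x\<in>Omega_star. \<forall>y\<in>Omega_star. f x \<le> exp (B * d_theta \<theta> x y) * f y)"

lemma d_bounds [simp]: "0 \<le> d_theta \<theta> x y" "d_theta \<theta> x y \<le> 1"
  using d_theta_bounds[OF theta] by auto

lemma psi_pos [simp]: "\<psi> n \<omega> > 0" by (simp add: \<psi>_def)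

lemma W_cons: "induced_potential V (cons n \<omega>) = (\<Sum>k<Suc n. V ((shift ^^ k) (cons n \<omega>)))"
proof -
  have "{k. enat k < passage_time (cons n \<omega>)} = {..<Suc n}" by auto
  then show ?thesis by (simp add: induced_potential_def)
qed

lemma psi_le: "\<psi> n \<omega> \<le> exp (SUP \<omega>\<in>level_set (Suc n). induced_potential V \<omega>)"
proof -
  have "bdd_above (induced_potential V ` level_set (Suc n))"
    unfolding level_set_Suc using V_bounds
    by (intro bdd_aboveI[of _ 0]) (auto simp: W_cons simp del: sum.lessThan_Suc intro!: sum_nonpos)
  then show ?thesis unfolding \<psi>_def exp_le_cancel_iff
    by (intro cSUP_upper) (auto simp: level_set_Suc)
qed

lemma summable_psi: "summable (\<lambda>n. \<psi> n \<omega>)"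
  by (rule summable_comparison_test'[OF W_summable, of 0]) (use psi_le in \<open>simp add: less_imp_le\<close>)

text \<open>The variation bound is available from order 1 on; prepending the same letter to both
  points guarantees that order and gains one factor \<open>\<theta>\<close>.\<close>

lemma W_cons_lipschitz:
  assumes "\<omega> \<in> Omega_star" "\<omega>' \<in> Omega_star"
  shows "\<bar>induced_potential V (cons n \<omega>) - induced_potential V (cons n \<omega>')\<bar> \<le> C3 * \<theta> * d_theta \<theta> \<omega> \<omega>'"
proof (cases "first_diff \<omega> \<omega>'")
  case infinity
  then have "\<omega> = \<omega>'" using assms by (intro first_diff_infinity)
  then show ?thesis using C3_pos theta by (auto intro!: mult_nonneg_nonneg)
next
  case (enat k)
  have "first_diff (cons n \<omega>) (cons n \<omega>') = enat (Suc k)" by (simp add: first_diff_cons_eq enat eSuc_enat)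
  then have "ereal \<bar>induced_potential V (cons n \<omega>) - induced_potential V (cons n \<omega>')\<bar> \<le> variation (Suc k) (induced_potential V)"
    unfolding variation_def using assms by (intro SUP_upper2[of "(cons n \<omega>, cons n \<omega>')"]) auto
  also have "\<dots> \<le> ereal (C3 * \<theta> ^ Suc k)" by (rule W_variation) simp
  finally show ?thesis using enat by (simp add: d_theta_def mult_ac)
qed

lemma psi_lipschitz:
  assumes "\<omega> \<in> Omega_star" "\<omega>' \<in> Omega_star"
  shows "\<psi> n \<omega> \<le> exp (C3 * \<theta> * d_theta \<theta> \<omega> \<omega>') * \<psi> n \<omega>'"
  using W_cons_lipschitz[OF assms, of n] by (simp add: \<psi>_def flip: exp_add)

lemma ex_h_bounds:
  obtains Bh Lh where "\<And>x. x \<in> Omega_star \<Longrightarrow> h x \<le> Bh"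
    "Lh \<ge> 0" "\<And>x y. x \<in> Omega_star \<Longrightarrow> y \<in> Omega_star \<Longrightarrow> \<bar>h x - h y\<bar> \<le> Lh * d_theta \<theta> x y"
proof -
  obtain Bh L where B: "\<forall>x\<in>Omega_star. norm (complex_of_real (h x)) \<le> Bh"
    and L: "\<forall>x\<in>Omega_star. \<forall>y\<in>Omega_star. norm (complex_of_real (h x) - complex_of_real (h y)) \<le> L * d_theta \<theta> x y"
    using h_in unfolding F_theta_def by auto
  show thesis
  proof (rule that[of Bh "\<bar>L\<bar>"])
    show "h x \<le> Bh" if "x \<in> Omega_star" for x using B that h_pos[OF that] by force
    fix x y assume xy: "x \<in> Omega_star" "y \<in> Omega_star"
    have "\<bar>h x - h y\<bar> = norm (complex_of_real (h x) - complex_of_real (h y))"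
      by (simp flip: of_real_diff)
    also have "\<dots> \<le> L * d_theta \<theta> x y" using L xy by blast
    also have "\<dots> \<le> \<bar>L\<bar> * d_theta \<theta> x y" by (intro mult_right_mono) auto
    finally show "\<bar>h x - h y\<bar> \<le> \<bar>L\<bar> * d_theta \<theta> x y" .
  qed simp
qed

lemma h_sums:
  assumes "\<omega> \<in> Omega_star"
  shows "(\<lambda>n. Lop n h \<omega>) sums h \<omega>"
proof -
  obtain Bh Lh where Bh: "\<And>x. x \<in> Omega_star \<Longrightarrow> h x \<le> Bh" by (rule ex_h_bounds) iprover
  have sm: "summable (\<lambda>n. Lop n h \<omega>)"
  proof (rule summable_comparison_test'[OF summable_mult2[OF summable_psi], of 0])
    show "norm (Lop n h \<omega>) \<le> \<psi> n \<omega> * Bh" for n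
      using Bh[of "cons n \<omega>"] h_pos[of "cons n \<omega>"] assms psi_pos[of n \<omega>]
      by (auto simp: Lop_def abs_mult less_imp_le intro!: mult_left_mono)
  qed
  have "complex_of_real (h \<omega>) = (\<Sum>n. complex_of_real (Lop n h \<omega>))"
    using h_eigen[OF assms] by (simp add: induced_operator_def Lop_def \<psi>_def cons_def)
  also have "\<dots> = complex_of_real (\<Sum>n. Lop n h \<omega>)" using sm by (rule suminf_of_real[symmetric])
  finally show ?thesis using sm by (simp add: sums_iff)
qed

lemma Lop_nonneg: "0 \<le> f (cons n \<omega>) \<Longrightarrow> 0 \<le> Lop n f \<omega>"
  by (simp add: Lop_def less_imp_le)

lemma Lop_h_pos: "\<omega> \<in> Omega_star \<Longrightarrow> 0 < Lop n h \<omega>"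
  by (simp add: Lop_def h_pos)

lemma sum_Lop_h_le:
  assumes "\<omega> \<in> Omega_star" "finite X"
  shows "(\<Sum>n\<in>X. Lop n h \<omega>) \<le> h \<omega>"
  using sum_le_suminf[OF sums_summable[OF h_sums[OF assms(1)]] assms(2)]
    Lop_h_pos[OF assms(1)] h_sums[OF assms(1)] by (simp add: sums_iff less_imp_le)

text \<open>Pointwise positivity is not yet uniform. The eigenvalue equation gives h x \<ge> exp (-
  C1) h (cons 0 x), since the branch of letter 0 reads V only once. After p such steps the argument
  is within \<open>\<theta> ^ p\<close> of \<open>ones\<close>, where the Lipschitz property leaves
  at least half of h ones.\<close>

lemma ex_h_lower: "\<exists>b>0. \<forall>x\<in>Omega_star. b \<le> h x"
proof -
  obtain Bh L where L: "L \<ge> 0" "\<And>x y. x \<in> Omega_star \<Longrightarrow> y \<in> Omega_star \<Longrightarrow> \<bar>h x - h y\<bar> \<le> L * d_theta \<theta> x y"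
    by (rule ex_h_bounds) iprover
  have h1: "h ones > 0" by (rule h_pos) simp
  have "(\<lambda>p. L * \<theta> ^ p) \<longlonglongrightarrow> L * 0"
    using theta by (intro tendsto_intros LIMSEQ_power_zero) auto
  then have "\<forall>\<^sub>F p in sequentially. L * \<theta> ^ p < h ones / 2" by (rule order_tendstoD) (use h1 in simp)
  then obtain p where p: "L * \<theta> ^ p < h ones / 2" by (auto simp: eventually_sequentially)
  have step: "exp (- C1) * h (cons 0 x) \<le> h x" if x: "x \<in> Omega_star" for x
  proof -
    have "\<psi> 0 x * h (cons 0 x) \<le> h x" using sum_Lop_h_le[OF x, of "{0}"] by (simp add: Lop_def)
    moreover have "exp (- C1) \<le> \<psi> 0 x" using V_bounds by (simp add: \<psi>_def W_cons)
    then have "exp (- C1) * h (cons 0 x) \<le> \<psi> 0 x * h (cons 0 x)"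
      using h_pos[of "cons 0 x"] x by (intro mult_right_mono) auto
    ultimately show ?thesis by linarith
  qed
  have iter: "exp (- C1) ^ q * h (prepend (replicate q 0) x) \<le> h x" if "x \<in> Omega_star" for q x
  proof (induction q)
    case (Suc q)
    let ?y = "prepend (replicate q 0) x"
    have "exp (- C1) * h (cons 0 ?y) \<le> h ?y" using that by (intro step) simp
    then have "exp (- C1) ^ q * (exp (- C1) * h (cons 0 ?y)) \<le> exp (- C1) ^ q * h ?y" by (intro mult_left_mono) auto
    also have "\<dots> \<le> h x" by (rule Suc)
    finally show ?case by (simp add: mult_ac)
  qed simp
  have "exp (- C1) ^ p * (h ones / 2) \<le> h x" if x: "x \<in> Omega_star" for x
  proof -
    have "d_theta \<theta> (prepend (replicate p 0) x) ones = \<theta> ^ p * d_theta \<theta> x ones"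
      using d_theta_prepend[of \<theta> "replicate p 0" x ones] by (simp add: ones_eq_prepend)
    also have "\<dots> \<le> \<theta> ^ p" using theta by (intro mult_left_le) auto
    finally have "L * d_theta \<theta> (prepend (replicate p 0) x) ones \<le> L * \<theta> ^ p" using L(1) by (rule mult_left_mono)
    then have "h ones / 2 \<le> h (prepend (replicate p 0) x)"
      using L(2)[of "prepend (replicate p 0) x" ones] p x by auto
    then have "exp (- C1) ^ p * (h ones / 2) \<le> exp (- C1) ^ p * h (prepend (replicate p 0) x)" by (intro mult_left_mono) auto
    then show ?thesis using iter[OF x, of p] by linarith
  qed
  then show ?thesis using h1 by (intro exI[of _ "exp (- C1) ^ p * (h ones / 2)"]) auto
qed

lemma ex_cone_h: "\<exists>B>0. cone B h \<and> (B + C3) * \<theta> < B"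
proof -
  obtain b where b: "b > 0" "\<And>x. x \<in> Omega_star \<Longrightarrow> b \<le> h x" using ex_h_lower by auto
  obtain Bh L where L: "L \<ge> 0" "\<And>x y. x \<in> Omega_star \<Longrightarrow> y \<in> Omega_star \<Longrightarrow> \<bar>h x - h y\<bar> \<le> L * d_theta \<theta> x y"
    by (rule ex_h_bounds) iprover
  \<comment> \<open>\<open>L / b\<close> turns the Lipschitz constant of h into a logarithmic one,
    \<open>C3 * \<theta> / (1 - \<theta>)\<close> is the fixed point of the map B \<mapsto> (B + C3)
    \<theta>, and the 1 makes the inequality strict.\<close>
  define B where "B = L / b + C3 * \<theta> / (1 - \<theta>) + 1"
  have t: "0 \<le> C3 * \<theta> / (1 - \<theta>)" using C3_pos theta by (intro divide_nonneg_pos) auto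
  have Lb: "0 \<le> L / b" using L b by simp
  have "B > 0" using t Lb by (simp add: B_def)
  moreover have "cone B h"
    unfolding cone_def
  proof safe
    fix x assume "x \<in> Omega_star" then show "0 \<le> h x" using h_pos less_imp_le by blast
  next
    fix x y assume xy: "x \<in> Omega_star" "y \<in> Omega_star"
    define D where "D = d_theta \<theta> x y"
    have D: "0 \<le> D" by (simp add: D_def)
    have "h x \<le> h y + L * D" using L(2)[OF xy] by (simp add: D_def)
    also have "L * D = L / b * D * b" using b(1) by simp
    also have "h y + L / b * D * b \<le> h y + L / b * D * h y"
      using Lb D b(2)[OF xy(2)] by (intro add_left_mono mult_left_mono mult_nonneg_nonneg)
    also have "h y + L / b * D * h y = (1 + L / b * D) * h y" by (simp add: algebra_simps)
    also have "\<dots> \<le> exp (L / b * D) * h y"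
      using exp_ge_add_one_self[of "L / b * D"] h_pos[OF xy(2)] by (intro mult_right_mono) auto
    also have "\<dots> \<le> exp (B * D) * h y"
    proof -
      have "L / b * D \<le> B * D" using D t by (intro mult_right_mono) (auto simp: B_def)
      then show ?thesis using h_pos[OF xy(2)] by (intro mult_right_mono) auto
    qed
    finally show "h x \<le> exp (B * d_theta \<theta> x y) * h y" by (simp add: D_def)
  qed
  moreover have "(B + C3) * \<theta> < B"
  proof -
    have "B * (1 - \<theta>) = (L / b + 1) * (1 - \<theta>) + C3 * \<theta>" using theta by (simp add: B_def field_simps)
    moreover have "0 < (L / b + 1) * (1 - \<theta>)" using Lb theta by (intro mult_pos_pos) auto
    ultimately show ?thesis by (simp add: algebra_simps)
  qed
  ultimately show ?thesis by blast
qed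

lemma Lw_simps [simp]: "Lw [] f = f" "Lw (n # u) f = Lw u (Lop n f)" "Lw (u @ v) f = Lw v (Lw u f)"
  by (simp_all add: Lw_def)

text \<open>The orbit pieces belonging to consecutive blocks join up. In this form traces will be
  recognised as products along periodic orbits of the original shift.\<close>

lemma Lw_eq: "Lw u f y = exp (\<Sum>k<tot u. V ((shift ^^ k) (prepend u y))) * f (prepend u y)"
proof (induction u arbitrary: f)
  case (Cons n u)
  let ?x = "prepend (n # u) y"
  have split: "(\<Sum>k<a + b. g k) = (\<Sum>k<a. g k) + (\<Sum>k<b. g (a + k))" for a b and g :: "nat \<Rightarrow> real"
    by (induction b) auto
  have shift: "(shift ^^ (Suc n + k)) ?x = (shift ^^ k) (prepend u y)" for k
    unfolding shift_pow prepend_simps add.assoc by (simp only: cons_nth_add)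
  have "(\<Sum>k<tot (n # u). V ((shift ^^ k) ?x)) =
      (\<Sum>k<Suc n. V ((shift ^^ k) ?x)) + (\<Sum>k<tot u. V ((shift ^^ k) (prepend u y)))"
    using split[of "\<lambda>k. V ((shift ^^ k) ?x)" "Suc n" "tot u"] by (simp only: shift tot_simps)
  then have "exp (\<Sum>k<tot (n # u). V ((shift ^^ k) ?x)) =
      \<psi> n (prepend u y) * exp (\<Sum>k<tot u. V ((shift ^^ k) (prepend u y)))"
    by (simp only: \<psi>_def W_cons prepend_simps exp_add)
  then show ?case unfolding Lw_simps Cons[of "Lop n f"] by (simp add: Lop_def)
qed simp

lemma Lw_one: "Lw u f y = Lw u (\<lambda>_. 1) y * f (prepend u y)"
  using Lw_eq[of u f y] Lw_eq[of u "\<lambda>_. 1" y] by simp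

lemma Lw_cmult: "Lw u (\<lambda>x. k * f x) y = k * Lw u f y"
  by (simp add: Lw_eq)

lemma Lw_mono: "f (prepend u y) \<le> g (prepend u y) \<Longrightarrow> Lw u f y \<le> Lw u g y"
  by (simp add: Lw_eq)

lemma Lw_one_pos: "Lw u (\<lambda>_. 1) y > 0"
  by (simp add: Lw_eq)

lemma sum_Lw_h_le:
  assumes "x \<in> Omega_star"
  shows "(\<Sum>u\<in>words K p. Lw u h x) \<le> h x"
  using assms
proof (induction p arbitrary: x)
  case (Suc p)
  have "(\<Sum>u\<in>words K (Suc p). Lw u h x) = (\<Sum>n<K. \<psi> n x * (\<Sum>u\<in>words K p. Lw u h (cons n x)))"
    by (simp add: sum_words_Suc Lop_def sum_distrib_left)
  also have "\<dots> \<le> (\<Sum>n<K. Lop n h x)"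
    unfolding Lop_def using Suc by (intro sum_mono mult_left_mono) (auto simp: less_imp_le)
  also have "\<dots> \<le> h x" using Suc.prems by (rule sum_Lop_h_le) simp
  finally show ?case .
qed simp

text \<open>An additive weight acts like a derivation: it sits on one of the p letters and costs m
  there, while the other letters sum to at most h. Hence the linear growth in p.\<close>

lemma sum_weighted_Lw_h_le:
  assumes W: "\<And>n. 0 \<le> W n" and m: "\<And>K x. x \<in> Omega_star \<Longrightarrow> (\<Sum>n<K. W n * Lop n h x) \<le> m * h x" "0 \<le> m"
    and x: "x \<in> Omega_star"
  shows "(\<Sum>u\<in>words K p. (\<Sum>n\<leftarrow>u. W n) * Lw u h x) \<le> real p * m * h x"
  using x
proof (induction p arbitrary: x)
  case (Suc p)
  have "(\<Sum>u\<in>words K (Suc p). (\<Sum>n\<leftarrow>u. W n) * Lw u h x) =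
      (\<Sum>n<K. \<psi> n x * (\<Sum>u\<in>words K p. (\<Sum>n\<leftarrow>u. W n) * Lw u h (cons n x)) + W n * (\<psi> n x * (\<Sum>u\<in>words K p. Lw u h (cons n x))))"
    unfolding sum_words_Suc
    by (rule sum.cong) (simp_all add: Lop_def distrib_left distrib_right sum.distrib sum_distrib_left mult_ac)
  also have "\<dots> \<le> (\<Sum>n<K. \<psi> n x * (real p * m * h (cons n x)) + W n * (\<psi> n x * h (cons n x)))"
    using Suc W by (intro sum_mono add_mono mult_left_mono sum_Lw_h_le) (auto simp: less_imp_le)
  also have "\<dots> = real p * m * (\<Sum>n<K. Lop n h x) + (\<Sum>n<K. W n * Lop n h x)"
    unfolding sum.distrib Lop_def sum_distrib_left by (simp add: mult_ac)
  also have "\<dots> \<le> real p * m * h x + m * h x"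
    by (intro add_mono mult_left_mono m sum_Lop_h_le) (use Suc.prems m in auto)
  finally show ?case by (simp add: algebra_simps)
qed simp

end

section \<open>Rearranging absolutely convergent sums over words\<close>

lemma has_sum_fibres:
  fixes F :: "'a \<Rightarrow> 'b :: banach"
  assumes F: "F summable_on UNIV"
  shows "(\<lambda>n::nat. infsum F {w. q w = n}) sums infsum F UNIV"
proof -
  have "bij_betw snd (Sigma UNIV (\<lambda>n. {w. q w = n})) UNIV"
    by (rule bij_betwI[of _ _ _ "\<lambda>w. (q w, w)"]) auto
  then have "((\<lambda>x. F (snd x)) has_sum infsum F UNIV) (Sigma UNIV (\<lambda>n. {w. q w = n}))"
    using has_sum_reindex_bij_betw[of snd _ UNIV F "infsum F UNIV"] F by (simp add: has_sum_infsum)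
  then have "((\<lambda>n. infsum F {w. q w = n}) has_sum infsum F UNIV) UNIV"
    by (rule has_sum_SigmaD) (use summable_on_subset_banach[OF F] in \<open>auto intro!: has_sum_infsum\<close>)
  then show ?thesis by (rule has_sum_imp_sums)
qed

lemma infsum_concat:
  fixes F G :: "'a list \<Rightarrow> 'b :: {real_normed_field, banach}"
  assumes F: "(\<lambda>u. norm (F u)) summable_on {u. length u = l}" and G: "(\<lambda>u. norm (G u)) summable_on {u. length u = m}"
  shows "infsum (\<lambda>v. F (take l v) * G (drop l v)) {v. length v = l + m} =
    infsum F {u. length u = l} * infsum G {u. length u = m}"
proof -
  let ?A = "{u :: 'a list. length u = l}" and ?B = "{u :: 'a list. length u = m}"
  have bij: "bij_betw (\<lambda>(a, b). a @ b) (?A \<times> ?B) {v. length v = l + m}"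
    by (rule bij_betwI[of _ _ _ "\<lambda>v. (take l v, drop l v)"]) auto
  have "(\<lambda>x. norm (case x of (a, b) \<Rightarrow> F a * G b)) summable_on (?A \<times> ?B)"
    unfolding Infinite_Sum.abs_summable_on_Sigma_iff
  proof (intro conjI ballI)
    show "(\<lambda>b. norm (case (a, b) of (a, b) \<Rightarrow> F a * G b)) summable_on ?B" for a
      using G by (simp add: norm_mult summable_on_cmult_right)
    show "(\<lambda>a. norm (infsum (\<lambda>b. norm (case (a, b) of (a, b) \<Rightarrow> F a * G b)) ?B)) summable_on ?A"
      using F by (simp add: norm_mult infsum_cmult_right' summable_on_cmult_left infsum_nonneg)
  qed
  then have sm: "(\<lambda>(a, b). F a * G b) summable_on (?A \<times> ?B)" by (rule Infinite_Sum.abs_summable_summable)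
  have "infsum (\<lambda>v. F (take l v) * G (drop l v)) {v. length v = l + m} =
      infsum (\<lambda>x. F (take l (case x of (a, b) \<Rightarrow> a @ b)) * G (drop l (case x of (a, b) \<Rightarrow> a @ b))) (?A \<times> ?B)"
    by (rule infsum_reindex_bij_betw[OF bij, symmetric])
  also have "\<dots> = infsum (\<lambda>(a, b). F a * G b) (?A \<times> ?B)" by (rule infsum_cong) auto
  also have "\<dots> = infsum (\<lambda>a. infsum (\<lambda>b. F a * G b) ?B) ?A"
    by (rule infsum_Sigma'_banach[OF sm, symmetric])
  also have "\<dots> = infsum F ?A * infsum G ?B" by (simp add: infsum_cmult_right' infsum_cmult_left')
  finally show ?thesis .
qed

text \<open>Words are grouped by their exponent of z; each group is finite because every letter
  contributes at least 1 to the exponent.\<close>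

definition word_coeff :: "(nat list \<Rightarrow> 'a :: comm_monoid_add) \<Rightarrow> nat \<Rightarrow> 'a" where
  "word_coeff f n = (\<Sum>w\<in>{w. tot w = n}. f w)"

lemma word_coeff_sums:
  fixes f :: "nat list \<Rightarrow> complex"
  assumes "(\<lambda>w. norm (f w * z ^ tot w)) summable_on UNIV"
  shows "(\<lambda>n. word_coeff f n * z ^ n) sums infsum (\<lambda>w. f w * z ^ tot w) UNIV"
proof -
  have "infsum (\<lambda>w. f w * z ^ tot w) {w. tot w = n} = word_coeff f n * z ^ n" for n
    by (simp add: word_coeff_def sum_distrib_right)
  then show ?thesis using has_sum_fibres[OF Infinite_Sum.abs_summable_summable[OF assms], of tot] by simp
qed

lemma sum_word_coeff_le:
  fixes f :: "nat list \<Rightarrow> complex"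
  assumes "\<And>X. finite X \<Longrightarrow> (\<Sum>w\<in>X. W (tot w) * norm (f w)) \<le> K" "\<And>n. 0 \<le> W n"
  shows "(\<Sum>n<N. W n * norm (word_coeff f n)) \<le> K"
proof -
  have "(\<Sum>n<N. W n * norm (word_coeff f n)) \<le> (\<Sum>n<N. \<Sum>w\<in>{w. tot w = n}. W (tot w) * norm (f w))"
    unfolding word_coeff_def sum_distrib_left[symmetric]
  proof (rule sum_mono)
    fix n
    have "W n * norm (\<Sum>w\<in>{w. tot w = n}. f w) \<le> W n * (\<Sum>w\<in>{w. tot w = n}. norm (f w))"
      by (intro mult_left_mono norm_sum assms)
    also have "\<dots> = (\<Sum>w\<in>{w. tot w = n}. W (tot w) * norm (f w))" by (simp add: sum_distrib_left)
    finally show "W n * norm (\<Sum>w\<in>{w. tot w = n}. f w) \<le> (\<Sum>w\<in>{w. tot w = n}. W (tot w) * norm (f w))" .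
  qed
  also have "\<dots> = (\<Sum>w\<in>(\<Union>n<N. {w. tot w = n}). W (tot w) * norm (f w))"
    by (rule sum.UNION_disjoint[symmetric]) auto
  also have "\<dots> \<le> K" by (rule assms) simp
  finally show ?thesis .
qed

lemma abs_summable_on_if_finite_sums_le:
  assumes "\<And>X. finite X \<Longrightarrow> (\<Sum>x\<in>X. norm (F x)) \<le> (K::real)"
  shows "(\<lambda>x. norm (F x)) summable_on A"
  unfolding Infinite_Sum.abs_summable_iff_bdd_above by (intro bdd_aboveI2[of _ _ K] assms) auto

lemma summable_linear_times_power:
  assumes "0 \<le> s" "s < (1::real)"
  shows "summable (\<lambda>p. (real p + 1) ^ k * s ^ p)"
proof (cases "s = 0")
  case True
  show ?thesis by (rule summable_finite[of "{0}"]) (auto simp: True)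
next
  case False
  have "summable (\<lambda>p. real p ^ k * 1 * s ^ p)"
    by (rule summable_power_times[of _ _ 1]) (use assms in auto)
  then have "summable (\<lambda>p. real (Suc p) ^ k * 1 * s ^ Suc p)" by (rule summable_Suc_iff[THEN iffD2])
  then have "summable (\<lambda>p. inverse s * (real (Suc p) ^ k * 1 * s ^ Suc p))" by (rule summable_mult)
  moreover have eq: "inverse s * (real (Suc p) ^ k * 1 * s ^ Suc p) = (real p + 1) ^ k * s ^ p" for p
    using False by (simp add: add.commute)
  ultimately show ?thesis by (simp only: eq)
qed

section \<open>Removing a rank-one piece inside the cone\<close>

locale cone_system = renewal_system +
  fixes B hmin hmax :: real
  assumes B_pos: "B > 0" and cone_h: "cone B h" and B_big: "(B + C3) * \<theta> < B"
    and hmin_pos: "hmin > 0" and hmin: "\<And>x. x \<in> Omega_star \<Longrightarrow> hmin \<le> h x"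
    and hmax: "\<And>x. x \<in> Omega_star \<Longrightarrow> h x \<le> hmax"
begin

text \<open>The constant to which one letter improves B: a common letter contracts the metric by
  \<open>\<theta>\<close>, and the weight adds \<open>C3 * \<theta>\<close>. The gap up to B is what
  may be spent on subtracting a constant.\<close>

definition "B1 = (B + C3) * \<theta>"

text \<open>The solution of c exp B1 B exp B = B - B1, which balances the two linear estimates
  behind \<open>cone_inequality\<close>.\<close>

definition "c = (B - B1) / (B * exp (B + B1))"

text \<open>As \<open>Lop n f\<close> lies in the cone of constant B1, its value at
  \<open>ones\<close> is at least exp (- B1) times any other value, so subtracting c times it
  removes at least the fraction c exp (- B1).\<close>

definition "r = 1 - c * exp (- B1)"

definition Nop :: "nat \<Rightarrow> (point \<Rightarrow> real) \<Rightarrow> point \<Rightarrow> real" where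
  "Nop n f = (\<lambda>\<omega>. Lop n f \<omega> - c * Lop n f ones)"

definition Nw :: "nat list \<Rightarrow> (point \<Rightarrow> real) \<Rightarrow> point \<Rightarrow> real" where
  "Nw u f = fold Nop u f"

lemma B1_bounds: "0 < B1" "B1 < B"
  using B_pos C3_pos theta B_big by (auto simp: B1_def)

lemma c_bounds: "0 < c" "c * exp B1 < 1" "c < 1"
proof -
  show c: "0 < c" using B1_bounds B_pos unfolding c_def by simp
  have "c * exp B1 = (B - B1) / B * exp (- B)"
    unfolding c_def using B_pos by (simp add: exp_add exp_minus field_simps)
  also have "\<dots> < 1 * 1" using B1_bounds B_pos by (intro mult_strict_mono) auto
  finally show 1: "c * exp B1 < 1" by simp
  have "c * 1 \<le> c * exp B1" using c B1_bounds by (intro mult_left_mono) auto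
  with 1 show "c < 1" by simp
qed

lemma r_bounds: "0 < r" "r < 1"
proof -
  have "c * exp (- B1) \<le> c * 1" using c_bounds B1_bounds by (intro mult_left_mono) auto
  then show "0 < r" using c_bounds(3) unfolding r_def by linarith
  show "r < 1" using c_bounds by (simp add: r_def)
qed

lemma exp_minus_one_le: "0 \<le> t \<Longrightarrow> exp t - 1 \<le> t * exp (t::real)"
  using mult_left_mono[OF exp_ge_add_one_self[of "- t"], of "exp t"] by (simp add: exp_minus algebra_simps)

text \<open>By exp t - 1 \<le> t exp t the left side is at most c exp B1 B exp B \<delta>; by 1 + t
  \<le> exp t the right side is at least (B - B1) \<delta>. The choice of c makes these two
  equal.\<close>

lemma cone_inequality:
  assumes "0 \<le> \<delta>" "\<delta> \<le> 1"
  shows "c * exp B1 * (exp (B * \<delta>) - 1) \<le> exp (B * \<delta>) - exp (B1 * \<delta>)"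
proof -
  have "exp (B * \<delta>) - 1 \<le> B * \<delta> * exp (B * \<delta>)" using assms B_pos by (intro exp_minus_one_le) simp
  also have "\<dots> \<le> B * \<delta> * exp B" using assms B_pos by (intro mult_left_mono) (auto simp: mult_left_le)
  finally have "c * exp B1 * (exp (B * \<delta>) - 1) \<le> c * exp B1 * (B * \<delta> * exp B)"
    using c_bounds by (intro mult_left_mono) auto
  also have "\<dots> = (B - B1) * \<delta>" using B_pos unfolding c_def by (simp add: exp_add field_simps)
  also have "\<dots> \<le> exp ((B - B1) * \<delta>) - 1" using exp_ge_add_one_self[of "(B - B1) * \<delta>"] by linarith
  also have "\<dots> \<le> exp (B1 * \<delta>) * (exp ((B - B1) * \<delta>) - 1)"
  proof -
    have "1 \<le> exp (B1 * \<delta>)" "0 \<le> exp ((B - B1) * \<delta>) - 1" using B1_bounds assms by auto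
    from mult_right_mono[OF this] show ?thesis by simp
  qed
  also have "\<dots> = exp (B * \<delta>) - exp (B1 * \<delta>)" by (simp add: right_diff_distrib left_diff_distrib flip: exp_add)
  finally show ?thesis .
qed

lemma coneD:
  assumes "cone A f" "x \<in> Omega_star" "y \<in> Omega_star"
  shows "0 \<le> f x" "f x \<le> exp (A * d_theta \<theta> x y) * f y"
  using assms by (auto simp: cone_def)

lemma cone_le_exp:
  assumes "cone A f" "0 \<le> A" "x \<in> Omega_star" "y \<in> Omega_star"
  shows "f x \<le> exp A * f y"
proof -
  have "exp (A * d_theta \<theta> x y) * f y \<le> exp A * f y"
    using assms coneD(1)[OF assms(1), of y] by (intro mult_right_mono) (auto simp: mult_left_le)
  then show ?thesis using coneD(2)[OF assms(1,3,4)] by linarith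
qed

text \<open>One factor exp B comes from exp t - 1 \<le> t exp t, the other from comparing with the
  free reference point z, so that sums over functions can be bounded at one common point.\<close>

lemma cone_lipschitz:
  assumes f: "cone B f" and xy: "x \<in> Omega_star" "y \<in> Omega_star" "z \<in> Omega_star" "d_theta \<theta> x y \<le> \<delta>"
  shows "\<bar>f x - f y\<bar> \<le> B * exp (2 * B) * \<delta> * f z"
proof -
  have *: "f x - f y \<le> B * exp (2 * B) * \<delta> * f z"
    if "x \<in> Omega_star" "y \<in> Omega_star" "d_theta \<theta> x y \<le> \<delta>" for x y
  proof -
    let ?d = "d_theta \<theta> x y"
    have \<delta>: "0 \<le> \<delta>" using that d_bounds(1)[of x y] by linarith
    have "f x - f y \<le> (exp (B * ?d) - 1) * f y"
      using coneD(2)[OF f that(1,2)] by (simp add: left_diff_distrib)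
    also have "\<dots> \<le> (B * \<delta> * exp B) * (exp B * f z)"
    proof (rule mult_mono)
      have "exp (B * ?d) - 1 \<le> B * ?d * exp (B * ?d)" using B_pos by (intro exp_minus_one_le) simp
      also have "\<dots> \<le> B * \<delta> * exp B"
        using B_pos that \<delta> by (intro mult_mono) (auto simp: mult_left_le)
      finally show "exp (B * ?d) - 1 \<le> B * \<delta> * exp B" .
      show "f y \<le> exp B * f z" using f B_pos that xy by (intro cone_le_exp) auto
      show "0 \<le> B * \<delta> * exp B" using B_pos \<delta> by simp
      show "0 \<le> f y" using coneD(1)[OF f] that by blast
    qed
    also have "\<dots> = B * exp (2 * B) * \<delta> * f z" by (simp add: mult_ac flip: exp_add)
    finally show ?thesis .
  qed
  show ?thesis using *[OF xy(1,2,4)] *[OF xy(2,1)] xy(4) by (simp add: abs_le_iff d_theta_sym)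
qed

lemma cone_mono: "cone A f \<Longrightarrow> A \<le> A' \<Longrightarrow> cone A' f"
  unfolding cone_def
  by (meson d_bounds(1) exp_le_cancel_iff mult_right_mono order_trans)

lemma cone_one: "cone B (\<lambda>_. 1)"
  using B_pos by (simp add: cone_def)

lemma cone_Lop:
  assumes f: "cone B f"
  shows "cone B1 (Lop n f)"
  unfolding cone_def
proof safe
  fix x assume "x \<in> Omega_star"
  then show "0 \<le> Lop n f x" using coneD(1)[OF f] by (intro Lop_nonneg) simp
next
  fix x y assume xy: "x \<in> Omega_star" "y \<in> Omega_star"
  have "Lop n f x \<le> (exp (C3 * \<theta> * d_theta \<theta> x y) * \<psi> n y) * (exp (B * (\<theta> * d_theta \<theta> x y)) * f (cons n y))"
    unfolding Lop_def using coneD[OF f, of "cons n x" "cons n y"] coneD(1)[OF f, of "cons n y"] psi_lipschitz[OF xy] xy psi_pos[of n y]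
    by (intro mult_mono) (auto simp: less_imp_le)
  also have "\<dots> = exp (B1 * d_theta \<theta> x y) * Lop n f y"
    by (simp add: Lop_def B1_def distrib_right distrib_left exp_add mult_ac)
  finally show "Lop n f x \<le> exp (B1 * d_theta \<theta> x y) * Lop n f y" .
qed

lemma cone_Lop': "cone B f \<Longrightarrow> cone B (Lop n f)"
  using cone_Lop cone_mono B1_bounds by (meson less_imp_le)

lemma Nop_le:
  assumes f: "cone B f" and x: "x \<in> Omega_star"
  shows "Nop n f x \<le> r * Lop n f x" "0 \<le> Nop n f x"
proof -
  have "Lop n f x \<le> exp B1 * Lop n f ones" by (rule cone_le_exp[OF cone_Lop[OF f]]) (use B1_bounds x in auto)
  then have "exp (- B1) * Lop n f x \<le> exp (- B1) * (exp B1 * Lop n f ones)" by (intro mult_left_mono) auto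
  also have "\<dots> = Lop n f ones" by (simp add: mult.assoc[symmetric] flip: exp_add)
  finally have "c * (exp (- B1) * Lop n f x) \<le> c * Lop n f ones" using c_bounds by (intro mult_left_mono) auto
  then show "Nop n f x \<le> r * Lop n f x" by (simp add: Nop_def r_def algebra_simps)
  have "Lop n f ones \<le> exp B1 * Lop n f x" by (rule cone_le_exp[OF cone_Lop[OF f]]) (use B1_bounds x in auto)
  then have "c * Lop n f ones \<le> c * (exp B1 * Lop n f x)" using c_bounds by (intro mult_left_mono) auto
  also have "\<dots> = c * exp B1 * Lop n f x" by simp
  also have "\<dots> \<le> 1 * Lop n f x"
    using c_bounds coneD(1)[OF cone_Lop[OF f] x x] by (intro mult_right_mono) auto
  finally show "0 \<le> Nop n f x" by (simp add: Nop_def)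
qed

text \<open>Subtracting a constant enlarges the relative oscillation. Here the constant is at most c
  exp B1 times any value of \<open>Lop n f\<close>, and by \<open>cone_inequality\<close> the loss
  fits into the gap between B1 and B.\<close>

lemma cone_Nop:
  assumes f: "cone B f"
  shows "cone B (Nop n f)"
  unfolding cone_def
proof safe
  fix x assume "x \<in> Omega_star" then show "0 \<le> Nop n f x" by (rule Nop_le[OF f])
next
  fix x y assume xy: "x \<in> Omega_star" "y \<in> Omega_star"
  let ?d = "d_theta \<theta> x y" and ?g = "Lop n f"
  note g = cone_Lop[OF f, of n]
  have "c * ?g ones \<le> c * (exp B1 * ?g y)"
    using c_bounds by (intro mult_left_mono cone_le_exp[OF g]) (use B1_bounds xy in auto)
  then have "c * ?g ones * (exp (B * ?d) - 1) \<le> c * (exp B1 * ?g y) * (exp (B * ?d) - 1)"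
    using B_pos by (intro mult_right_mono) auto
  also have "\<dots> = c * exp B1 * (exp (B * ?d) - 1) * ?g y" by simp
  also have "\<dots> \<le> (exp (B * ?d) - exp (B1 * ?d)) * ?g y"
    using coneD(1)[OF g xy(2,2)] by (intro mult_right_mono cone_inequality) auto
  finally have "exp (B1 * ?d) * ?g y - c * ?g ones \<le> exp (B * ?d) * (?g y - c * ?g ones)"
    by (simp add: algebra_simps)
  with coneD(2)[OF g xy] show "Nop n f x \<le> exp (B * ?d) * Nop n f y" by (simp add: Nop_def)
qed

lemma Nw_simps [simp]: "Nw [] f = f" "Nw (n # u) f = Nw u (Nop n f)" "Nw (u @ v) f = Nw v (Nw u f)"
  by (simp_all add: Nw_def)

lemma cone_Lw: "cone B f \<Longrightarrow> cone B (Lw u f)"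
  by (induction u arbitrary: f) (auto intro: cone_Lop')

lemma cone_Nw: "cone B f \<Longrightarrow> cone B (Nw u f)"
  by (induction u arbitrary: f) (auto intro: cone_Nop)

lemma Nw_le:
  assumes "cone B f" "x \<in> Omega_star"
  shows "Nw u f x \<le> r ^ length u * Lw u f x"
  using assms
proof (induction u arbitrary: f)
  case (Cons n u)
  have "Nw (n # u) f x \<le> r ^ length u * Lw u (Nop n f) x"
    using Cons cone_Nop by simp
  also have "\<dots> \<le> r ^ length u * Lw u (\<lambda>x. r * Lop n f x) x"
    using Cons.prems r_bounds by (intro mult_left_mono Lw_mono Nop_le) auto
  also have "\<dots> = r ^ length (n # u) * Lw (n # u) f x" by (simp add: Lw_cmult)
  finally show ?case .
qed simp

lemma Nw_add_const: "Nw u (\<lambda>x. f x + k * g x) y = Nw u f y + k * Nw u g y"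
proof (induction u arbitrary: f g)
  case (Cons n u)
  have "Nop n (\<lambda>x. f x + k * g x) = (\<lambda>x. Nop n f x + k * Nop n g x)"
    by (simp add: Nop_def Lop_def algebra_simps)
  then show ?case using Cons by simp
qed simp

lemma cone_Lw_one: "cone B (Lw u (\<lambda>_. 1))" "cone B (Nw u (\<lambda>_. 1))"
  using cone_Lw[OF cone_one] cone_Nw[OF cone_one] by auto

lemma Lw_one_le: "x \<in> Omega_star \<Longrightarrow> Lw u (\<lambda>_. 1) x \<le> Lw u h x / hmin"
proof -
  assume x: "x \<in> Omega_star"
  have "Lw u (\<lambda>_. hmin * 1) x \<le> Lw u h x" by (rule Lw_mono) (use hmin x in simp)
  then show ?thesis unfolding Lw_cmult using hmin_pos by (simp add: field_simps)
qed

lemma Nw_one_le: "x \<in> Omega_star \<Longrightarrow> Nw u (\<lambda>_. 1) x \<le> r ^ length u * Lw u h x / hmin"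
proof -
  assume x: "x \<in> Omega_star"
  have "r ^ length u * Lw u (\<lambda>_. 1) x \<le> r ^ length u * (Lw u h x / hmin)"
    using r_bounds x by (intro mult_left_mono Lw_one_le) auto
  then show ?thesis using Nw_le[OF cone_one x, of u] by simp
qed

section \<open>Traces and the renewal sequence\<close>

lemma Nw_Lw_step:
  assumes "j < length u"
  shows "Nw (drop (Suc j) u) (Lw (take (Suc j) u) f) y =
    Nw (drop j u) (Lw (take j u) f) y + c * Lw (take (Suc j) u) f ones * Nw (drop (Suc j) u) (\<lambda>_. 1) y"
proof -
  let ?n = "u ! j" and ?g = "Lw (take j u) f"
  have t: "take (Suc j) u = take j u @ [?n]" using assms by (rule take_Suc_conv_app_nth)
  have d: "drop j u = ?n # drop (Suc j) u" using assms by (rule Cons_nth_drop_Suc[symmetric])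
  have "Lw (take (Suc j) u) f = (\<lambda>x. Nop ?n ?g x + c * Lop ?n ?g ones * 1)"
    unfolding t by (simp add: Nop_def)
  then have "Nw (drop (Suc j) u) (Lw (take (Suc j) u) f) y =
      Nw (drop (Suc j) u) (Nop ?n ?g) y + c * Lop ?n ?g ones * Nw (drop (Suc j) u) (\<lambda>_. 1) y"
    using Nw_add_const[of "drop (Suc j) u" "Nop ?n ?g" "c * Lop ?n ?g ones" "\<lambda>_. 1"] by simp
  then show ?thesis unfolding t d by simp
qed

text \<open>Telescoping over the border between full and reduced letters: each summand uses the
  rank-one part at one letter, full operators up to it and reduced ones after it.\<close>

lemma Lw_split:
  "Lw u f y = Nw u f y + (\<Sum>j<length u. c * Lw (take (Suc j) u) f ones * Nw (drop (Suc j) u) (\<lambda>_. 1) y)"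
proof -
  define T where "T j = Nw (drop j u) (Lw (take j u) f) y" for j
  have "(\<Sum>j<length u. c * Lw (take (Suc j) u) f ones * Nw (drop (Suc j) u) (\<lambda>_. 1) y) =
      (\<Sum>j<length u. T (Suc j) - T j)"
    by (rule sum.cong) (simp_all add: T_def Nw_Lw_step)
  also have "\<dots> = T (length u) - T 0" by (rule sum_lessThan_telescope)
  finally show ?thesis by (simp add: T_def)
qed

text \<open>
  The coefficients of the renewal sequence: the words that return to the constant function 1
  for the first time when the last letter is read.
\<close>

definition renewal :: "nat list \<Rightarrow> real" where
  "renewal v = (if v = [] then 0 else c * Lop (last v) (Nw (butlast v) (\<lambda>_. 1)) ones)"

text \<open>Loops at the constant 1 that may not return during the first i letters and are free
  afterwards; for i = length v - 1 this is the first-return weight \<open>renewal v\<close>.\<close>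

definition return_weight :: "nat \<Rightarrow> nat list \<Rightarrow> real" where
  "return_weight i v = c * Lw (drop i v) (Nw (take i v) (\<lambda>_. 1)) ones"

text \<open>Formally the trace of \<open>Lw w\<close>, a weighted composition with a contraction
  whose fixed point is \<open>periodic_point w\<close>.\<close>

definition trace_weight :: "nat list \<Rightarrow> real" where
  "trace_weight w = Lw w (\<lambda>_. 1) (periodic_point w)"

text \<open>Formally the trace of \<open>Lw w\<close> minus that of \<open>Nw w\<close>: the
  rank-one part is used at position j, and cyclicity of the trace rotates the word so that the loop
  begins and ends there.\<close>

definition cyclic_weight :: "nat list \<Rightarrow> real" where
  "cyclic_weight w = (\<Sum>j<length w. return_weight (length w - Suc j) (rotate (Suc j) w))"

text \<open>Decomposition by the last return before the end, at position l > i: what follows it is a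
  first return, what precedes it is again free after i letters. If there is no such return,
  \<open>renewal v\<close> remains.\<close>

lemma return_weight_rec:
  assumes "i < length v"
  shows "return_weight i v = renewal v + (\<Sum>l\<in>{i<..<length v}. return_weight i (take l v) * renewal (drop l v))"
proof -
  define x where "x = take i v"
  define u where "u = butlast (drop i v)"
  define n where "n = last (drop i v)"
  have x: "length x = i" using assms by (simp add: x_def)
  have "u @ [n] = drop i v" unfolding u_def n_def using assms by (intro append_butlast_last_id) simp
  then have v: "v = x @ u @ [n]" by (simp add: x_def)
  have lv: "length v = i + Suc (length u)" using x v by simp
  let ?g = "Nw x (\<lambda>_. 1)" and ?y = "cons n ones"
  have "return_weight i v = c * (\<psi> n ones * Lw u ?g ?y)"
    using x by (simp add: return_weight_def v Lop_def)
  also have "\<dots> = c * (\<psi> n ones * Nw u ?g ?y) +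
      (\<Sum>j<length u. c * Lw (take (Suc j) u) ?g ones * (c * (\<psi> n ones * Nw (drop (Suc j) u) (\<lambda>_. 1) ?y)))"
    by (subst Lw_split) (simp add: distrib_left sum_distrib_left mult_ac)
  also have "c * (\<psi> n ones * Nw u ?g ?y) = renewal v"
    by (simp add: renewal_def v butlast_append Lop_def)
  also have "(\<Sum>j<length u. c * Lw (take (Suc j) u) ?g ones * (c * (\<psi> n ones * Nw (drop (Suc j) u) (\<lambda>_. 1) ?y))) =
      (\<Sum>l\<in>{i<..<length v}. return_weight i (take l v) * renewal (drop l v))"
  proof (rule sum.reindex_bij_witness[of _ "\<lambda>l. l - Suc i" "\<lambda>j. i + Suc j"])
    fix j assume "j \<in> {..<length u}"
    then show "return_weight i (take (i + Suc j) v) * renewal (drop (i + Suc j) v) =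
        c * Lw (take (Suc j) u) ?g ones * (c * (\<psi> n ones * Nw (drop (Suc j) u) (\<lambda>_. 1) ?y))"
      using x by (simp add: return_weight_def renewal_def v Lop_def butlast_append)
  qed (use lv in auto)
  finally show ?thesis .
qed

lemma return_weight_rotate:
  assumes "j < length w"
  shows "return_weight (length w - Suc j) (rotate (Suc j) w) =
    c * Lw (take (Suc j) w) (Nw (drop (Suc j) w) (\<lambda>_. 1)) ones"
proof -
  have "rotate (Suc j) w = drop (Suc j) w @ take (Suc j) w"
  proof (cases "Suc j = length w")
    case False
    then show ?thesis using assms by (subst rotate_drop_take) simp
  qed simp
  then show ?thesis using assms by (simp add: return_weight_def)
qed

lemma Lop_le_Lop: "f (cons n x) \<le> g (cons n x) \<Longrightarrow> Lop n f x \<le> Lop n g x"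
  using psi_pos[of n x] by (simp add: Lop_def)

lemma Lw_h_nonneg [simp]: "x \<in> Omega_star \<Longrightarrow> 0 \<le> Lw u h x"
  by (subst Lw_one) (use Lw_one_pos[of u x] h_pos in \<open>auto intro!: mult_nonneg_nonneg less_imp_le\<close>)

text \<open>All letters but the last are reduced and contract by r; the last one carries the
  rank-one functional instead, which accounts for the extra factor 1 / r.\<close>

lemma renewal_bounds:
  "0 \<le> renewal v" "renewal v \<le> c / (hmin * r) * r ^ length v * Lw v h ones"
proof -
  show "0 \<le> renewal v"
    using c_bounds(1) coneD(1)[OF cone_Lop'[OF cone_Lw_one(2)], of ones ones "last v" "butlast v"]
    by (simp add: renewal_def)
  show "renewal v \<le> c / (hmin * r) * r ^ length v * Lw v h ones"
  proof (cases "v = []")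
    case True
    then show ?thesis using c_bounds hmin_pos r_bounds h_pos[of ones] by (auto simp: renewal_def)
  next
    case False
    then obtain u n where v: "v = u @ [n]" by (metis rev_exhaust)
    have "Lop n (Nw u (\<lambda>_. 1)) ones \<le> Lop n (\<lambda>x. r ^ length u * Lw u h x / hmin) ones"
      by (rule Lop_le_Lop) (simp add: Nw_one_le)
    also have "\<dots> = r ^ length u * Lw v h ones / hmin" by (simp add: Lop_def v)
    finally have "c * Lop n (Nw u (\<lambda>_. 1)) ones \<le> c * (r ^ length u * Lw v h ones / hmin)"
      using c_bounds by (intro mult_left_mono) auto
    also have "\<dots> = c / (hmin * r) * r ^ length v * Lw v h ones" using r_bounds by (simp add: v)
    finally show ?thesis by (simp add: renewal_def v)
  qed
qed

lemma return_weight_bounds: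
  "0 \<le> return_weight i v" "return_weight i v \<le> c / hmin * Lw v h ones"
proof -
  show "0 \<le> return_weight i v"
    using c_bounds(1) coneD(1)[OF cone_Lw[OF cone_Lw_one(2)], of ones ones "drop i v" "take i v"]
    by (simp add: return_weight_def)
  have "Lw (drop i v) (Nw (take i v) (\<lambda>_. 1)) ones \<le> Lw (drop i v) (\<lambda>x. (1 / hmin) * Lw (take i v) h x) ones"
  proof (rule Lw_mono)
    let ?y = "prepend (drop i v) ones"
    have "Nw (take i v) (\<lambda>_. 1) ?y \<le> r ^ length (take i v) * Lw (take i v) h ?y / hmin"
      by (rule Nw_one_le) simp
    also have "\<dots> \<le> 1 * Lw (take i v) h ?y / hmin"
      using r_bounds hmin_pos by (intro divide_right_mono mult_right_mono power_le_one) auto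
    finally show "Nw (take i v) (\<lambda>_. 1) ?y \<le> (1 / hmin) * Lw (take i v) h ?y" by simp
  qed
  also have "\<dots> = 1 / hmin * Lw (take i v @ drop i v) h ones" by (simp only: Lw_cmult Lw_simps)
  finally have "c * Lw (drop i v) (Nw (take i v) (\<lambda>_. 1)) ones \<le> c * (1 / hmin * Lw v h ones)"
    using c_bounds by (intro mult_left_mono) auto
  then show "return_weight i v \<le> c / hmin * Lw v h ones" by (simp add: return_weight_def)
qed

lemma trace_weight_bounds:
  assumes "w \<noteq> []"
  shows "0 \<le> trace_weight w" "trace_weight w \<le> exp B / hmin * Lw w h ones"
proof -
  show "0 \<le> trace_weight w" by (simp add: trace_weight_def Lw_one_pos less_imp_le)
  have "trace_weight w \<le> exp B * Lw w (\<lambda>_. 1) ones"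
    unfolding trace_weight_def by (rule cone_le_exp[OF cone_Lw_one(1)]) (use assms B_pos in auto)
  also have "\<dots> \<le> exp B * (Lw w h ones / hmin)" by (intro mult_left_mono Lw_one_le) auto
  finally show "trace_weight w \<le> exp B / hmin * Lw w h ones" by simp
qed

text \<open>The common rate of two gains: p - j reduced letters give \<open>r ^ (p - j)\<close>, and
  moving a point behind j common letters gives \<open>\<theta> ^ j\<close>.\<close>

definition "s = max r \<theta>"

lemma s_bounds: "0 < s" "s < 1" "r \<le> s" "\<theta> \<le> s"
  using r_bounds theta by (auto simp: s_def)

text \<open>
  Telescoping along \<open>N_{w_{j+1}\<dots>w_p} L_{w_1\<dots>w_j} 1\<close>, evaluated at points \<open>\<xi> j\<close> which agree in the
  first \<open>j\<close> letters and reach the periodic point at the end; replacing \<open>L\<close> by \<open>N\<close> produces the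
  cyclic weight, moving the point costs a factor \<open>\<theta>\<^sup>j\<close>.
\<close>

lemma trace_minus_cyclic_le:
  assumes w: "w \<noteq> []"
  shows "\<bar>trace_weight w - cyclic_weight w\<bar> \<le>
    (exp B + B * exp (2 * B)) / hmin * (real (length w) + 1) * s ^ length w * Lw w h ones"
proof -
  define p where "p = length w"
  define \<xi> where "\<xi> j = (if j < p then prepend (take (Suc j) w) ones else periodic_point w)" for j
  define T where "T j = Nw (drop j w) (Lw (take j w) (\<lambda>_. 1))" for j
  have \<xi>star: "\<xi> j \<in> Omega_star" for j using w by (simp add: \<xi>_def)
  have coneT: "cone B (T j)" for j unfolding T_def by (intro cone_Nw cone_Lw cone_one)
  have T_le: "T j ones \<le> r ^ (p - j) * (Lw w h ones / hmin)" if "j \<le> p" for j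
  proof -
    have "T j ones \<le> r ^ length (drop j w) * Lw (drop j w) (Lw (take j w) (\<lambda>_. 1)) ones"
      unfolding T_def by (intro Nw_le cone_Lw cone_one) simp
    also have "Lw (drop j w) (Lw (take j w) (\<lambda>_. 1)) ones = Lw (take j w @ drop j w) (\<lambda>_. 1) ones"
      by (simp only: Lw_simps)
    also have "\<dots> = Lw w (\<lambda>_. 1) ones" by simp
    also have "r ^ length (drop j w) * Lw w (\<lambda>_. 1) ones \<le> r ^ length (drop j w) * (Lw w h ones / hmin)"
      using r_bounds by (intro mult_left_mono Lw_one_le) auto
    finally show ?thesis by (simp add: p_def)
  qed
  have bound: "\<theta> ^ j * (r ^ (p - j) * (Lw w h ones / hmin)) \<le> s ^ p * (Lw w h ones / hmin)" if "j \<le> p" for j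
  proof -
    have "\<theta> ^ j * r ^ (p - j) \<le> s ^ j * s ^ (p - j)"
      using s_bounds r_bounds theta by (intro mult_mono power_mono) auto
    also have "\<dots> = s ^ p" using that by (simp flip: power_add)
    finally show ?thesis using hmin_pos unfolding mult.assoc[symmetric] by (intro mult_right_mono) auto
  qed
  have step: "T (Suc j) (\<xi> (Suc j)) - T j (\<xi> j) =
      (T (Suc j) (\<xi> (Suc j)) - T (Suc j) (\<xi> j)) + return_weight (p - Suc j) (rotate (Suc j) w)" if j: "j < p" for j
  proof -
    have "T (Suc j) (\<xi> j) = T j (\<xi> j) + c * Lw (take (Suc j) w) (\<lambda>_. 1) ones * Nw (drop (Suc j) w) (\<lambda>_. 1) (\<xi> j)"
      unfolding T_def by (rule Nw_Lw_step) (use j p_def in simp)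
    \<comment> \<open>For j < p the point \<open>\<xi> j\<close> is \<open>ones\<close> preceded by
      exactly the letters read so far, so the two values merge into one operator value at
      \<open>ones\<close>.\<close>
    also have "Lw (take (Suc j) w) (\<lambda>_. 1) ones * Nw (drop (Suc j) w) (\<lambda>_. 1) (\<xi> j) =
        Lw (take (Suc j) w) (Nw (drop (Suc j) w) (\<lambda>_. 1)) ones"
      using j by (subst (2) Lw_one) (simp add: \<xi>_def)
    then have "c * Lw (take (Suc j) w) (\<lambda>_. 1) ones * Nw (drop (Suc j) w) (\<lambda>_. 1) (\<xi> j) =
        return_weight (p - Suc j) (rotate (Suc j) w)"
      using j return_weight_rotate[of j w] by (simp only: p_def mult.assoc)
    finally show ?thesis by simp
  qed
  have move: "\<bar>T (Suc j) (\<xi> (Suc j)) - T (Suc j) (\<xi> j)\<bar> \<le> B * exp (2 * B) * (s ^ p * (Lw w h ones / hmin))"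
    if j: "j < p" for j
  proof -
    \<comment> \<open>Consecutive points share j + 1 letters; the tail is one more letter before
      \<open>ones\<close>, or at the end the periodic point itself.\<close>
    obtain x where x: "x \<in> Omega_star" "\<xi> (Suc j) = prepend (take (Suc j) w) x"
    proof (cases "Suc j < p")
      case True
      then have "take (Suc (Suc j)) w = take (Suc j) w @ [w ! Suc j]"
        unfolding p_def by (rule take_Suc_conv_app_nth)
      then show thesis using that[of "cons (w ! Suc j) ones"] True by (simp add: \<xi>_def)
    next
      case False
      then have "Suc j = p" using j by simp
      then show thesis using that[of "periodic_point w"] w by (simp add: \<xi>_def p_def)
    qed
    have "d_theta \<theta> (\<xi> (Suc j)) (\<xi> j) = \<theta> ^ Suc j * d_theta \<theta> x ones"
    proof -
      have "length (take (Suc j) w) = Suc j" using j by (simp add: p_def)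
      then show ?thesis unfolding x(2) using j by (simp only: \<xi>_def if_True d_theta_prepend)
    qed
    also have "\<dots> \<le> \<theta> ^ Suc j" using theta by (intro mult_left_le) auto
    finally have "\<bar>T (Suc j) (\<xi> (Suc j)) - T (Suc j) (\<xi> j)\<bar> \<le> B * exp (2 * B) * \<theta> ^ Suc j * T (Suc j) ones"
      by (intro cone_lipschitz[OF coneT] \<xi>star) auto
    also have "\<dots> \<le> B * exp (2 * B) * \<theta> ^ Suc j * (r ^ (p - Suc j) * (Lw w h ones / hmin))"
      using j theta B_pos by (intro mult_left_mono T_le) auto
    also have "\<dots> = B * exp (2 * B) * (\<theta> ^ Suc j * (r ^ (p - Suc j) * (Lw w h ones / hmin)))"
      by (simp only: mult.assoc)
    also have "\<dots> \<le> B * exp (2 * B) * (s ^ p * (Lw w h ones / hmin))"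
      using j B_pos by (intro mult_left_mono bound) auto
    finally show ?thesis .
  qed
  have "trace_weight w = T p (\<xi> p)" by (simp add: trace_weight_def T_def \<xi>_def p_def)
  also have "\<dots> = T 0 (\<xi> 0) + (\<Sum>j<p. T (Suc j) (\<xi> (Suc j)) - T j (\<xi> j))"
    by (simp add: sum_lessThan_telescope[of "\<lambda>j. T j (\<xi> j)"])
  also have "(\<Sum>j<p. T (Suc j) (\<xi> (Suc j)) - T j (\<xi> j)) =
      (\<Sum>j<p. T (Suc j) (\<xi> (Suc j)) - T (Suc j) (\<xi> j)) + cyclic_weight w"
    by (simp add: step sum.distrib cyclic_weight_def p_def)
  finally have eq: "trace_weight w - cyclic_weight w = T 0 (\<xi> 0) + (\<Sum>j<p. T (Suc j) (\<xi> (Suc j)) - T (Suc j) (\<xi> j))"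
    by simp
  \<comment> \<open>The telescope starts from \<open>Nw w\<close> applied to 1, which is already of
    order \<open>r ^ p\<close>.\<close>
  have "\<bar>T 0 (\<xi> 0)\<bar> \<le> exp B * T 0 ones"
    using cone_le_exp[OF coneT[of 0] _ \<xi>star, of ones 0] coneD(1)[OF coneT[of 0] \<xi>star \<xi>star] B_pos by simp
  also have "\<dots> \<le> exp B * (s ^ p * (Lw w h ones / hmin))"
    using order_trans[OF T_le[of 0]] bound[of 0] by (intro mult_left_mono) auto
  finally have 0: "\<bar>T 0 (\<xi> 0)\<bar> \<le> exp B * (s ^ p * (Lw w h ones / hmin))" .
  have "\<bar>\<Sum>j<p. T (Suc j) (\<xi> (Suc j)) - T (Suc j) (\<xi> j)\<bar> \<le> (\<Sum>j<p. B * exp (2 * B) * (s ^ p * (Lw w h ones / hmin)))"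
    by (rule order_trans[OF sum_abs sum_mono]) (use move in auto)
  also have "\<dots> = real p * (B * exp (2 * B) * (s ^ p * (Lw w h ones / hmin)))" by simp
  finally have "\<bar>trace_weight w - cyclic_weight w\<bar> \<le> exp B * (s ^ p * (Lw w h ones / hmin)) +
      real p * (B * exp (2 * B) * (s ^ p * (Lw w h ones / hmin)))"
    using 0 unfolding eq by linarith
  also have "\<dots> \<le> (real p + 1) * (exp B * (s ^ p * (Lw w h ones / hmin))) +
      (real p + 1) * (B * exp (2 * B) * (s ^ p * (Lw w h ones / hmin)))"
  proof -
    have A: "0 \<le> s ^ p * (Lw w h ones / hmin)" using s_bounds hmin_pos by simp
    have "0 \<le> exp B * (s ^ p * (Lw w h ones / hmin))" by (rule mult_nonneg_nonneg[OF _ A]) simp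
    moreover have "0 \<le> B * exp (2 * B) * (s ^ p * (Lw w h ones / hmin))"
      by (rule mult_nonneg_nonneg[OF _ A]) (use B_pos in simp)
    moreover have "a + real p * b \<le> (real p + 1) * a + (real p + 1) * b" if "0 \<le> a" "0 \<le> b" for a b :: real
      using that by (simp add: distrib_right)
    ultimately show ?thesis by blast
  qed
  also have "\<dots> = (exp B + B * exp (2 * B)) / hmin * (real (length w) + 1) * s ^ length w * Lw w h ones"
    unfolding p_def using hmin_pos by (simp add: field_simps)
  finally show ?thesis .
qed

section \<open>Summation over all words\<close>

lemma sum_fixed_length_le:
  assumes "finite X" "X \<subseteq> {v. length v = p}" "x \<in> Omega_star"
  shows "(\<Sum>v\<in>X. Lw v h x) \<le> h x"
proof -
  have "finite (\<Union>u\<in>X. set u)" using assms(1) by simp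
  then obtain K where "\<forall>n\<in>(\<Union>u\<in>X. set u). n < K" using finite_nat_set_iff_bounded by blast
  then have "X \<subseteq> words K p" using assms(2) by (auto simp: words_def)
  then have "(\<Sum>v\<in>X. Lw v h x) \<le> (\<Sum>v\<in>words K p. Lw v h x)"
    using assms(3) by (intro sum_mono2) auto
  also have "\<dots> \<le> h x" using assms(3) by (rule sum_Lw_h_le)
  finally show ?thesis .
qed

text \<open>The factor \<open>q ^ length u\<close> beats every power of the length, so an additive
  weight on letters passes to words with a finite constant; the exponent rises by one for the choice
  of the weighted letter.\<close>

lemma weighted_words_le:
  assumes W: "\<And>n. 0 \<le> W n" and m: "\<And>K x. x \<in> Omega_star \<Longrightarrow> (\<Sum>n<K. W n * Lop n h x) \<le> m * h x" "0 \<le> m"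
    and x: "x \<in> Omega_star" and q: "0 \<le> q" "q < 1" and X: "finite X"
  shows "(\<Sum>u\<in>X. (real (length u) + 1) ^ k * q ^ length u * (\<Sum>n\<leftarrow>u. W n) * Lw u h x) \<le>
    (\<Sum>p. (real p + 1) ^ Suc k * q ^ p) * m * h x"
proof -
  have sm: "summable (\<lambda>p. (real p + 1) ^ Suc k * q ^ p)" using q by (rule summable_linear_times_power)
  have "(\<Sum>u\<in>X. (real (length u) + 1) ^ k * q ^ length u * (\<Sum>n\<leftarrow>u. W n) * Lw u h x) \<le>
      (\<Sum>p. (real p + 1) ^ Suc k * q ^ p * (m * h x))"
  proof (rule finite_sum_words_le[OF _ _ _ X])
    show "0 \<le> (real (length u) + 1) ^ k * q ^ length u * (\<Sum>n\<leftarrow>u. W n) * Lw u h x" for u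
      using W q x by (intro mult_nonneg_nonneg sum_list_nonneg) auto
    show "summable (\<lambda>p. (real p + 1) ^ Suc k * q ^ p * (m * h x))" using sm by (rule summable_mult2)
    fix K p
    have "(\<Sum>u\<in>words K p. (real (length u) + 1) ^ k * q ^ length u * (\<Sum>n\<leftarrow>u. W n) * Lw u h x) =
        (real p + 1) ^ k * q ^ p * (\<Sum>u\<in>words K p. (\<Sum>n\<leftarrow>u. W n) * Lw u h x)"
      unfolding sum_distrib_left by (rule sum.cong) (auto simp: words_def)
    also have "\<dots> \<le> (real p + 1) ^ k * q ^ p * (real p * m * h x)"
      using q by (intro mult_left_mono sum_weighted_Lw_h_le W m x) auto
    also have "\<dots> \<le> (real p + 1) ^ k * q ^ p * ((real p + 1) * m * h x)"
      using q m(2) h_pos[OF x] by (intro mult_left_mono mult_right_mono) auto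
    finally show "(\<Sum>u\<in>words K p. (real (length u) + 1) ^ k * q ^ length u * (\<Sum>n\<leftarrow>u. W n) * Lw u h x) \<le>
        (real p + 1) ^ Suc k * q ^ p * (m * h x)" by (simp add: mult_ac)
  qed
  also have "\<dots> = (\<Sum>p. (real p + 1) ^ Suc k * q ^ p) * (m * h x)" using sm by (rule suminf_mult2[symmetric])
  finally show ?thesis by (simp add: mult.assoc)
qed

lemma powered_words_le:
  assumes x: "x \<in> Omega_star" and q: "0 \<le> q" "q < 1" and X: "finite X"
  shows "(\<Sum>u\<in>X. (real (length u) + 1) ^ k * q ^ length u * Lw u h x) \<le> (\<Sum>p. (real p + 1) ^ k * q ^ p) * h x"
proof -
  have sm: "summable (\<lambda>p. (real p + 1) ^ k * q ^ p)" using q by (rule summable_linear_times_power)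
  have "(\<Sum>u\<in>X. (real (length u) + 1) ^ k * q ^ length u * Lw u h x) \<le> (\<Sum>p. (real p + 1) ^ k * q ^ p * h x)"
  proof (rule finite_sum_words_le[OF _ _ _ X])
    show "0 \<le> (real (length u) + 1) ^ k * q ^ length u * Lw u h x" for u
      using q x by (intro mult_nonneg_nonneg) auto
    show "summable (\<lambda>p. (real p + 1) ^ k * q ^ p * h x)" using sm by (rule summable_mult2)
    fix K p
    have "(\<Sum>u\<in>words K p. (real (length u) + 1) ^ k * q ^ length u * Lw u h x) =
        (real p + 1) ^ k * q ^ p * (\<Sum>u\<in>words K p. Lw u h x)"
      unfolding sum_distrib_left by (rule sum.cong) (auto simp: words_def)
    also have "\<dots> \<le> (real p + 1) ^ k * q ^ p * h x"
      using q by (intro mult_left_mono sum_Lw_h_le x) auto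
    finally show "(\<Sum>u\<in>words K p. (real (length u) + 1) ^ k * q ^ length u * Lw u h x) \<le>
        (real p + 1) ^ k * q ^ p * h x" .
  qed
  also have "\<dots> = (\<Sum>p. (real p + 1) ^ k * q ^ p) * h x" using sm by (rule suminf_mult2[symmetric])
  finally show ?thesis .
qed

text \<open>The number p of letters and the exponent \<open>tot v\<close> are kept apart as two
  gradings; Newton's identities live in the grading by p, with z fixed.\<close>

definition word_sum :: "complex \<Rightarrow> (nat list \<Rightarrow> real) \<Rightarrow> nat \<Rightarrow> complex" where
  "word_sum z f p = infsum (\<lambda>v. complex_of_real (f v) * z ^ tot v) {v. length v = p}"

lemma norm_word_term_le:
  assumes z: "norm z \<le> 1" and f: "\<bar>f v\<bar> \<le> M * (real (length v) + 1) * Lw v h ones"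
  shows "norm (complex_of_real (f v) * z ^ tot v) \<le> M * ((real (length v) + 1) * norm z ^ length v * Lw v h ones)"
proof -
  have "norm (complex_of_real (f v) * z ^ tot v) = \<bar>f v\<bar> * norm z ^ tot v" by (simp add: norm_mult norm_power)
  also have "\<dots> \<le> (M * (real (length v) + 1) * Lw v h ones) * norm z ^ length v"
    using f z abs_ge_zero[of "f v"] by (intro mult_mono power_decreasing length_le_tot) (auto intro: order_trans)
  finally show ?thesis by (simp only: mult_ac)
qed

lemma disc_summable:
  assumes z: "norm z < 1" and f: "\<And>v. \<bar>f v\<bar> \<le> M * (real (length v) + 1) * Lw v h ones" and M: "0 \<le> M"
  shows "(\<lambda>v. norm (complex_of_real (f v) * z ^ tot v)) summable_on A"
    and "norm (word_sum z f p) \<le> M * h ones * ((real p + 1) ^ 1 * norm z ^ p)"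
proof -
  note le = norm_word_term_le[OF less_imp_le[OF z] f]
  show sm: "(\<lambda>v. norm (complex_of_real (f v) * z ^ tot v)) summable_on A" for A
  proof (rule abs_summable_on_if_finite_sums_le)
    fix X :: "nat list set" assume X: "finite X"
    have "(\<Sum>v\<in>X. norm (complex_of_real (f v) * z ^ tot v)) \<le> (\<Sum>v\<in>X. M * ((real (length v) + 1) * norm z ^ length v * Lw v h ones))"
      by (intro sum_mono le)
    also have "\<dots> = M * (\<Sum>v\<in>X. (real (length v) + 1) ^ 1 * norm z ^ length v * Lw v h ones)"
      by (simp add: sum_distrib_left)
    also have "\<dots> \<le> M * ((\<Sum>p. (real p + 1) ^ 1 * norm z ^ p) * h ones)"
      using z by (intro mult_left_mono powered_words_le X M) auto
    finally show "(\<Sum>v\<in>X. norm (complex_of_real (f v) * z ^ tot v)) \<le> M * ((\<Sum>p. (real p + 1) ^ 1 * norm z ^ p) * h ones)" .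
  qed
  have "norm (word_sum z f p) \<le> infsum (\<lambda>v. norm (complex_of_real (f v) * z ^ tot v)) {v. length v = p}"
    unfolding word_sum_def using sm by (rule Infinite_Sum.norm_infsum_bound)
  also have "\<dots> \<le> M * h ones * ((real p + 1) ^ 1 * norm z ^ p)"
  proof (rule infsum_le_finite_sums[OF sm])
    fix X assume X: "finite X" "X \<subseteq> {v :: nat list. length v = p}"
    have "(\<Sum>v\<in>X. norm (complex_of_real (f v) * z ^ tot v)) \<le> (\<Sum>v\<in>X. M * ((real (length v) + 1) * norm z ^ length v * Lw v h ones))"
      by (intro sum_mono le)
    also have "\<dots> = M * ((real p + 1) * norm z ^ p) * (\<Sum>v\<in>X. Lw v h ones)"
      unfolding sum_distrib_left using X by (intro sum.cong) (auto simp: mult.assoc)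
    also have "\<dots> \<le> M * ((real p + 1) * norm z ^ p) * h ones"
      using M by (intro mult_left_mono sum_fixed_length_le[OF X]) auto
    finally show "(\<Sum>v\<in>X. norm (complex_of_real (f v) * z ^ tot v)) \<le> M * h ones * ((real p + 1) ^ 1 * norm z ^ p)"
      by (simp add: mult_ac)
  qed
  finally show "norm (word_sum z f p) \<le> M * h ones * ((real p + 1) ^ 1 * norm z ^ p)" .
qed

lemma renewal_abs_le: "\<bar>renewal v\<bar> \<le> c / (hmin * r) * (real (length v) + 1) * Lw v h ones"
proof -
  have "r ^ length v \<le> 1" using r_bounds by (intro power_le_one) auto
  then have "c / (hmin * r) * r ^ length v * Lw v h ones \<le> c / (hmin * r) * (real (length v) + 1) * Lw v h ones"
    using c_bounds hmin_pos r_bounds by (intro mult_right_mono mult_left_mono) auto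
  then show ?thesis using renewal_bounds[of v] by simp
qed

lemma return_weight_abs_le: "\<bar>return_weight i v\<bar> \<le> c / hmin * (real (length v) + 1) * Lw v h ones"
proof -
  have "c / hmin * 1 * Lw v h ones \<le> c / hmin * (real (length v) + 1) * Lw v h ones"
    using c_bounds hmin_pos by (intro mult_right_mono mult_left_mono) auto
  then show ?thesis using return_weight_bounds[of i v] by simp
qed

definition "trace_const = (exp B + B * exp (2 * B)) / hmin"

lemma trace_const_nonneg: "0 \<le> trace_const"
  using B_pos hmin_pos by (simp add: trace_const_def)

lemma cyclic_weight_abs_le:
  "\<bar>cyclic_weight w\<bar> \<le> (exp B / hmin + trace_const) * (real (length w) + 1) * Lw w h ones"
proof (cases "w = []")
  case True
  then show ?thesis using B_pos hmin_pos trace_const_nonneg h_pos[of ones] by (simp add: cyclic_weight_def)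
next
  case False
  have "s ^ length w \<le> 1" using s_bounds by (intro power_le_one) auto
  then have "trace_const * (real (length w) + 1) * s ^ length w * Lw w h ones \<le> trace_const * (real (length w) + 1) * 1 * Lw w h ones"
    using trace_const_nonneg by (intro mult_right_mono mult_left_mono) auto
  moreover have "exp B / hmin * Lw w h ones \<le> exp B / hmin * (real (length w) + 1) * Lw w h ones"
    using hmin_pos by (simp add: distrib_left distrib_right)
  ultimately show ?thesis
    using trace_minus_cyclic_le[OF False] trace_weight_bounds[OF False] unfolding trace_const_def[symmetric]
    by (simp add: distrib_right abs_le_iff)
qed

lemma trace_weight_abs_le:
  "w \<noteq> [] \<Longrightarrow> \<bar>trace_weight w\<bar> \<le> exp B / hmin * (real (length w) + 1) * Lw w h ones"
proof -
  assume "w \<noteq> []"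
  moreover have "exp B / hmin * Lw w h ones \<le> exp B / hmin * (real (length w) + 1) * Lw w h ones"
    using hmin_pos by (simp add: distrib_left distrib_right)
  ultimately show ?thesis using trace_weight_bounds[of w] by simp
qed

lemma word_sum_concat:
  assumes "(\<lambda>v. norm (complex_of_real (f v) * z ^ tot v)) summable_on {v. length v = l}"
    "(\<lambda>v. norm (complex_of_real (g v) * z ^ tot v)) summable_on {v. length v = m}"
  shows "word_sum z (\<lambda>v. f (take l v) * g (drop l v)) (l + m) = word_sum z f l * word_sum z g m"
  unfolding word_sum_def infsum_concat[OF assms, symmetric]
proof (rule infsum_cong)
  fix v :: "nat list"
  have "tot v = tot (take l v) + tot (drop l v)" by (metis append_take_drop_id tot_simps(3))
  then show "complex_of_real (f (take l v) * g (drop l v)) * z ^ tot v =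
      complex_of_real (f (take l v)) * z ^ tot (take l v) * (complex_of_real (g (drop l v)) * z ^ tot (drop l v))"
    by (simp add: power_add)
qed

lemma bij_betw_rotate: "bij_betw (rotate j) {v :: nat list. length v = p} {v. length v = p}"
proof (rule bij_betwI[of _ _ _ "rotate (p - j mod p)"])
  fix v :: "nat list" assume v: "v \<in> {v. length v = p}"
  have *: "(p - j mod p + j) mod p = 0" if "p \<noteq> 0"
  proof -
    have "j mod p \<le> p" using that by (simp add: less_imp_le)
    then have "(p - j mod p + j mod p) mod p = 0" by simp
    then show ?thesis by (metis mod_add_right_eq)
  qed
  have "rotate (p - j mod p + j) v = v"
  proof (cases "v = []")
    case False
    then show ?thesis using * v by (intro rotate_id) auto
  qed simp
  then show "rotate (p - j mod p) (rotate j v) = v" "rotate j (rotate (p - j mod p) v) = v"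
    by (simp_all only: rotate_rotate add.commute[of j])
qed auto

lemma word_sum_rotate: "word_sum z (\<lambda>v. f (rotate j v)) p = word_sum z f p"
  unfolding word_sum_def
  using infsum_reindex_bij_betw[OF bij_betw_rotate, of "\<lambda>v. complex_of_real (f v) * z ^ tot v"] by simp

lemma word_sum_sum:
  assumes "finite I" "\<And>i. i \<in> I \<Longrightarrow> (\<lambda>v. complex_of_real (f i v) * z ^ tot v) summable_on {v. length v = p}"
  shows "word_sum z (\<lambda>v. \<Sum>i\<in>I. f i v) p = (\<Sum>i\<in>I. word_sum z (f i) p)"
    and "(\<lambda>v. complex_of_real (\<Sum>i\<in>I. f i v) * z ^ tot v) summable_on {v. length v = p}"
proof -
  have "((\<lambda>v. \<Sum>i\<in>I. complex_of_real (f i v) * z ^ tot v) has_sum (\<Sum>i\<in>I. word_sum z (f i) p)) {v. length v = p}"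
    using assms
  proof (induction I rule: finite_induct)
    case (insert i I)
    then show ?case by (simp add: word_sum_def has_sum_add)
  qed simp
  then have *: "((\<lambda>v. complex_of_real (\<Sum>i\<in>I. f i v) * z ^ tot v) has_sum (\<Sum>i\<in>I. word_sum z (f i) p)) {v. length v = p}"
    unfolding of_real_sum sum_distrib_right .
  show "word_sum z (\<lambda>v. \<Sum>i\<in>I. f i v) p = (\<Sum>i\<in>I. word_sum z (f i) p)"
    unfolding word_sum_def[of z "\<lambda>v. \<Sum>i\<in>I. f i v"] using * by (rule infsumI)
  show "(\<lambda>v. complex_of_real (\<Sum>i\<in>I. f i v) * z ^ tot v) summable_on {v. length v = p}"
    using * by (rule has_sum_imp_summable)
qed

lemma word_sum_cong:
  assumes "\<And>v. length v = p \<Longrightarrow> f v = g v"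
  shows "word_sum z f p = word_sum z g p"
  unfolding word_sum_def by (rule infsum_cong) (use assms in simp)

lemma word_sum_return_weight:
  assumes z: "norm z < 1" and i: "i < p"
  shows "word_sum z (return_weight i) p = word_sum z renewal p +
    (\<Sum>l\<in>{i<..<p}. word_sum z (return_weight i) l * word_sum z renewal (p - l))"
proof -
  have M: "0 \<le> c / (hmin * r)" "0 \<le> c / hmin" using c_bounds hmin_pos r_bounds by auto
  note smr = disc_summable(1)[OF z renewal_abs_le M(1)]
  have smb: "(\<lambda>v. norm (complex_of_real (return_weight i v) * z ^ tot v)) summable_on A" for A
    by (rule disc_summable(1)[OF z return_weight_abs_le M(2)])
  have rec: "word_sum z (\<lambda>v. return_weight i (take l v) * renewal (drop l v)) p =
      word_sum z (return_weight i) l * word_sum z renewal (p - l)" if "l \<in> {i<..<p}" for l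
    using word_sum_concat[OF smb smr, of l "p - l"] that by simp
  \<comment> \<open>Each product is one nonnegative summand of \<open>return_weight_rec\<close> and
    so dominated by \<open>return_weight i v\<close>.\<close>
  have smp: "(\<lambda>v. complex_of_real (return_weight i (take l v) * renewal (drop l v)) * z ^ tot v) summable_on {v. length v = p}"
    if l: "l \<in> {i<..<p}" for l
  proof (rule Infinite_Sum.abs_summable_summable, rule Infinite_Sum.abs_summable_on_comparison_test'[OF smb])
    fix v :: "nat list" assume v: "v \<in> {v. length v = p}"
    have nn: "0 \<le> return_weight i (take l v) * renewal (drop l v)"
      using return_weight_bounds(1) renewal_bounds(1) by (rule mult_nonneg_nonneg)
    have "return_weight i (take l v) * renewal (drop l v) \<le>
        (\<Sum>l\<in>{i<..<length v}. return_weight i (take l v) * renewal (drop l v))"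
      using l v by (intro member_le_sum mult_nonneg_nonneg return_weight_bounds(1) renewal_bounds(1)) auto
    also have "\<dots> \<le> return_weight i v"
      using return_weight_rec[of i v] v i renewal_bounds(1)[of v] by simp
    finally show "norm (complex_of_real (return_weight i (take l v) * renewal (drop l v)) * z ^ tot v) \<le>
        norm (complex_of_real (return_weight i v) * z ^ tot v)"
      using nn return_weight_bounds(1)[of i v] unfolding norm_mult[of _ "z ^ tot v"] norm_of_real
      by (intro mult_right_mono) auto
  qed
  let ?P = "\<lambda>l v. return_weight i (take l v) * renewal (drop l v)"
  have smS: "(\<lambda>v. complex_of_real (\<Sum>l\<in>{i<..<p}. ?P l v) * z ^ tot v) summable_on {v. length v = p}"
    by (rule word_sum_sum(2)) (use smp in auto)
  have "word_sum z (return_weight i) p = word_sum z (\<lambda>v. renewal v + (\<Sum>l\<in>{i<..<p}. ?P l v)) p"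
    by (rule word_sum_cong) (use i return_weight_rec in simp)
  also have "\<dots> = word_sum z renewal p + word_sum z (\<lambda>v. \<Sum>l\<in>{i<..<p}. ?P l v) p"
    unfolding word_sum_def
    using infsum_add[OF Infinite_Sum.abs_summable_summable[OF smr] smS] by (simp only: of_real_add distrib_right)
  also have "word_sum z (\<lambda>v. \<Sum>l\<in>{i<..<p}. ?P l v) p = (\<Sum>l\<in>{i<..<p}. word_sum z (?P l) p)"
    by (rule word_sum_sum(1)) (use smp in auto)
  finally show ?thesis using rec by simp
qed

text \<open>Rotation permutes the words of length p and preserves \<open>tot\<close>, so after
  summation the rotations in \<open>cyclic_weight\<close> disappear.\<close>

lemma word_sum_cyclic_weight:
  assumes z: "norm z < 1"
  shows "word_sum z cyclic_weight p = (\<Sum>i<p. word_sum z (return_weight i) p)"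
proof -
  have M: "0 \<le> c / hmin" using c_bounds hmin_pos by auto
  have smb: "(\<lambda>v. complex_of_real (return_weight i v) * z ^ tot v) summable_on A" for i A
    by (rule Infinite_Sum.abs_summable_summable[OF disc_summable(1)[OF z return_weight_abs_le M]])
  have smrot: "(\<lambda>v. complex_of_real (return_weight i (rotate j v)) * z ^ tot v) summable_on {v. length v = p}" for i j
  proof -
    note inj = bij_betw_imp_inj_on[OF bij_betw_rotate[of j p]]
    have "(\<lambda>v. complex_of_real (return_weight i v) * z ^ tot v) summable_on (rotate j ` {v. length v = p})" by (rule smb)
    then show ?thesis unfolding summable_on_reindex[OF inj] by (simp add: o_def)
  qed
  have "word_sum z cyclic_weight p = word_sum z (\<lambda>w. \<Sum>j<p. return_weight (p - Suc j) (rotate (Suc j) w)) p"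
    by (rule word_sum_cong) (simp add: cyclic_weight_def)
  also have "\<dots> = (\<Sum>j<p. word_sum z (\<lambda>w. return_weight (p - Suc j) (rotate (Suc j) w)) p)"
    by (rule word_sum_sum(1)[OF finite_lessThan smrot])
  also have "\<dots> = (\<Sum>j<p. word_sum z (return_weight (p - Suc j)) p)"
    by (simp only: word_sum_rotate)
  also have "\<dots> = (\<Sum>i<p. word_sum z (return_weight i) p)" by (rule sum.nat_diff_reindex)
  finally show ?thesis .
qed

text \<open>Newton's identities, with cyclic sums as power sums and renewal sums, up to sign, as
  elementary symmetric functions. Summing the last-return recursion over i and exchanging sums, the
  indices i < l collect into the cyclic sum of length l.\<close>

lemma word_sum_newton:
  assumes z: "norm z < 1"
  shows "word_sum z cyclic_weight (Suc n) = of_nat (Suc n) * word_sum z renewal (Suc n) +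
    (\<Sum>i<n. word_sum z cyclic_weight (Suc i) * word_sum z renewal (n - i))"
proof -
  let ?b = "\<lambda>i p. word_sum z (return_weight i) p" and ?a = "word_sum z renewal"
  have "word_sum z cyclic_weight (Suc n) =
      (\<Sum>i<Suc n. ?a (Suc n) + (\<Sum>l\<in>{i<..<Suc n}. ?b i l * ?a (Suc n - l)))"
    unfolding word_sum_cyclic_weight[OF z] by (intro sum.cong refl word_sum_return_weight z) simp
  also have "\<dots> = of_nat (Suc n) * ?a (Suc n) + (\<Sum>i<Suc n. \<Sum>l\<in>{i<..<Suc n}. ?b i l * ?a (Suc n - l))"
    by (simp only: sum.distrib sum_constant card_lessThan)
  also have "(\<Sum>i<Suc n. \<Sum>l\<in>{i<..<Suc n}. ?b i l * ?a (Suc n - l)) =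
      (\<Sum>i\<in>{..<Suc n}. \<Sum>l\<in>{l\<in>{..<Suc n}. i < l}. ?b i l * ?a (Suc n - l))"
    by (intro sum.cong refl) auto
  also have "\<dots> = (\<Sum>l\<in>{..<Suc n}. \<Sum>i\<in>{i\<in>{..<Suc n}. i < l}. ?b i l * ?a (Suc n - l))"
    by (rule sum.swap_restrict) auto
  also have "\<dots> = (\<Sum>l\<in>{..<Suc n}. word_sum z cyclic_weight l * ?a (Suc n - l))"
    unfolding word_sum_cyclic_weight[OF z] sum_distrib_right by (intro sum.cong refl) auto
  also have "\<dots> = word_sum z cyclic_weight 0 * ?a (Suc n - 0) + (\<Sum>i<n. word_sum z cyclic_weight (Suc i) * ?a (Suc n - Suc i))"
    by (rule sum.lessThan_Suc_shift)
  also have "word_sum z cyclic_weight 0 = 0" by (simp add: word_sum_cyclic_weight[OF z])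
  finally show ?thesis by simp
qed

section \<open>From traces to exponentials\<close>

definition "renewal_coeff = word_coeff renewal"

abbreviation "ren z \<equiv> psum (\<lambda>n. of_real (renewal_coeff n)) z"

definition "trace_coeff = word_coeff (\<lambda>w. trace_weight w / real (length w))"

text \<open>The division by the length is that of - log det (1 - M) = sum of tr M^p / p; formally
  these are the terms of - log det (1 - N_z).\<close>

definition "regular_term w = (trace_weight w - cyclic_weight w) / real (length w)"

definition "regular_coeff = word_coeff (\<lambda>w. complex_of_real (regular_term w))"

lemma word_coeff_of_real: "word_coeff (\<lambda>w. complex_of_real (f w)) n = complex_of_real (word_coeff f n)"
  by (simp add: word_coeff_def)

lemma exp_cyclic_sum:
  assumes z: "norm z < 1"
  shows "exp (infsum (\<lambda>w. complex_of_real (cyclic_weight w / real (length w)) * z ^ tot w) UNIV) *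
    (1 - ren z) = 1"
proof -
  \<comment> \<open>Any R > 1 with \<open>norm z * R < 1\<close> would serve: the variable counting
    letters needs room beyond 1 while z stays fixed.\<close>
  define R where "R = 2 / (1 + norm z)"
  have R: "R > 1" "norm z * R < 1" "0 \<le> norm z * R"
    using z by (auto simp: R_def field_simps add_pos_nonneg)
  have M: "0 \<le> c / (hmin * r)" "0 \<le> exp B / hmin + trace_const"
    using c_bounds hmin_pos r_bounds trace_const_nonneg by auto
  note smr = disc_summable[OF z renewal_abs_le M(1)]
  note smc = disc_summable[OF z cyclic_weight_abs_le M(2)]
  have sum_R: "summable (\<lambda>p. y p * of_real R ^ p)" if "\<And>p. norm (y p) \<le> K * ((real p + 1) ^ 1 * norm z ^ p)" for y :: "nat \<Rightarrow> complex" and K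
  proof (rule summable_comparison_test'[OF summable_mult[OF summable_linear_times_power[OF R(3,2), of 1]], of 0])
    fix p
    have "norm (y p * of_real R ^ p) = norm (y p) * R ^ p" using R by (simp add: norm_mult norm_power)
    also have "\<dots> \<le> K * ((real p + 1) ^ 1 * norm z ^ p) * R ^ p" using R that by (intro mult_right_mono) auto
    finally show "norm (y p * of_real R ^ p) \<le> K * ((real p + 1) ^ 1 * (norm z * R) ^ p)"
      by (simp add: power_mult_distrib mult_ac)
  qed
  have le_c: "\<bar>cyclic_weight w / real (length w)\<bar> \<le> (exp B / hmin + trace_const) * (real (length w) + 1) * Lw w h ones" for w
  proof -
    have "\<bar>cyclic_weight w / real (length w)\<bar> \<le> \<bar>cyclic_weight w\<bar>"
      by (cases "w = []") (auto simp: abs_divide divide_le_eq mult_le_cancel_left1 Suc_le_eq)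
    then show ?thesis using cyclic_weight_abs_le[of w] by linarith
  qed
  note smd = disc_summable[OF z le_c M(2)]
  have div: "infsum (\<lambda>w. complex_of_real (cyclic_weight w / real (length w)) * z ^ tot w) {w. length w = p} =
      word_sum z cyclic_weight p / of_nat p" for p
  proof -
    have "infsum (\<lambda>w. complex_of_real (cyclic_weight w / real (length w)) * z ^ tot w) {w. length w = p} =
        infsum (\<lambda>w. inverse (of_nat p) * (complex_of_real (cyclic_weight w) * z ^ tot w)) {w. length w = p}"
      by (rule infsum_cong) (simp add: field_simps)
    also have "\<dots> = inverse (of_nat p) * word_sum z cyclic_weight p"
      unfolding word_sum_def by (rule infsum_cmult_right')
    finally show ?thesis by (simp add: field_simps)
  qed
  have nd: "norm (word_sum z cyclic_weight p / of_nat p) \<le> (exp B / hmin + trace_const) * h ones * ((real p + 1) ^ 1 * norm z ^ p)" for p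
    using smd(2)[of p] unfolding word_sum_def div .
  have r0: "word_sum z renewal 0 = 0" by (simp add: word_sum_def renewal_def)
  have "exp (\<Sum>p. word_sum z cyclic_weight p / of_nat p) * (1 - (\<Sum>p. word_sum z renewal p)) = 1"
    by (rule exp_newton_sums[OF R(1) r0 sum_R[OF smr(2)] sum_R[OF nd] word_sum_newton[OF z]])
  moreover have "(\<Sum>p. word_sum z cyclic_weight p / of_nat p) =
      infsum (\<lambda>w. complex_of_real (cyclic_weight w / real (length w)) * z ^ tot w) UNIV"
    using has_sum_fibres[OF Infinite_Sum.abs_summable_summable[OF smd(1)], of length] unfolding div by (simp only: sums_iff)
  moreover have "(\<Sum>p. word_sum z renewal p) = infsum (\<lambda>w. complex_of_real (renewal w) * z ^ tot w) UNIV"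
    using has_sum_fibres[OF Infinite_Sum.abs_summable_summable[OF smr(1)], of length] unfolding word_sum_def by (simp only: sums_iff)
  moreover have "ren z = infsum (\<lambda>w. complex_of_real (renewal w) * z ^ tot w) UNIV"
    using word_coeff_sums[OF smr(1)] unfolding psum_def renewal_coeff_def word_coeff_of_real by (simp only: sums_iff)
  ultimately show ?thesis by simp
qed

text \<open>In the open disc trace and cyclic sums converge separately, so their exponentials can be
  divided; what is left on the right is controlled up to the circle.\<close>

lemma exp_trace_sum:
  assumes z: "norm z < 1"
  shows "(\<lambda>n. complex_of_real (trace_coeff n) * z ^ n) sums psum (\<lambda>n. of_real (trace_coeff n)) z"
    and "exp (psum (\<lambda>n. of_real (trace_coeff n)) z) * (1 - ren z) = exp (psum regular_coeff z)"
proof -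
  have M: "0 \<le> exp B / hmin + trace_const" "0 \<le> exp B / hmin" using hmin_pos trace_const_nonneg by auto
  have quot: "\<bar>f w / real (length w)\<bar> \<le> K * (real (length w) + 1) * Lw w h ones"
    if "w \<noteq> [] \<Longrightarrow> \<bar>f w\<bar> \<le> K * (real (length w) + 1) * Lw w h ones" "0 \<le> K" for f w K
  proof (cases "w = []")
    case True
    then show ?thesis using that(2) h_pos[of ones] by simp
  next
    case False
    then have "\<bar>f w / real (length w)\<bar> \<le> \<bar>f w\<bar>"
      by (auto simp: abs_divide divide_le_eq mult_le_cancel_left1 Suc_le_eq)
    then show ?thesis using that(1)[OF False] by linarith
  qed
  have le_t: "\<bar>trace_weight w / real (length w)\<bar> \<le> exp B / hmin * (real (length w) + 1) * Lw w h ones" for w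
    by (rule quot[OF _ M(2)]) (rule trace_weight_abs_le)
  have le_c: "\<bar>cyclic_weight w / real (length w)\<bar> \<le> (exp B / hmin + trace_const) * (real (length w) + 1) * Lw w h ones" for w
    by (rule quot[OF _ M(1)]) (rule cyclic_weight_abs_le)
  note smt = disc_summable(1)[OF z le_t M(2)]
  note smc = disc_summable(1)[OF z le_c M(1)]
  let ?t = "\<lambda>w. complex_of_real (trace_weight w / real (length w)) * z ^ tot w"
  let ?c = "\<lambda>w. complex_of_real (cyclic_weight w / real (length w)) * z ^ tot w"
  let ?g = "\<lambda>w. complex_of_real (regular_term w) * z ^ tot w"
  have g: "?g w = ?t w - ?c w" for w
    by (simp add: regular_term_def diff_divide_distrib left_diff_distrib)
  have smg: "(\<lambda>w. norm (?g w)) summable_on UNIV"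
  proof (rule Infinite_Sum.abs_summable_on_comparison_test'[OF summable_on_add[OF smt smc]])
    show "norm (?g w) \<le> norm (?t w) + norm (?c w)" for w unfolding g by (rule norm_triangle_ineq4)
  qed
  have t: "(\<lambda>n. complex_of_real (trace_coeff n) * z ^ n) sums infsum ?t UNIV"
    using word_coeff_sums[OF smt] unfolding trace_coeff_def word_coeff_of_real .
  then show "(\<lambda>n. complex_of_real (trace_coeff n) * z ^ n) sums psum (\<lambda>n. of_real (trace_coeff n)) z"
    unfolding psum_def by (simp add: sums_iff)
  have pt: "psum (\<lambda>n. of_real (trace_coeff n)) z = infsum ?t UNIV"
    using t unfolding psum_def by (simp add: sums_iff)
  have pg: "psum regular_coeff z = infsum ?g UNIV"
    using word_coeff_sums[OF smg] unfolding psum_def regular_coeff_def by (simp add: sums_iff)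
  have "infsum (\<lambda>w. ?g w + ?c w) UNIV = infsum ?g UNIV + infsum ?c UNIV"
    by (rule infsum_add) (use Infinite_Sum.abs_summable_summable[OF smg] Infinite_Sum.abs_summable_summable[OF smc] in auto)
  then have "psum (\<lambda>n. of_real (trace_coeff n)) z = psum regular_coeff z + infsum ?c UNIV"
    unfolding pt pg g by simp
  then show "exp (psum (\<lambda>n. of_real (trace_coeff n)) z) * (1 - ren z) = exp (psum regular_coeff z)"
    using exp_cyclic_sum[OF z] by (simp add: exp_add mult.assoc)
qed

text \<open>Dividing by the length absorbs the linear number of telescoping steps, as (p + 1) / p
  \<le> 2.\<close>

lemma regular_term_abs_le: "\<bar>regular_term w\<bar> \<le> 2 * trace_const * s ^ length w * Lw w h ones"
proof (cases "w = []")
  case True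
  then show ?thesis using trace_const_nonneg h_pos[of ones] by (simp add: regular_term_def)
next
  case False
  then have l: "1 \<le> real (length w)" by (cases w) auto
  have "\<bar>regular_term w\<bar> = \<bar>trace_weight w - cyclic_weight w\<bar> / real (length w)"
    by (simp add: regular_term_def abs_divide)
  also have "\<dots> \<le> trace_const * (real (length w) + 1) * s ^ length w * Lw w h ones / real (length w)"
    using trace_minus_cyclic_le[OF False] l unfolding trace_const_def by (intro divide_right_mono) auto
  also have "\<dots> \<le> trace_const * (2 * real (length w)) * s ^ length w * Lw w h ones / real (length w)"
    using l trace_const_nonneg s_bounds by (intro divide_right_mono mult_right_mono mult_left_mono) auto
  also have "\<dots> = 2 * trace_const * s ^ length w * Lw w h ones" using False by simp
  finally show ?thesis .
qed

text \<open>The decay \<open>s ^ length w\<close> does not depend on z, so these coefficients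
  inherit the moments of single letters; the hypothesis on W lets letters control words up to a
  power of the length.\<close>

lemma weighted_regular_le:
  assumes W: "\<And>n. 0 \<le> W n" "\<And>u. u \<noteq> [] \<Longrightarrow> W (tot u) \<le> (real (length u) + 1) ^ k * (\<Sum>n\<leftarrow>u. W (Suc n))"
    and m: "\<And>K x. x \<in> Omega_star \<Longrightarrow> (\<Sum>n<K. W (Suc n) * Lop n h x) \<le> m * h x" "0 \<le> m"
  shows "(\<Sum>n<N. W n * norm (regular_coeff n)) \<le> 2 * trace_const * (\<Sum>p. (real p + 1) ^ Suc k * s ^ p) * h ones * m"
  unfolding regular_coeff_def
proof (rule sum_word_coeff_le[OF _ W(1)])
  fix X :: "nat list set" assume X: "finite X"
  have "W (tot w) * norm (complex_of_real (regular_term w)) \<le>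
      2 * trace_const * ((real (length w) + 1) ^ k * s ^ length w * (\<Sum>n\<leftarrow>w. W (Suc n)) * Lw w h ones)" for w
  proof (cases "w = []")
    case True
    then show ?thesis by (simp add: regular_term_def)
  next
    case False
    have "W (tot w) * norm (complex_of_real (regular_term w)) \<le>
        ((real (length w) + 1) ^ k * (\<Sum>n\<leftarrow>w. W (Suc n))) * (2 * trace_const * s ^ length w * Lw w h ones)"
      using regular_term_abs_le[of w] W(1) by (intro mult_mono W(2)[OF False]) (auto intro!: mult_nonneg_nonneg sum_list_nonneg)
    then show ?thesis by (simp only: mult_ac)
  qed
  then have "(\<Sum>w\<in>X. W (tot w) * norm (complex_of_real (regular_term w))) \<le>
      2 * trace_const * (\<Sum>w\<in>X. (real (length w) + 1) ^ k * s ^ length w * (\<Sum>n\<leftarrow>w. W (Suc n)) * Lw w h ones)"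
    unfolding sum_distrib_left by (rule sum_mono)
  also have "\<dots> \<le> 2 * trace_const * ((\<Sum>p. (real p + 1) ^ Suc k * s ^ p) * m * h ones)"
    using trace_const_nonneg W(1) s_bounds by (intro mult_left_mono weighted_words_le m X) auto
  finally show "(\<Sum>w\<in>X. W (tot w) * norm (complex_of_real (regular_term w))) \<le>
      2 * trace_const * (\<Sum>p. (real p + 1) ^ Suc k * s ^ p) * h ones * m"
    by (simp only: mult_ac)
qed

end

section \<open>Periodic points and the zeta function\<close>

text \<open>The orbit closes after n steps, so starting one step later trades one summand for an
  equal one.\<close>

lemma sum_orbit_shift:
  fixes F :: "point \<Rightarrow> real"
  assumes "(shift ^^ n) \<omega> = \<omega>"
  shows "(\<Sum>k<n. F ((shift ^^ k) ((shift ^^ j) \<omega>))) = (\<Sum>k<n. F ((shift ^^ k) \<omega>))"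
proof (induction j)
  case (Suc j)
  let ?x = "(shift ^^ j) \<omega>"
  have fix_x: "(shift ^^ n) ?x = ?x"
    using assms by (metis add.commute funpow_add o_apply)
  have "F ?x + (\<Sum>k<n. F ((shift ^^ k) ((shift ^^ Suc j) \<omega>))) = (\<Sum>k<Suc n. F ((shift ^^ k) ?x))"
    unfolding sum.lessThan_Suc_shift by (simp add: funpow_swap1)
  also have "\<dots> = (\<Sum>k<n. F ((shift ^^ k) ?x)) + F ?x" by (simp add: fix_x)
  finally show ?case using Suc by simp
qed simp

lemma bij_betw_shift_periodic:
  assumes "i < n"
  shows "bij_betw (shift ^^ Suc i) {\<omega>. (shift ^^ n) \<omega> = \<omega> \<and> \<omega> i} {\<omega>. (shift ^^ n) \<omega> = \<omega> \<and> \<omega> (n - 1)}"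
proof (rule bij_betwI[of _ _ _ "shift ^^ (n - Suc i)"])
  have comm: "(shift ^^ n) ((shift ^^ j) \<omega>) = (shift ^^ j) ((shift ^^ n) \<omega>)" for j \<omega>
    by (metis add.commute funpow_add o_apply)
  have full: "(shift ^^ (n - Suc i)) ((shift ^^ Suc i) \<omega>) = (shift ^^ n) \<omega>"
    "(shift ^^ Suc i) ((shift ^^ (n - Suc i)) \<omega>) = (shift ^^ n) \<omega>" for \<omega>
    unfolding shift_pow using assms by (simp_all del: funpow.simps)
  have nth: "\<omega> (n + j) = \<omega> j" if "(shift ^^ n) \<omega> = \<omega>" for \<omega> j
    using fun_cong[OF that, of j] by (simp add: shift_pow)
  show "shift ^^ Suc i \<in> {\<omega>. (shift ^^ n) \<omega> = \<omega> \<and> \<omega> i} \<rightarrow> {\<omega>. (shift ^^ n) \<omega> = \<omega> \<and> \<omega> (n - 1)}"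
  proof
    fix \<omega> assume \<omega>: "\<omega> \<in> {\<omega>. (shift ^^ n) \<omega> = \<omega> \<and> \<omega> i}"
    have "(shift ^^ Suc i) \<omega> (n - 1) = \<omega> (Suc i + (n - 1))" by (simp only: shift_pow)
    also have "Suc i + (n - 1) = n + i" using assms by simp
    finally show "(shift ^^ Suc i) \<omega> \<in> {\<omega>. (shift ^^ n) \<omega> = \<omega> \<and> \<omega> (n - 1)}"
      using \<omega> nth[of \<omega> i] comm[of "Suc i" \<omega>] by (simp del: funpow.simps)
  qed
  show "shift ^^ (n - Suc i) \<in> {\<omega>. (shift ^^ n) \<omega> = \<omega> \<and> \<omega> (n - 1)} \<rightarrow> {\<omega>. (shift ^^ n) \<omega> = \<omega> \<and> \<omega> i}"
  proof
    fix \<omega> assume \<omega>: "\<omega> \<in> {\<omega>. (shift ^^ n) \<omega> = \<omega> \<and> \<omega> (n - 1)}"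
    have "(shift ^^ (n - Suc i)) \<omega> i = \<omega> (n - Suc i + i)" by (simp only: shift_pow)
    also have "n - Suc i + i = n - 1" using assms by simp
    finally show "(shift ^^ (n - Suc i)) \<omega> \<in> {\<omega>. (shift ^^ n) \<omega> = \<omega> \<and> \<omega> i}"
      using \<omega> comm[of "n - Suc i" \<omega>] by simp
  qed
  show "(shift ^^ (n - Suc i)) ((shift ^^ Suc i) \<omega>) = \<omega>" if "\<omega> \<in> {\<omega>. (shift ^^ n) \<omega> = \<omega> \<and> \<omega> i}" for \<omega>
    using that unfolding full by simp
  show "(shift ^^ Suc i) ((shift ^^ (n - Suc i)) \<omega>) = \<omega>" if "\<omega> \<in> {\<omega>. (shift ^^ n) \<omega> = \<omega> \<and> \<omega> (n - 1)}" for \<omega>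
    using that unfolding full by simp
qed

text \<open>
  Each nonzero point of period n is counted once for every 1 among its first n symbols, and
  shifting moves that 1 to position n - 1, where the point is coded by a word.
\<close>

lemma sum_periodic_points:
  fixes F :: "point \<Rightarrow> real"
  assumes n: "n \<ge> 1"
  shows "(\<Sum>\<omega>\<in>{\<omega>. (shift ^^ n) \<omega> = \<omega>}. exp (\<Sum>k<n. F ((shift ^^ k) \<omega>))) =
    exp (real n * F zero_point) +
    real n * (\<Sum>w\<in>{w. tot w = n}. exp (\<Sum>k<n. F ((shift ^^ k) (periodic_point w))) / real (length w))"
proof -
  define Per where "Per = {\<omega>. (shift ^^ n) \<omega> = \<omega>}"
  define \<Phi> where "\<Phi> \<omega> = exp (\<Sum>k<n. F ((shift ^^ k) \<omega>))" for \<omega>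
  \<comment> \<open>The number of ones in the period, written as an orbit sum so that its shift
    invariance is an instance of \<open>sum_orbit_shift\<close>.\<close>
  define ct where "ct \<omega> = (\<Sum>k<n. of_bool (((shift ^^ k) \<omega>) 0) :: real)" for \<omega>
  have ct: "ct \<omega> = real (card {i. i < n \<and> \<omega> i})" for \<omega>
    by (simp add: ct_def shift_pow sum.If_cases of_bool_def Int_def conj_commute)
  have inv: "\<Phi> ((shift ^^ j) \<omega>) = \<Phi> \<omega>" "ct ((shift ^^ j) \<omega>) = ct \<omega>" if "\<omega> \<in> Per" for j \<omega>
    unfolding \<Phi>_def ct_def using that
    by (simp_all only: Per_def mem_Collect_eq sum_orbit_shift[of n \<omega> F j] sum_orbit_shift[of n \<omega> "\<lambda>y. of_bool (y 0)" j])
  have bij0: "bij_betw periodic_point {w. tot w = n} {\<omega> \<in> Per. \<omega> (n - 1)}"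
    using bij_betw_periodic_point[OF n] by (simp add: Per_def)
  have bij: "bij_betw (shift ^^ Suc i) {\<omega> \<in> Per. \<omega> i} {\<omega> \<in> Per. \<omega> (n - 1)}" if "i < n" for i
    using bij_betw_shift_periodic[OF that] by (simp add: Per_def)
  have fin_i: "finite {\<omega> \<in> Per. \<omega> i}" if "i < n" for i
    using bij_betw_finite[OF bij[OF that]] bij_betw_finite[OF bij0] by simp
  have zero: "zero_point \<in> Per" by (simp add: Per_def shift_pow zero_point_def)
  have nz: "\<exists>i<n. \<omega> i" if "\<omega> \<in> Per" "\<omega> \<noteq> zero_point" for \<omega>
  proof (rule ccontr)
    assume *: "\<not> (\<exists>i<n. \<omega> i)"
    have "\<not> \<omega> j" for j
    proof (induction j rule: less_induct)
      case (less j)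
      show ?case
      proof (cases "j < n")
        case False
        have "(shift ^^ n) \<omega> (j - n) = \<omega> (j - n)" using that(1) by (simp add: Per_def)
        then have "\<omega> j = \<omega> (j - n)" using False by (simp add: shift_pow)
        then show ?thesis using less[of "j - n"] False n by simp
      qed (use * in simp)
    qed
    with that(2) show False by (auto simp: zero_point_def)
  qed
  have Per_eq: "Per = insert zero_point (\<Union>i<n. {\<omega> \<in> Per. \<omega> i})" using zero nz by auto
  have fin: "finite Per" by (subst Per_eq) (use fin_i in auto)
  have "(\<Sum>\<omega>\<in>Per - {zero_point}. \<Phi> \<omega>) = (\<Sum>\<omega>\<in>Per - {zero_point}. \<Sum>i<n. of_bool (\<omega> i) * (\<Phi> \<omega> / ct \<omega>))"
  proof (rule sum.cong)
    fix \<omega> assume \<omega>: "\<omega> \<in> Per - {zero_point}"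
    then have "{i. i < n \<and> \<omega> i} \<noteq> {}" using nz by auto
    then have "ct \<omega> \<noteq> 0" unfolding ct by simp
    have e: "(\<Sum>i<n. of_bool (\<omega> i)) = ct \<omega>" by (simp add: ct_def shift_pow)
    have "(\<Sum>i<n. of_bool (\<omega> i) * (\<Phi> \<omega> / ct \<omega>)) = (\<Sum>i<n. of_bool (\<omega> i)) * (\<Phi> \<omega> / ct \<omega>)"
      by (rule sum_distrib_right[symmetric])
    also have "\<dots> = \<Phi> \<omega>" unfolding e using \<open>ct \<omega> \<noteq> 0\<close> by simp
    finally show "\<Phi> \<omega> = (\<Sum>i<n. of_bool (\<omega> i) * (\<Phi> \<omega> / ct \<omega>))" by (rule sym)
  qed simp
  also have "\<dots> = (\<Sum>i<n. \<Sum>\<omega>\<in>Per - {zero_point}. of_bool (\<omega> i) * (\<Phi> \<omega> / ct \<omega>))" by (rule sum.swap)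
  also have "\<dots> = (\<Sum>i<n. \<Sum>\<omega>\<in>{\<omega> \<in> Per. \<omega> (n - 1)}. \<Phi> \<omega> / ct \<omega>)"
  proof (rule sum.cong)
    fix i assume i: "i \<in> {..<n}"
    have "(\<Sum>\<omega>\<in>Per - {zero_point}. of_bool (\<omega> i) * (\<Phi> \<omega> / ct \<omega>)) = (\<Sum>\<omega>\<in>{\<omega> \<in> Per. \<omega> i}. \<Phi> \<omega> / ct \<omega>)"
      by (rule sum.mono_neutral_cong_right) (use fin in \<open>auto simp: zero_point_def\<close>)
    also have "\<dots> = (\<Sum>\<omega>\<in>{\<omega> \<in> Per. \<omega> i}. \<Phi> ((shift ^^ Suc i) \<omega>) / ct ((shift ^^ Suc i) \<omega>))"
      by (rule sum.cong) (use inv in \<open>auto simp del: funpow.simps\<close>)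
    also have "\<dots> = (\<Sum>\<omega>\<in>{\<omega> \<in> Per. \<omega> (n - 1)}. \<Phi> \<omega> / ct \<omega>)"
      by (rule sum.reindex_bij_betw[OF bij]) (use i in simp)
    finally show "(\<Sum>\<omega>\<in>Per - {zero_point}. of_bool (\<omega> i) * (\<Phi> \<omega> / ct \<omega>)) = (\<Sum>\<omega>\<in>{\<omega> \<in> Per. \<omega> (n - 1)}. \<Phi> \<omega> / ct \<omega>)" .
  qed simp
  also have "\<dots> = real n * (\<Sum>\<omega>\<in>{\<omega> \<in> Per. \<omega> (n - 1)}. \<Phi> \<omega> / ct \<omega>)" by simp
  also have "(\<Sum>\<omega>\<in>{\<omega> \<in> Per. \<omega> (n - 1)}. \<Phi> \<omega> / ct \<omega>) = (\<Sum>w\<in>{w. tot w = n}. \<Phi> (periodic_point w) / ct (periodic_point w))"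
    by (rule sum.reindex_bij_betw[OF bij0, symmetric])
  also have "\<dots> = (\<Sum>w\<in>{w. tot w = n}. \<Phi> (periodic_point w) / real (length w))"
  proof (rule sum.cong)
    fix w assume w: "w \<in> {w. tot w = n}"
    then have "w \<noteq> []" using n by auto
    then have "{i. i < n \<and> periodic_point w i} = {i. i < tot w \<and> prepend w (periodic_point w) i}" using w by simp
    then have "ct (periodic_point w) = real (length w)" unfolding ct by (simp only: card_ones_prepend)
    then show "\<Phi> (periodic_point w) / ct (periodic_point w) = \<Phi> (periodic_point w) / real (length w)" by simp
  qed simp
  finally have "(\<Sum>\<omega>\<in>Per - {zero_point}. \<Phi> \<omega>) = real n * (\<Sum>w\<in>{w. tot w = n}. \<Phi> (periodic_point w) / real (length w))" .
  moreover have "(\<Sum>\<omega>\<in>Per. \<Phi> \<omega>) = \<Phi> zero_point + (\<Sum>\<omega>\<in>Per - {zero_point}. \<Phi> \<omega>)"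
    using fin zero by (rule sum.remove)
  moreover have "\<Phi> zero_point = exp (real n * F zero_point)"
    by (simp add: \<Phi>_def shift_pow) (simp add: zero_point_def)
  ultimately show ?thesis by (simp add: Per_def \<Phi>_def)
qed

context cone_system
begin

lemma periodic_sum_eq:
  assumes "n \<ge> 1" "V zero_point = 0"
  shows "periodic_sum (\<lambda>\<omega>. exp (V \<omega>)) n = 1 + real n * trace_coeff n"
proof -
  have "exp (\<Sum>k<n. V ((shift ^^ k) (periodic_point w))) = trace_weight w" if "tot w = n" for w
  proof -
    have "w \<noteq> []" using that assms(1) by auto
    then show ?thesis unfolding trace_weight_def by (subst Lw_eq) (simp add: that)
  qed
  then show ?thesis
    using sum_periodic_points[OF assms(1), of V] assms(2)
    by (simp add: periodic_sum_def exp_sum trace_coeff_def word_coeff_def)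
qed

text \<open>The contribution 1 of \<open>zero_point\<close> to each periodic sum produces the series
  of - Ln (1 - z), hence the factor 1 - z; the remainder is the trace series.\<close>

lemma zeta_eq:
  assumes V0: "V zero_point = 0" and z: "norm z < 1"
  shows "summable (\<lambda>n. zeta_term (\<lambda>\<omega>. exp (V \<omega>)) z (Suc n))"
    and "dyn_zeta (\<lambda>\<omega>. exp (V \<omega>)) z * (1 - z) * (1 - ren z) = exp (psum regular_coeff z)"
proof -
  let ?p = "psum (\<lambda>n. of_real (trace_coeff n)) z"
  have z1: "1 - z \<noteq> 0" using z by auto
  have "(\<lambda>n. - (z ^ n) / of_nat n) sums Ln (1 - z)" using Ln_series'[of "- z"] z by simp
  from sums_minus[OF this] have "(\<lambda>n. z ^ n / of_nat n) sums - Ln (1 - z)" by simp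
  then have S: "(\<lambda>n. z ^ n / of_nat n + of_real (trace_coeff n) * z ^ n) sums (- Ln (1 - z) + ?p)"
    by (rule sums_add[OF _ exp_trace_sum(1)[OF z]])
  have t0: "trace_coeff 0 = 0" by (simp add: trace_coeff_def word_coeff_def)
  have zt: "z ^ Suc n / of_nat (Suc n) + of_real (trace_coeff (Suc n)) * z ^ Suc n = zeta_term (\<lambda>\<omega>. exp (V \<omega>)) z (Suc n)" for n
  proof -
    have "zeta_term (\<lambda>\<omega>. exp (V \<omega>)) z (Suc n) = z ^ Suc n / of_nat (Suc n) * of_real (1 + real (Suc n) * trace_coeff (Suc n))"
      unfolding zeta_term_def using periodic_sum_eq[of "Suc n", OF _ V0] by simp
    also have "\<dots> = z ^ Suc n / of_nat (Suc n) + of_real (trace_coeff (Suc n)) * z ^ Suc n"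
      by (simp add: distrib_left del: of_nat_Suc power_Suc)
    finally show ?thesis by simp
  qed
  have "(\<lambda>n. z ^ Suc n / of_nat (Suc n) + of_real (trace_coeff (Suc n)) * z ^ Suc n) sums (- Ln (1 - z) + ?p)"
    using S t0 by (subst sums_Suc_iff) simp
  then have "(\<lambda>n. zeta_term (\<lambda>\<omega>. exp (V \<omega>)) z (Suc n)) sums (- Ln (1 - z) + ?p)"
    unfolding zt .
  note zs = this
  then show "summable (\<lambda>n. zeta_term (\<lambda>\<omega>. exp (V \<omega>)) z (Suc n))" by (rule sums_summable)
  have "dyn_zeta (\<lambda>\<omega>. exp (V \<omega>)) z = exp (- Ln (1 - z) + ?p)"
    unfolding dyn_zeta_def using zs by (simp only: sums_iff)
  also have "\<dots> = exp ?p / (1 - z)" using z1 by (simp only: exp_add exp_minus exp_Ln) (simp add: field_simps)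
  finally have "dyn_zeta (\<lambda>\<omega>. exp (V \<omega>)) z * (1 - z) = exp ?p" using z1 by simp
  then show "dyn_zeta (\<lambda>\<omega>. exp (V \<omega>)) z * (1 - z) * (1 - ren z) = exp (psum regular_coeff z)"
    using exp_trace_sum(2)[OF z] by (simp only:)
qed

section \<open>The generating function of the regular part\<close>

text \<open>The resolvent (1 - N_z)^(-1) applied to the constant 1, expanded over words.\<close>

definition gen :: "complex \<Rightarrow> point \<Rightarrow> complex" where
  "gen z x = infsum (\<lambda>u. complex_of_real (Nw u (\<lambda>_. 1) x) * z ^ tot u) UNIV"

definition gen1 :: "point \<Rightarrow> real" where
  "gen1 x = infsum (\<lambda>u. Nw u (\<lambda>_. 1) x) UNIV"

lemma Nw_one_nonneg: "x \<in> Omega_star \<Longrightarrow> 0 \<le> Nw u (\<lambda>_. 1) x"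
  using coneD(1)[OF cone_Lw_one(2)] by blast

definition "gen_const = (\<Sum>p. (real p + 1) ^ 0 * r ^ p) / hmin"

lemma sum_Nw_one_le:
  assumes "x \<in> Omega_star" "finite X"
  shows "(\<Sum>u\<in>X. Nw u (\<lambda>_. 1) x) \<le> gen_const * h x"
proof -
  have "(\<Sum>u\<in>X. Nw u (\<lambda>_. 1) x) \<le> (\<Sum>u\<in>X. (real (length u) + 1) ^ 0 * r ^ length u * Lw u h x / hmin)"
    by (intro sum_mono) (use Nw_one_le[OF assms(1)] in simp)
  also have "\<dots> = (\<Sum>u\<in>X. (real (length u) + 1) ^ 0 * r ^ length u * Lw u h x) / hmin"
    by (rule sum_divide_distrib[symmetric])
  also have "\<dots> \<le> (\<Sum>p. (real p + 1) ^ 0 * r ^ p) * h x / hmin"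
    using r_bounds hmin_pos by (intro divide_right_mono powered_words_le assms) auto
  finally show ?thesis by (simp add: gen_const_def)
qed

lemma summable_Nw_one:
  assumes "x \<in> Omega_star"
  shows "(\<lambda>u. Nw u (\<lambda>_. 1) x) summable_on A"
proof -
  have "(\<lambda>u. norm (Nw u (\<lambda>_. 1) x)) summable_on A"
    by (rule abs_summable_on_if_finite_sums_le[of _ "gen_const * h x"])
      (use sum_Nw_one_le[OF assms] Nw_one_nonneg[OF assms] in simp)
  then show ?thesis by (rule Infinite_Sum.abs_summable_summable)
qed

lemma norm_gen_term_le:
  assumes "x \<in> Omega_star" "norm z \<le> 1"
  shows "norm (complex_of_real (Nw u (\<lambda>_. 1) x) * z ^ tot u) \<le> Nw u (\<lambda>_. 1) x"
  using norm_mult_power_le[OF assms(2), of "complex_of_real (Nw u (\<lambda>_. 1) x)" "tot u"] Nw_one_nonneg[OF assms(1), of u] by simp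

lemma gen_has_sum:
  assumes "x \<in> Omega_star" "norm z \<le> 1"
  shows "((\<lambda>u. complex_of_real (Nw u (\<lambda>_. 1) x) * z ^ tot u) has_sum gen z x) UNIV"
proof -
  have "(\<lambda>u. norm (complex_of_real (Nw u (\<lambda>_. 1) x) * z ^ tot u)) summable_on UNIV"
    by (rule Infinite_Sum.abs_summable_on_comparison_test'[OF summable_Nw_one[OF assms(1)]])
      (rule norm_gen_term_le[OF assms])
  from has_sum_infsum[OF Infinite_Sum.abs_summable_summable[OF this]] show ?thesis unfolding gen_def .
qed

lemma gen1_has_sum: "x \<in> Omega_star \<Longrightarrow> ((\<lambda>u. Nw u (\<lambda>_. 1) x) has_sum gen1 x) UNIV"
  unfolding gen1_def by (rule has_sum_infsum[OF summable_Nw_one])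

lemma norm_gen_le:
  assumes "x \<in> Omega_star" "norm z \<le> 1"
  shows "norm (gen z x) \<le> gen1 x"
  by (rule norm_infsum_le[OF gen_has_sum[OF assms] gen1_has_sum[OF assms(1)]])
    (rule norm_gen_term_le[OF assms])

lemma gen1_le: "x \<in> Omega_star \<Longrightarrow> gen1 x \<le> gen_const * h x"
  unfolding gen1_def by (intro infsum_le_finite_sums summable_Nw_one sum_Nw_one_le)

lemma gen_one: "x \<in> Omega_star \<Longrightarrow> gen 1 x = of_real (gen1 x)"
proof -
  assume x: "x \<in> Omega_star"
  have "((\<lambda>u. complex_of_real (Nw u (\<lambda>_. 1) x)) has_sum of_real (gen1 x)) UNIV"
    using gen1_has_sum[OF x] by (rule has_sum_of_real)
  then show ?thesis unfolding gen_def by (simp add: infsumI)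
qed

text \<open>Wanted because invariance of the measure is given on \<open>F_theta \<theta>\<close>
  only. Both bounds are summed over words, the Lipschitz one by means of
  \<open>cone_lipschitz\<close> with reference point \<open>ones\<close>.\<close>

lemma gen_in_F_theta:
  assumes z: "norm z \<le> 1"
  shows "gen z \<in> F_theta \<theta>"
  unfolding F_theta_def
proof (intro CollectI conjI)
  have gc: "0 \<le> gen_const"
    unfolding gen_const_def using hmin_pos r_bounds summable_linear_times_power[of r 0]
    by (intro divide_nonneg_pos suminf_nonneg) auto
  show "\<exists>Bd. \<forall>x\<in>Omega_star. norm (gen z x) \<le> Bd"
  proof (intro exI ballI)
    fix x assume x: "x \<in> Omega_star"
    have "norm (gen z x) \<le> gen_const * h x" using norm_gen_le[OF x z] gen1_le[OF x] by linarith
    also have "\<dots> \<le> gen_const * hmax" using gc hmax[OF x] by (rule mult_left_mono[rotated])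
    finally show "norm (gen z x) \<le> gen_const * hmax" .
  qed
  show "\<exists>L. \<forall>x\<in>Omega_star. \<forall>y\<in>Omega_star. norm (gen z x - gen z y) \<le> L * d_theta \<theta> x y"
  proof (intro exI ballI)
    fix x y assume x: "x \<in> Omega_star" and y: "y \<in> Omega_star"
    let ?L = "B * exp (2 * B) * d_theta \<theta> x y"
    have 1: "((\<lambda>u. complex_of_real (Nw u (\<lambda>_. 1) x) * z ^ tot u - complex_of_real (Nw u (\<lambda>_. 1) y) * z ^ tot u) has_sum (gen z x - gen z y)) UNIV"
      using has_sum_add[OF gen_has_sum[OF x z] has_sum_uminusI[OF gen_has_sum[OF y z]]] by simp
    have 2: "((\<lambda>u. ?L * Nw u (\<lambda>_. 1) ones) has_sum (?L * gen1 ones)) UNIV"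
      by (rule has_sum_cmult_right) (rule gen1_has_sum, simp)
    have "norm (gen z x - gen z y) \<le> ?L * gen1 ones"
    proof (rule norm_infsum_le[OF 1 2])
      fix u
      have "norm (complex_of_real (Nw u (\<lambda>_. 1) x) * z ^ tot u - complex_of_real (Nw u (\<lambda>_. 1) y) * z ^ tot u) =
          norm (complex_of_real (Nw u (\<lambda>_. 1) x - Nw u (\<lambda>_. 1) y) * z ^ tot u)" by (simp add: left_diff_distrib)
      also have "\<dots> \<le> norm (complex_of_real (Nw u (\<lambda>_. 1) x - Nw u (\<lambda>_. 1) y))" by (rule norm_mult_power_le[OF z])
      also have "\<dots> = \<bar>Nw u (\<lambda>_. 1) x - Nw u (\<lambda>_. 1) y\<bar>" by (rule norm_of_real)
      also have "\<dots> \<le> ?L * Nw u (\<lambda>_. 1) ones"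
        by (rule cone_lipschitz[OF cone_Lw_one(2) x y]) auto
      finally show "norm (complex_of_real (Nw u (\<lambda>_. 1) x) * z ^ tot u - complex_of_real (Nw u (\<lambda>_. 1) y) * z ^ tot u) \<le> ?L * Nw u (\<lambda>_. 1) ones" .
    qed
    then show "norm (gen z x - gen z y) \<le> B * exp (2 * B) * gen1 ones * d_theta \<theta> x y" by (simp add: mult_ac)
  qed
qed

text \<open>In absolute value 1 - z^(tot u) is at most the sum of the 1 - z^(n + 1) over the letters
  n of u, an additive weight to which \<open>weighted_words_le\<close> applies.\<close>

lemma gen_diff_le:
  assumes x: "x \<in> Omega_star" and z: "norm z \<le> 1"
    and m: "\<And>K x. x \<in> Omega_star \<Longrightarrow> (\<Sum>n<K. norm (1 - z ^ Suc n) * Lop n h x) \<le> m * h x" "0 \<le> m"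
  shows "norm (gen 1 x - gen z x) \<le> (\<Sum>p. (real p + 1) ^ Suc 0 * r ^ p) * m * h x / hmin"
proof -
  have le: "norm (1 - z ^ tot u) \<le> (\<Sum>n\<leftarrow>u. norm (1 - z ^ Suc n))" for u
  proof (induction u)
    case (Cons n u)
    have "1 - z ^ tot (n # u) = (1 - z ^ Suc n) + z ^ Suc n * (1 - z ^ tot u)"
      by (simp add: power_add algebra_simps)
    then have "norm (1 - z ^ tot (n # u)) \<le> norm (1 - z ^ Suc n) + norm (z ^ Suc n * (1 - z ^ tot u))"
      by (metis norm_triangle_ineq)
    also have "norm (z ^ Suc n * (1 - z ^ tot u)) \<le> norm (1 - z ^ tot u)"
      using norm_mult_power_le[OF z, of "1 - z ^ tot u" "Suc n"] by (simp only: mult.commute)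
    finally show ?case using Cons by simp
  qed simp
  have 1: "((\<lambda>u. complex_of_real (Nw u (\<lambda>_. 1) x) * (1 - z ^ tot u)) has_sum (gen 1 x - gen z x)) UNIV"
    using has_sum_add[OF gen_has_sum[OF x, of 1] has_sum_uminusI[OF gen_has_sum[OF x z]]] by (simp add: right_diff_distrib)
  have sm: "(\<lambda>u. norm (complex_of_real (Nw u (\<lambda>_. 1) x) * (1 - z ^ tot u))) summable_on UNIV"
  proof (rule Infinite_Sum.abs_summable_on_comparison_test')
    show "(\<lambda>u. 2 * Nw u (\<lambda>_. 1) x) summable_on UNIV" by (intro summable_on_cmult_right summable_Nw_one x)
    fix u
    show "norm (complex_of_real (Nw u (\<lambda>_. 1) x) * (1 - z ^ tot u)) \<le> 2 * Nw u (\<lambda>_. 1) x"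
      using mult_right_mono[OF norm_one_minus_power_le(3)[OF z, of "tot u"] Nw_one_nonneg[OF x, of u]] Nw_one_nonneg[OF x, of u]
      by (simp add: norm_mult mult.commute)
  qed
  have "norm (gen 1 x - gen z x) \<le> infsum (\<lambda>u. norm (complex_of_real (Nw u (\<lambda>_. 1) x) * (1 - z ^ tot u))) UNIV"
    using Infinite_Sum.norm_infsum_bound[OF sm] infsumI[OF 1] by simp
  also have "\<dots> \<le> (\<Sum>p. (real p + 1) ^ Suc 0 * r ^ p) * m * h x / hmin"
  proof (rule infsum_le_finite_sums[OF sm])
    fix X :: "nat list set" assume X: "finite X"
    have "(\<Sum>u\<in>X. norm (complex_of_real (Nw u (\<lambda>_. 1) x) * (1 - z ^ tot u))) \<le>
        (\<Sum>u\<in>X. (real (length u) + 1) ^ 0 * r ^ length u * (\<Sum>n\<leftarrow>u. norm (1 - z ^ Suc n)) * Lw u h x / hmin)"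
    proof (rule sum_mono)
      fix u
      have "norm (complex_of_real (Nw u (\<lambda>_. 1) x) * (1 - z ^ tot u)) = Nw u (\<lambda>_. 1) x * norm (1 - z ^ tot u)"
        using Nw_one_nonneg[OF x, of u] by (simp add: norm_mult)
      also have "\<dots> \<le> (r ^ length u * Lw u h x / hmin) * (\<Sum>n\<leftarrow>u. norm (1 - z ^ Suc n))"
        using r_bounds hmin_pos x by (intro mult_mono Nw_one_le le) auto
      finally show "norm (complex_of_real (Nw u (\<lambda>_. 1) x) * (1 - z ^ tot u)) \<le>
          (real (length u) + 1) ^ 0 * r ^ length u * (\<Sum>n\<leftarrow>u. norm (1 - z ^ Suc n)) * Lw u h x / hmin"
        by (simp add: mult_ac)
    qed
    also have "\<dots> = (\<Sum>u\<in>X. (real (length u) + 1) ^ 0 * r ^ length u * (\<Sum>n\<leftarrow>u. norm (1 - z ^ Suc n)) * Lw u h x) / hmin"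
      by (rule sum_divide_distrib[symmetric])
    also have "\<dots> \<le> (\<Sum>p. (real p + 1) ^ Suc 0 * r ^ p) * m * h x / hmin"
      using r_bounds hmin_pos by (intro divide_right_mono weighted_words_le m x X) auto
    finally show "(\<Sum>u\<in>X. norm (complex_of_real (Nw u (\<lambda>_. 1) x) * (1 - z ^ tot u))) \<le>
        (\<Sum>p. (real p + 1) ^ Suc 0 * r ^ p) * m * h x / hmin" .
  qed
  finally show ?thesis .
qed

lemma Nw_snoc: "Nw (u @ [n]) (\<lambda>_. 1) x + renewal (u @ [n]) = Lop n (Nw u (\<lambda>_. 1)) x"
  by (simp add: Nop_def renewal_def)

lemma renewal_finite_sums_le: "finite X \<Longrightarrow> (\<Sum>u\<in>X. norm (renewal u)) \<le> c / r * gen_const * h ones"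
proof -
  assume X: "finite X"
  have "(\<Sum>u\<in>X. norm (renewal u)) \<le> (\<Sum>u\<in>X. c / (hmin * r) * ((real (length u) + 1) ^ 0 * r ^ length u * Lw u h ones))"
    by (intro sum_mono) (use renewal_bounds in \<open>simp add: mult.assoc\<close>)
  also have "\<dots> = c / (hmin * r) * (\<Sum>u\<in>X. (real (length u) + 1) ^ 0 * r ^ length u * Lw u h ones)"
    by (rule sum_distrib_left[symmetric])
  also have "\<dots> \<le> c / (hmin * r) * ((\<Sum>p. (real p + 1) ^ 0 * r ^ p) * h ones)"
    using c_bounds r_bounds hmin_pos by (intro mult_left_mono powered_words_le X) auto
  finally show ?thesis by (simp add: gen_const_def mult_ac)
qed

lemma renewal_abs_summable:
  assumes "norm z \<le> 1"
  shows "(\<lambda>u. norm (complex_of_real (renewal u) * z ^ tot u)) summable_on A"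
proof (rule abs_summable_on_if_finite_sums_le)
  fix X :: "nat list set" assume X: "finite X"
  have "(\<Sum>u\<in>X. norm (complex_of_real (renewal u) * z ^ tot u)) \<le> (\<Sum>u\<in>X. norm (renewal u))"
    by (intro sum_mono order_trans[OF norm_mult_power_le[OF assms]]) simp
  then show "(\<Sum>u\<in>X. norm (complex_of_real (renewal u) * z ^ tot u)) \<le> c / r * gen_const * h ones"
    using renewal_finite_sums_le[OF X] by linarith
qed

lemma psum_renewal_coeff:
  assumes "norm z \<le> 1"
  shows "((\<lambda>u. complex_of_real (renewal u) * z ^ tot u) has_sum ren z) UNIV"
proof -
  have "ren z = infsum (\<lambda>u. complex_of_real (renewal u) * z ^ tot u) UNIV"
    using word_coeff_sums[OF renewal_abs_summable[OF assms]]
    unfolding psum_def renewal_coeff_def word_coeff_of_real by (simp only: sums_iff)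
  then show ?thesis using has_sum_infsum[OF Infinite_Sum.abs_summable_summable[OF renewal_abs_summable[OF assms]]] by simp
qed

text \<open>The resolvent equation M_z gen = gen - 1 + a(z). Adding a last letter through
  \<open>Nw_snoc\<close> yields all nonempty words of gen, and the rank-one remainders sum to the
  renewal series.\<close>

lemma gen_equation:
  assumes x: "x \<in> Omega_star" and z: "norm z \<le> 1"
  shows "(\<lambda>n. complex_of_real (\<psi> n x) * (z ^ Suc n * gen z (cons n x))) sums
    (gen z x - 1 + ren z)"
proof -
  let ?H = "\<lambda>u. complex_of_real (Nw u (\<lambda>_. 1) x) * z ^ tot u - of_bool (u = []) + complex_of_real (renewal u) * z ^ tot u"
  have one: "((\<lambda>u :: nat list. - of_bool (u = []) :: complex) has_sum - 1) UNIV"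
    by (rule has_sum_finite_neutralI[of "{[]}"]) auto
  have H: "(?H has_sum (gen z x - 1 + ren z)) UNIV"
    using has_sum_add[OF has_sum_add[OF gen_has_sum[OF x z] one] psum_renewal_coeff[OF z]] by simp
  have H0: "?H [] = 0" by (simp add: renewal_def)
  \<comment> \<open>The empty word has no last letter; it is put into the fibre of 0, where its term
    vanishes by \<open>H0\<close>.\<close>
  define q where "q u = (if u = [] then 0 else last u :: nat)" for u
  have "infsum ?H {u. q u = n} = complex_of_real (\<psi> n x) * (z ^ Suc n * gen z (cons n x))" for n
  proof -
    have "infsum ?H {u. q u = n} = infsum ?H (range (\<lambda>u. u @ [n]))"
    proof (rule infsum_cong_neutral)
      fix u assume "u \<in> {u. q u = n} - range (\<lambda>u. u @ [n])"
      then have "u = []" by (cases u rule: rev_cases) (auto simp: q_def)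
      then show "?H u = 0" using H0 by simp
    qed (auto simp: q_def)
    also have "\<dots> = infsum (?H \<circ> (\<lambda>u. u @ [n])) UNIV" by (rule infsum_reindex) (simp add: inj_on_def)
    also have "\<dots> = infsum (\<lambda>u. (complex_of_real (\<psi> n x) * z ^ Suc n) * (complex_of_real (Nw u (\<lambda>_. 1) (cons n x)) * z ^ tot u)) UNIV"
    proof (rule infsum_cong)
      fix u
      have "(?H \<circ> (\<lambda>u. u @ [n])) u = complex_of_real (Nw (u @ [n]) (\<lambda>_. 1) x + renewal (u @ [n])) * z ^ tot (u @ [n])"
        by (simp add: distrib_right del: Nw_simps)
      also have "\<dots> = (complex_of_real (\<psi> n x) * z ^ Suc n) * (complex_of_real (Nw u (\<lambda>_. 1) (cons n x)) * z ^ tot u)"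
        unfolding Nw_snoc by (simp add: Lop_def power_add)
      finally show "(?H \<circ> (\<lambda>u. u @ [n])) u = (complex_of_real (\<psi> n x) * z ^ Suc n) * (complex_of_real (Nw u (\<lambda>_. 1) (cons n x)) * z ^ tot u)" .
    qed
    also have "\<dots> = (complex_of_real (\<psi> n x) * z ^ Suc n) * gen z (cons n x)"
      unfolding gen_def by (rule infsum_cmult_right')
    finally show ?thesis by (simp add: mult.assoc)
  qed
  then show ?thesis using has_sum_fibres[OF has_sum_imp_summable[OF H], of q] infsumI[OF H] by simp
qed

lemma Lw_h_has_sum:
  assumes "x \<in> Omega_star"
  shows "((\<lambda>u. Lw u h x) has_sum h x) {u. length u = p}"
  using assms
proof (induction p arbitrary: x)
  case (Suc p)
  have bij: "bij_betw (\<lambda>(n, u). u @ [n]) (UNIV \<times> {u :: nat list. length u = p}) {u. length u = Suc p}"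
  proof (rule bij_betwI[of _ _ _ "\<lambda>u. (last u, butlast u)"])
    show "(\<lambda>u. (last u, butlast u)) \<in> {u. length u = Suc p} \<rightarrow> UNIV \<times> {u :: nat list. length u = p}" by auto
    show "(case (last u, butlast u) of (n, u) \<Rightarrow> u @ [n]) = u" if "u \<in> {u. length u = Suc p}" for u :: "nat list"
      using that by (cases u rule: rev_cases) auto
  qed auto
  have inner: "((\<lambda>u. Lw (case (n, u) of (n, u) \<Rightarrow> u @ [n]) h x) has_sum Lop n h x) {u. length u = p}" for n
    using has_sum_cmult_right[OF Suc.IH[of "cons n x"], of "\<psi> n x"] Suc.prems by (simp add: Lop_def)
  have outer: "((\<lambda>n. Lop n h x) has_sum h x) UNIV"
    using h_sums[OF Suc.prems] Lop_h_pos[OF Suc.prems] by (intro sums_nonneg_imp_has_sum) (auto simp: less_imp_le)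
  have "(\<lambda>y. Lw (case y of (n, u) \<Rightarrow> u @ [n]) h x) summable_on (UNIV \<times> {u. length u = p})"
  proof (rule summable_on_SigmaI[OF inner has_sum_imp_summable[OF outer]])
    show "0 \<le> Lw (case (n, u) of (n, u) \<Rightarrow> u @ [n]) h x" for n u
      using Lw_h_nonneg[OF Suc.prems, of "u @ [n]"] by (simp del: Lw_simps)
  qed
  from has_sum_SigmaI[OF inner outer this]
  have "((\<lambda>y. Lw (case y of (n, u) \<Rightarrow> u @ [n]) h x) has_sum h x) (UNIV \<times> {u. length u = p})" by simp
  then show ?case using has_sum_reindex_bij_betw[OF bij, of "\<lambda>u. Lw u h x" "h x"] by simp
next
  case 0
  then show ?case using has_sum_finite[of "{[]}" "\<lambda>u. Lw u h x"] by simp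
qed

text \<open>Sum \<open>Lw_split\<close> for h over all words of length p. The left side gives h, the
  functional always takes the value h ones by invariance, and the fully reduced part is at most
  \<open>r ^ p * h\<close>. In the limit h is a multiple of (1 - N_1)^(-1) 1.\<close>

lemma h_eq_gen1:
  assumes x: "x \<in> Omega_star"
  shows "h x = c * h ones * gen1 x"
proof -
  define G where "G i = infsum (\<lambda>u. Nw u (\<lambda>_. 1) x) {u. length u = i}" for i
  have nN: "(\<lambda>u. norm (Nw u (\<lambda>_. 1) x)) summable_on A" for A
    using summable_Nw_one[OF x, of A] Nw_one_nonneg[OF x] by simp
  have nL: "(\<lambda>u. norm (Lw u h ones)) summable_on {u. length u = p}" for p
    using Lw_h_has_sum[of ones p] by (simp add: has_sum_imp_summable)
  have step: "0 \<le> h x - (\<Sum>j<p. c * h ones * G (p - Suc j)) \<and> h x - (\<Sum>j<p. c * h ones * G (p - Suc j)) \<le> r ^ p * h x" for p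
  proof -
    let ?t = "\<lambda>j u. c * Lw (take (Suc j) u) h ones * Nw (drop (Suc j) u) (\<lambda>_. 1) x"
    have t0: "0 \<le> ?t j u" for j u
      using c_bounds Nw_one_nonneg[OF x] by (intro mult_nonneg_nonneg) auto
    have N0: "0 \<le> Nw u h x" for u using coneD(1)[OF cone_Nw[OF cone_h] x x] .
    have eq: "Lw u h x = Nw u h x + (\<Sum>j<p. ?t j u)" if "length u = p" for u
      using Lw_split[of u h x] that by simp
    have t_sum: "(?t j has_sum (c * h ones * G (p - Suc j))) {u. length u = p}" if j: "j < p" for j
    proof -
      have "infsum (\<lambda>u. Lw (take (Suc j) u) h ones * Nw (drop (Suc j) u) (\<lambda>_. 1) x) {u. length u = Suc j + (p - Suc j)} = h ones * G (p - Suc j)"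
        unfolding infsum_concat[OF nL nN] G_def using infsumI[OF Lw_h_has_sum[of ones "Suc j"]] by simp
      then have i: "infsum (\<lambda>u. Lw (take (Suc j) u) h ones * Nw (drop (Suc j) u) (\<lambda>_. 1) x) {u. length u = p} = h ones * G (p - Suc j)"
        using j by simp
      have "(\<lambda>u. norm (?t j u)) summable_on {u. length u = p}"
      proof (rule Infinite_Sum.abs_summable_on_comparison_test'[OF has_sum_imp_summable[OF Lw_h_has_sum[OF x]]])
        fix u :: "nat list" assume u: "u \<in> {u. length u = p}"
        have "?t j u \<le> (\<Sum>j<p. ?t j u)" by (rule member_le_sum) (use j t0 in auto)
        then show "norm (?t j u) \<le> Lw u h x" using eq[of u] u N0[of u] t0[of j u] by simp
      qed
      then have "?t j summable_on {u. length u = p}" by (rule Infinite_Sum.abs_summable_summable)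
      then have "(?t j has_sum infsum (?t j) {u. length u = p}) {u. length u = p}" by (rule has_sum_infsum)
      moreover have "infsum (?t j) {u. length u = p} = c * (h ones * G (p - Suc j))"
        unfolding mult.assoc infsum_cmult_right' i ..
      ultimately show ?thesis by (simp add: mult.assoc)
    qed
    have S: "((\<lambda>u. \<Sum>j\<in>J. ?t j u) has_sum (\<Sum>j\<in>J. c * h ones * G (p - Suc j))) {u. length u = p}" if "finite J" "J \<subseteq> {..<p}" for J
      using that by (induction J rule: finite_induct) (auto intro!: has_sum_add t_sum)
    have "((\<lambda>u. Lw u h x + - (\<Sum>j<p. ?t j u)) has_sum (h x + - (\<Sum>j<p. c * h ones * G (p - Suc j)))) {u. length u = p}"
      by (intro has_sum_add has_sum_uminusI Lw_h_has_sum x S) auto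
    then have N: "((\<lambda>u. Nw u h x) has_sum (h x - (\<Sum>j<p. c * h ones * G (p - Suc j)))) {u. length u = p}"
      by (subst (asm) has_sum_cong[where g = "\<lambda>u. Nw u h x"]) (use eq in auto)
    have "h x - (\<Sum>j<p. c * h ones * G (p - Suc j)) \<le> r ^ p * h x"
    proof (rule has_sum_mono[OF N has_sum_cmult_right[OF Lw_h_has_sum[OF x, of p], of "r ^ p"]])
      show "Nw u h x \<le> r ^ p * Lw u h x" if "u \<in> {u. length u = p}" for u
        using Nw_le[OF cone_h x, of u] that by simp
    qed
    moreover have "0 \<le> h x - (\<Sum>j<p. c * h ones * G (p - Suc j))"
      by (rule has_sum_nonneg[OF N]) (rule N0)
    ultimately show ?thesis by simp
  qed
  have "G sums gen1 x"
    unfolding G_def gen1_def by (rule has_sum_fibres[OF summable_Nw_one[OF x]])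
  then have "(\<lambda>p. \<Sum>j<p. G j) \<longlonglongrightarrow> gen1 x" by (simp add: sums_def)
  then have l1: "(\<lambda>p. h x - c * h ones * (\<Sum>j<p. G j)) \<longlonglongrightarrow> h x - c * h ones * gen1 x"
    by (intro tendsto_intros)
  have eqG: "(\<Sum>j<p. c * h ones * G (p - Suc j)) = c * h ones * (\<Sum>j<p. G j)" for p
    unfolding sum_distrib_left by (rule sum.nat_diff_reindex)
  have st: "0 \<le> h x - c * h ones * (\<Sum>j<p. G j)" "h x - c * h ones * (\<Sum>j<p. G j) \<le> r ^ p * h x" for p
    using step[of p] unfolding eqG by blast+
  have "(\<lambda>p. r ^ p * h x) \<longlonglongrightarrow> 0 * h x" using r_bounds by (intro tendsto_intros LIMSEQ_power_zero) auto
  then have "(\<lambda>p. r ^ p * h x) \<longlonglongrightarrow> 0" by simp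
  with tendsto_const have "(\<lambda>p. h x - c * h ones * (\<Sum>j<p. G j)) \<longlonglongrightarrow> 0"
    by (rule tendsto_sandwich[rotated 2]) (simp_all only: st eventually_True simp_thms)
  from LIMSEQ_unique[OF l1 this] show ?thesis by simp
qed

end

section \<open>The conformal measure\<close>

lemma prepend_eqI:
  assumes "\<And>i. i < tot u \<Longrightarrow> y i = prepend u x i"
  shows "y = prepend u ((shift ^^ tot u) y)"
proof
  fix i
  show "y i = prepend u ((shift ^^ tot u) y) i"
  proof (cases "i < tot u")
    case True
    then show ?thesis using assms prepend_nth_indep[of i u x] by simp
  next
    case False
    then have i: "i = tot u + (i - tot u)" by simp
    show ?thesis by (subst (2) i, subst prepend_nth_shift) (use i in \<open>simp add: shift_pow\<close>)
  qed
qed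

lemma open_cylinder: "open {y :: point. \<forall>i<K. y i = x i}"
proof -
  have "open ((\<lambda>y :: point. y i) -` {x i})" for i
    by (rule open_vimage) (auto intro: open_discrete continuous_on_product_coordinates)
  then have "open (\<Inter>i<K. (\<lambda>y :: point. y i) -` {x i})" by (intro open_INT) auto
  also have "(\<Inter>i<K. (\<lambda>y :: point. y i) -` {x i}) = {y. \<forall>i<K. y i = x i}" by auto
  finally show ?thesis .
qed

text \<open>Points that agree on the binary symbols of the first N blocks share N passage times, and
  such cylinders are open in the product topology.\<close>

lemma continuous_on_F_theta:
  assumes f: "f \<in> F_theta \<theta>" and \<theta>: "0 < \<theta>" "\<theta> < 1"
  shows "continuous_on Omega_star f"
  unfolding continuous_on_topological
proof (intro ballI allI impI)
  fix x S assume x: "x \<in> Omega_star" and S: "open S" "f x \<in> S"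
  obtain \<epsilon> where \<epsilon>: "\<epsilon> > 0" "ball (f x) \<epsilon> \<subseteq> S" using S by (auto simp: open_contains_ball)
  obtain L where L: "\<And>y. y \<in> Omega_star \<Longrightarrow> norm (f x - f y) \<le> L * d_theta \<theta> x y"
    using f x unfolding F_theta_def by blast
  have "(\<lambda>N. \<bar>L\<bar> * \<theta> ^ N) \<longlonglongrightarrow> \<bar>L\<bar> * 0" using \<theta> by (intro tendsto_intros LIMSEQ_power_zero) auto
  then have "\<forall>\<^sub>F N in sequentially. \<bar>L\<bar> * \<theta> ^ N < \<epsilon>" by (rule order_tendstoD) (use \<epsilon> in simp)
  then obtain N where N: "\<bar>L\<bar> * \<theta> ^ N < \<epsilon>" by (auto simp: eventually_sequentially)
  obtain u x' where u: "length u = N" "x = prepend u x'" "x' \<in> Omega_star"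
    using passage_times_prefix[OF x] by blast
  show "\<exists>A. open A \<and> x \<in> A \<and> (\<forall>y\<in>Omega_star. y \<in> A \<longrightarrow> f y \<in> S)"
  proof (intro exI conjI ballI impI)
    show "open {y :: point. \<forall>i<tot u. y i = x i}" by (rule open_cylinder)
    show "x \<in> {y. \<forall>i<tot u. y i = x i}" by simp
    fix y assume y: "y \<in> Omega_star" "y \<in> {y. \<forall>i<tot u. y i = x i}"
    define y' where "y' = (shift ^^ tot u) y"
    have yy: "y = prepend u y'" unfolding y'_def using y u(2) by (intro prepend_eqI) auto
    have "d_theta \<theta> x y = \<theta> ^ N * d_theta \<theta> x' y'" using u yy by simp
    also have "\<dots> \<le> \<theta> ^ N" using d_theta_bounds[OF \<theta>] \<theta> by (intro mult_left_le) auto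
    finally have "L * d_theta \<theta> x y \<le> \<bar>L\<bar> * \<theta> ^ N"
      using d_theta_bounds[OF \<theta>, of x y] by (intro mult_mono) auto
    then have "norm (f x - f y) < \<epsilon>" using L[OF y(1)] N by linarith
    then show "f y \<in> S" using \<epsilon>(2) by (auto simp: dist_norm)
  qed
qed

text \<open>Different first letters mean distance 1, so a bounded function of the first letter is
  Lipschitz no matter how it varies.\<close>

lemma F_theta_first_one_mult:
  assumes f: "f \<in> F_theta \<theta>" and g: "\<And>n. norm (g n :: complex) \<le> M" and \<theta>: "0 < \<theta>" "\<theta> < 1"
  shows "(\<lambda>x. g (first_one x) * f x) \<in> F_theta \<theta>"
proof -
  obtain K L where K: "\<And>x. x \<in> Omega_star \<Longrightarrow> norm (f x) \<le> K"
    and L: "\<And>x y. x \<in> Omega_star \<Longrightarrow> y \<in> Omega_star \<Longrightarrow> norm (f x - f y) \<le> L * d_theta \<theta> x y"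
    using f unfolding F_theta_def by blast
  have M: "0 \<le> M" using g[of 0] norm_ge_zero[of "g 0"] by linarith
  have gf: "norm (g (first_one x) * f x) \<le> M * K" if "x \<in> Omega_star" for x
    unfolding norm_mult using g K[OF that] M by (intro mult_mono) auto
  have K0: "0 \<le> K" using K[of ones] norm_ge_zero[of "f ones"] by (simp add: order_trans[OF norm_ge_zero])
  show ?thesis unfolding F_theta_def
  proof (intro CollectI conjI exI ballI)
    show "norm (g (first_one x) * f x) \<le> M * K" if "x \<in> Omega_star" for x using that by (rule gf)
    fix x y assume x: "x \<in> Omega_star" and y: "y \<in> Omega_star"
    obtain n x' where n: "x = cons n x'" using x by (rule star_cases)
    obtain m y' where m: "y = cons m y'" using y by (rule star_cases)
    have d: "0 \<le> d_theta \<theta> x y" using d_theta_bounds[OF \<theta>] by simp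
    show "norm (g (first_one x) * f x - g (first_one y) * f y) \<le> (M * \<bar>L\<bar> + 2 * (M * K)) * d_theta \<theta> x y"
    proof (cases "n = m")
      case True
      have "norm (g (first_one x) * f x - g (first_one y) * f y) = norm (g n) * norm (f x - f y)"
        by (simp add: n m True norm_mult[symmetric] right_diff_distrib)
      also have "\<dots> \<le> M * (\<bar>L\<bar> * d_theta \<theta> x y)"
      proof (intro mult_mono g)
        have "L * d_theta \<theta> x y \<le> \<bar>L\<bar> * d_theta \<theta> x y" using d by (intro mult_right_mono) auto
        then show "norm (f x - f y) \<le> \<bar>L\<bar> * d_theta \<theta> x y" using L[OF x y] by linarith
      qed (use M in auto)
      also have "\<dots> \<le> (M * \<bar>L\<bar> + 2 * (M * K)) * d_theta \<theta> x y"
        using M K0 d by (simp add: distrib_right)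
      finally show ?thesis .
    next
      case False
      then have d1: "d_theta \<theta> x y = 1" unfolding n m by (rule d_theta_cons_neq)
      have "norm (g (first_one x) * f x - g (first_one y) * f y) \<le> M * K + M * K"
        using gf[OF x] gf[OF y] norm_triangle_ineq4[of "g (first_one x) * f x" "g (first_one y) * f y"] by linarith
      moreover have "0 \<le> M * \<bar>L\<bar>" using M by simp
      ultimately show ?thesis unfolding d1 mult_1_right by linarith
    qed
  qed
qed

locale measure_system = cone_system +
  fixes \<nu> :: "point measure"
  assumes nu_prob: "prob_space \<nu>"
    and nu_sets: "sets \<nu> = sets (restrict_space borel Omega_star)"
    and nu_eigen: "\<And>f. f \<in> F_theta \<theta> \<Longrightarrow>
                     (\<integral>\<omega>. induced_operator V f \<omega> \<partial>\<nu>) = (\<integral>\<omega>. f \<omega> \<partial>\<nu>)"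
    and h_norm: "(\<integral>\<omega>. h \<omega> \<partial>\<nu>) = 1"
begin

sublocale prob_space \<nu> by (rule nu_prob)

lemma space_nu: "space \<nu> = Omega_star"
  using sets_eq_imp_space_eq[OF nu_sets] by (simp add: space_restrict_space)

lemma F_theta_measurable: "f \<in> F_theta \<theta> \<Longrightarrow> f \<in> borel_measurable \<nu>"
  using borel_measurable_continuous_on_restrict[OF continuous_on_F_theta[OF _ theta]]
  by (simp add: measurable_cong_sets[OF nu_sets refl])

lemma F_theta_integrable: "f \<in> F_theta \<theta> \<Longrightarrow> integrable \<nu> f"
proof -
  assume f: "f \<in> F_theta \<theta>"
  then obtain K where K: "\<And>x. x \<in> Omega_star \<Longrightarrow> norm (f x) \<le> K" unfolding F_theta_def by blast
  show "integrable \<nu> f"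
    by (rule integrable_const_bound[of _ K]) (use K F_theta_measurable[OF f] in \<open>auto simp: space_nu\<close>)
qed

lemma cone_in_F_theta:
  assumes f: "cone B f"
  shows "(\<lambda>x. complex_of_real (f x)) \<in> F_theta \<theta>"
  unfolding F_theta_def
proof (intro CollectI conjI exI ballI)
  show "norm (complex_of_real (f x)) \<le> exp B * f ones" if "x \<in> Omega_star" for x
    using cone_le_exp[OF f _ that, of ones] coneD(1)[OF f that that] B_pos by simp
  fix x y assume xy: "x \<in> Omega_star" "y \<in> Omega_star"
  have "norm (complex_of_real (f x) - complex_of_real (f y)) = \<bar>f x - f y\<bar>"
    by (simp flip: of_real_diff)
  also have "\<dots> \<le> B * exp (2 * B) * d_theta \<theta> x y * f ones"
    by (rule cone_lipschitz[OF f xy]) auto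
  finally show "norm (complex_of_real (f x) - complex_of_real (f y)) \<le> (B * exp (2 * B) * f ones) * d_theta \<theta> x y"
    by (simp add: mult_ac)
qed

lemma cone_integrable: "cone B f \<Longrightarrow> integrable \<nu> f"
  using integrable_Re[OF F_theta_integrable[OF cone_in_F_theta]] by simp

lemma induced_operator_eq:
  "induced_operator V f x = (\<Sum>n. complex_of_real (\<psi> n x) * f (cons n x))"
  by (simp add: induced_operator_def \<psi>_def cons_def)

text \<open>Indexed by letters: the probability of passage time n + 1, as
  \<open>passage_prob_eq\<close> shows; \<open>pr'\<close> undoes the shift of index.\<close>

definition pr :: "nat \<Rightarrow> real" where
  "pr n = (\<integral>x. of_bool (first_one x = n) * h x \<partial>\<nu>)"

lemma bounded_first_one_h:
  assumes "\<And>n. norm (g n :: complex) \<le> M"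
  shows "(\<lambda>x. g (first_one x) * complex_of_real (h x)) \<in> F_theta \<theta>"
  using h_in assms theta by (rule F_theta_first_one_mult)

lemma of_bool_h_in: "(\<lambda>x. of_bool (first_one x = n) * complex_of_real (h x)) \<in> F_theta \<theta>"
  by (rule bounded_first_one_h[of _ 1]) auto

lemma of_bool_h_eq:
  "(\<lambda>x. of_bool (first_one x = n) * complex_of_real (h x)) = (\<lambda>x. complex_of_real (of_bool (first_one x = n) * h x))"
  by auto

lemma of_bool_h_integrable: "integrable \<nu> (\<lambda>x. of_bool (first_one x = n) * h x)"
  using F_theta_integrable[OF of_bool_h_in[of n]]
  unfolding of_bool_h_eq by (simp only: complex_of_real_integrable_eq)

lemma of_real_pr: "(\<integral>x. of_bool (first_one x = n) * complex_of_real (h x) \<partial>\<nu>) = of_real (pr n)"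
  unfolding of_bool_h_eq pr_def by (rule integral_complex_of_real)

lemma passage_prob_eq: "passage_prob (density \<nu> (\<lambda>x. ennreal (h x))) (Suc n) = pr n"
proof -
  let ?S = "level_set (Suc n) \<inter> Omega_star"
  have S: "?S = {x \<in> space \<nu>. first_one x = n}"
    unfolding space_nu level_set_Suc by (auto elim: star_cases)
  have hm: "h \<in> borel_measurable \<nu>" using cone_integrable[OF cone_h] by simp
  have one: "(\<lambda>x. of_bool (first_one x = n) * 1 :: complex) \<in> F_theta \<theta>"
    by (rule F_theta_first_one_mult[OF _ _ theta, of _ _ 1]) (auto simp: F_theta_def intro!: exI[of _ 1])
  have "{x \<in> space \<nu>. (of_bool (first_one x = n) * 1 :: complex) = 1} \<in> sets \<nu>"
    using F_theta_measurable[OF one] by measurable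
  moreover have "{x \<in> space \<nu>. (of_bool (first_one x = n) * 1 :: complex) = 1} = ?S" unfolding S by auto
  ultimately have Sm: "?S \<in> sets \<nu>" by simp
  have "emeasure (density \<nu> (\<lambda>x. ennreal (h x))) ?S = (\<integral>\<^sup>+ x. ennreal (h x) * indicator ?S x \<partial>\<nu>)"
    by (rule emeasure_density) (use hm Sm in auto)
  also have "\<dots> = (\<integral>\<^sup>+ x. ennreal (of_bool (first_one x = n) * h x) \<partial>\<nu>)"
    by (rule nn_integral_cong) (auto simp: S indicator_def)
  also have "\<dots> = ennreal (pr n)" unfolding pr_def
    by (rule nn_integral_eq_integral[OF of_bool_h_integrable]) (use h_pos space_nu in \<open>auto simp: less_imp_le\<close>)
  finally have "measure (density \<nu> (\<lambda>x. ennreal (h x))) ?S = enn2real (ennreal (pr n))"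
    by (simp add: measure_def)
  moreover have "0 \<le> pr n" unfolding pr_def
    by (rule integral_nonneg_AE) (use h_pos space_nu in \<open>auto simp: less_imp_le\<close>)
  ultimately show ?thesis by (simp add: passage_prob_def)
qed

text \<open>Applied to h restricted to first letter n, the induced operator has the single nonzero
  term \<open>Lop n h\<close>; invariance of the measure does the rest.\<close>

lemma pr_eq_integral_Lop: "pr n = (\<integral>x. Lop n h x \<partial>\<nu>)"
proof -
  have "induced_operator V (\<lambda>x. of_bool (first_one x = n) * complex_of_real (h x)) y = complex_of_real (Lop n h y)" for y
    unfolding induced_operator_eq by (subst suminf_finite[of "{n}"]) (auto simp: Lop_def)
  then have "complex_of_real (\<integral>x. Lop n h x \<partial>\<nu>) = of_real (pr n)"
    using nu_eigen[OF of_bool_h_in[of n]] unfolding of_real_pr by simp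
  then show ?thesis by (simp only: of_real_eq_iff)
qed

lemma cone_integral_bounds:
  assumes f: "cone B f" and x: "x \<in> Omega_star"
  shows "f x \<le> exp B * (\<integral>y. f y \<partial>\<nu>)" "(\<integral>y. f y \<partial>\<nu>) \<le> exp B * f x"
proof -
  have "(\<integral>y. f x \<partial>\<nu>) \<le> (\<integral>y. exp B * f y \<partial>\<nu>)"
    by (rule integral_mono) (use cone_integrable[OF f] cone_le_exp[OF f _ x] B_pos space_nu in auto)
  then show "f x \<le> exp B * (\<integral>y. f y \<partial>\<nu>)" by (simp add: prob_space)
  have "(\<integral>y. f y \<partial>\<nu>) \<le> (\<integral>y. exp B * f x \<partial>\<nu>)"
    by (rule integral_mono) (use cone_integrable[OF f] cone_le_exp[OF f _ _ x] B_pos space_nu in auto)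
  then show "(\<integral>y. f y \<partial>\<nu>) \<le> exp B * f x" by (simp add: prob_space)
qed

text \<open>Letter weights at any point are comparable with passage probabilities; this carries
  moments of the measure over to operator bounds and back.\<close>

lemma Lop_h_le_pr: "x \<in> Omega_star \<Longrightarrow> Lop n h x \<le> exp B * pr n"
  and pr_le_Lop_h: "x \<in> Omega_star \<Longrightarrow> pr n \<le> exp B * Lop n h x"
  unfolding pr_eq_integral_Lop using cone_integral_bounds[OF cone_Lop'[OF cone_h]] by auto

lemma pr_pos: "0 < pr n"
proof -
  have "0 < exp B * pr n" using Lop_h_le_pr[of ones n] Lop_h_pos[of ones n] by (auto intro: less_le_trans)
  then show ?thesis by (simp add: zero_less_mult_iff)
qed

lemma integral_first_one_sums:
  assumes g: "\<And>n. norm (g n :: complex) \<le> M"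
  shows "(\<lambda>n. g n * of_real (pr n)) sums (\<integral>x. g (first_one x) * complex_of_real (h x) \<partial>\<nu>)"
  unfolding sums_def
proof -
  let ?s = "\<lambda>N x. \<Sum>n<N. g n * (of_bool (first_one x = n) * complex_of_real (h x))"
  have s: "?s N x = (if first_one x < N then g (first_one x) * complex_of_real (h x) else 0)" for N x
  proof -
    have "?s N x = (\<Sum>n<N. if n = first_one x then g n * complex_of_real (h x) else 0)"
      by (rule sum.cong) auto
    then show ?thesis by (simp add: sum.delta)
  qed
  have M: "0 \<le> M" using g[of 0] norm_ge_zero[of "g 0"] by linarith
  have "(\<lambda>N. \<integral>x. ?s N x \<partial>\<nu>) \<longlonglongrightarrow> (\<integral>x. g (first_one x) * complex_of_real (h x) \<partial>\<nu>)"
  proof (rule integral_dominated_convergence[where w = "\<lambda>x. M * h x"])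
    show "(\<lambda>x. g (first_one x) * complex_of_real (h x)) \<in> borel_measurable \<nu>"
      by (rule F_theta_measurable[OF bounded_first_one_h[OF g]])
    show "(\<lambda>x. ?s N x) \<in> borel_measurable \<nu>" for N
      by (intro borel_measurable_sum borel_measurable_times borel_measurable_const F_theta_measurable[OF of_bool_h_in])
    show "integrable \<nu> (\<lambda>x. M * h x)" using cone_integrable[OF cone_h] by simp
    show "AE x in \<nu>. (\<lambda>N. ?s N x) \<longlonglongrightarrow> g (first_one x) * complex_of_real (h x)"
    proof (rule AE_I2)
      fix x
      have "\<forall>\<^sub>F N in sequentially. ?s N x = g (first_one x) * complex_of_real (h x)"
        using eventually_gt_at_top[of "first_one x"] by eventually_elim (simp only: s if_True)
      then show "(\<lambda>N. ?s N x) \<longlonglongrightarrow> g (first_one x) * complex_of_real (h x)" by (rule tendsto_eventually)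
    qed
    show "AE x in \<nu>. norm (?s N x) \<le> M * h x" for N
    proof (rule AE_I2)
      fix x assume "x \<in> space \<nu>"
      then have "0 < h x" using h_pos space_nu by simp
      then show "norm (?s N x) \<le> M * h x"
        unfolding s using g[of "first_one x"] M by (auto simp: norm_mult intro: mult_right_mono)
    qed
  qed
  moreover have "(\<integral>x. ?s N x \<partial>\<nu>) = (\<Sum>n<N. g n * of_real (pr n))" for N
    by (subst Bochner_Integration.integral_sum) (auto simp: of_real_pr intro!: F_theta_integrable[OF of_bool_h_in])
  ultimately show "(\<lambda>N. \<Sum>n<N. g n * of_real (pr n)) \<longlonglongrightarrow> (\<integral>x. g (first_one x) * complex_of_real (h x) \<partial>\<nu>)" by simp
qed

lemma pr_sums: "pr sums 1"
proof -
  have "(\<lambda>n. complex_of_real (pr n)) sums (\<integral>x. complex_of_real (h x) \<partial>\<nu>)"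
    using integral_first_one_sums[of "\<lambda>_. 1" 1] by simp
  also have "(\<integral>x. complex_of_real (h x) \<partial>\<nu>) = of_real 1" using h_norm by simp
  finally show ?thesis by (simp only: sums_of_real_iff)
qed

text \<open>Moving the power of z into the function writes M_z gen as the operator without z applied
  to \<open>?f\<close>. Integrating \<open>gen_equation\<close>, invariance of the measure turns
  that side into the integral of \<open>?f\<close>.\<close>

lemma one_minus_renewal:
  assumes z: "norm z \<le> 1"
  shows "1 - ren z = (\<integral>x. (1 - z ^ Suc (first_one x)) * gen z x \<partial>\<nu>)"
proof -
  let ?f = "\<lambda>x. z ^ Suc (first_one x) * gen z x"
  have f: "?f \<in> F_theta \<theta>"
    by (rule F_theta_first_one_mult[OF gen_in_F_theta[OF z] _ theta, of _ 1])
      (use z in \<open>simp add: norm_power power_le_one norm_mult mult_le_one\<close>)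
  have "induced_operator V ?f x = gen z x - (1 - ren z)" if "x \<in> Omega_star" for x
    using gen_equation[OF that z] unfolding induced_operator_eq first_one_cons by (simp only: sums_iff) simp
  then have "(\<integral>x. induced_operator V ?f x \<partial>\<nu>) = (\<integral>x. gen z x - (1 - ren z) \<partial>\<nu>)"
    by (intro Bochner_Integration.integral_cong) (auto simp: space_nu)
  also have "\<dots> = (\<integral>x. gen z x \<partial>\<nu>) - (1 - ren z)"
    by (subst Bochner_Integration.integral_diff) (use F_theta_integrable[OF gen_in_F_theta[OF z]] in \<open>auto simp: prob_space\<close>)
  finally have "1 - ren z = (\<integral>x. gen z x \<partial>\<nu>) - (\<integral>x. ?f x \<partial>\<nu>)"
    unfolding nu_eigen[OF f] by simp
  also have "\<dots> = (\<integral>x. gen z x - ?f x \<partial>\<nu>)"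
    by (rule Bochner_Integration.integral_diff[symmetric]) (use F_theta_integrable f gen_in_F_theta[OF z] in auto)
  finally show ?thesis by (simp add: left_diff_distrib)
qed

lemma renewal_coeff_nonneg: "0 \<le> renewal_coeff n"
  unfolding renewal_coeff_def word_coeff_def by (intro sum_nonneg renewal_bounds)

text \<open>At z = 1 the integrand in \<open>one_minus_renewal\<close> vanishes identically.\<close>

lemma renewal_coeff_sums: "renewal_coeff sums 1"
proof -
  have "ren 1 = 1" using one_minus_renewal[of 1] by simp
  moreover have "(\<lambda>n. complex_of_real (renewal_coeff n) * 1 ^ n) sums ren 1"
    using word_coeff_sums[OF renewal_abs_summable[of 1]] unfolding renewal_coeff_def word_coeff_of_real psum_def
    by (simp add: sums_iff)
  ultimately have "(\<lambda>n. complex_of_real (renewal_coeff n)) sums of_real 1" by simp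
  then show ?thesis by (simp only: sums_of_real_iff)
qed

definition pr' :: "nat \<Rightarrow> real" where
  "pr' n = (case n of 0 \<Rightarrow> 0 | Suc k \<Rightarrow> pr k)"

abbreviation "pas z \<equiv> psum (\<lambda>n. of_real (pr' n)) z"

lemma pr'_simps [simp]: "pr' 0 = 0" "pr' (Suc n) = pr n"
  by (simp_all add: pr'_def)

lemma pr'_sums: "pr' sums 1"
  using pr_sums sums_Suc_iff[of pr' 1] by simp

lemma pr'_bounds: "0 \<le> pr' n" "0 < pr' 1" "pr' n \<le> 1"
proof -
  show nn: "0 \<le> pr' n" for n using pr_pos by (cases n) (auto simp: less_imp_le)
  show "0 < pr' 1" using pr_pos[of 0] by (simp only: One_nat_def pr'_simps)
  have "(\<Sum>i\<in>{n}. pr' i) \<le> suminf pr'"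
    using nn pr'_sums by (intro sum_le_suminf) (auto simp: sums_iff)
  then show "pr' n \<le> 1" using pr'_sums by (simp add: sums_iff)
qed

text \<open>What one-letter words alone contribute to \<open>renewal_coeff\<close>: exp B compares
  the value at \<open>ones\<close> with the mean over \<open>\<nu>\<close>, and hmax compares h with
  1.\<close>

definition "M0 = c / (hmax * exp B)"

lemma M0_pos: "0 < M0"
  using c_bounds hmin_pos hmin[of ones] hmax[of ones] unfolding M0_def by (intro divide_pos_pos mult_pos_pos) auto

lemma renewal_coeff_ge: "M0 * pr' n \<le> renewal_coeff n"
proof (cases n)
  case 0
  then show ?thesis using renewal_coeff_nonneg by simp
next
  case (Suc k)
  have hm: "0 < hmax" using hmin_pos hmin[of ones] hmax[of ones] by simp
  have "pr k \<le> exp B * Lop k h ones" by (rule pr_le_Lop_h) simp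
  also have "Lop k h ones \<le> Lop k (\<lambda>_. hmax) ones" by (rule Lop_le_Lop) (simp add: hmax)
  also have "Lop k (\<lambda>_. hmax) ones = hmax * Lop k (\<lambda>_. 1) ones" by (simp add: Lop_def)
  finally have "M0 * pr k \<le> M0 * (exp B * (hmax * Lop k (\<lambda>_. 1) ones))" using M0_pos by (intro mult_left_mono) auto
  also have "\<dots> = renewal [k]" using hm by (simp add: M0_def renewal_def)
  also have "\<dots> \<le> renewal_coeff n"
    unfolding renewal_coeff_def word_coeff_def by (rule member_le_sum) (use Suc renewal_bounds in auto)
  finally show ?thesis by (simp add: Suc)
qed

lemma weighted_Lop_le:
  assumes W: "\<And>n. 0 \<le> W n" "summable (\<lambda>n. W (Suc n) * pr n)" and x: "x \<in> Omega_star"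
  shows "(\<Sum>n<K. W (Suc n) * Lop n h x) \<le> exp B / hmin * (\<Sum>n. W (Suc n) * pr n) * h x"
proof -
  have "(\<Sum>n<K. W (Suc n) * Lop n h x) \<le> (\<Sum>n<K. W (Suc n) * (exp B * pr n))"
    using W x by (intro sum_mono mult_left_mono Lop_h_le_pr) auto
  also have "\<dots> = exp B * (\<Sum>n<K. W (Suc n) * pr n)" by (simp add: sum_distrib_left mult_ac)
  also have "\<dots> \<le> exp B * (\<Sum>n. W (Suc n) * pr n)"
    using W pr_pos by (intro mult_left_mono sum_le_suminf) (auto simp: less_imp_le)
  also have "\<dots> = exp B / hmin * (\<Sum>n. W (Suc n) * pr n) * hmin" using hmin_pos by simp
  also have "\<dots> \<le> exp B / hmin * (\<Sum>n. W (Suc n) * pr n) * h x"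
    using hmin[OF x] hmin_pos W pr_pos by (intro mult_left_mono mult_nonneg_nonneg suminf_nonneg) (auto simp: less_imp_le)
  finally show ?thesis .
qed

lemma passage_gf_eq: "passage_gf (density \<nu> (\<lambda>x. ennreal (h x))) z = pas z" if "norm z \<le> 1"
proof -
  have "summable (\<lambda>n. norm (complex_of_real (pr' n)))" using pr'_sums pr'_bounds(1) by (simp add: sums_iff)
  then have sm: "summable (\<lambda>n. complex_of_real (pr' n) * z ^ n)"
    by (rule summable_norm_cancel[OF psum_summable_norm[OF _ that]])
  show ?thesis
    unfolding passage_gf_def psum_def passage_prob_eq using suminf_split_head[OF sm] by simp
qed

lemma one_minus_passage:
  assumes z: "norm z \<le> 1"
  shows "1 - pas z = (\<integral>x. (1 - z ^ Suc (first_one x)) * complex_of_real (h x) \<partial>\<nu>)"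
proof -
  have b: "norm (1 - z ^ Suc n) \<le> 2" for n by (rule norm_one_minus_power_le(3)[OF z])
  have "(\<lambda>n. of_real (pr' n) * (1 - z ^ n)) sums (1 - pas z)"
    by (rule sum_terms_one_minus_power(1)[OF pr'_sums pr'_bounds(1) z])
  then have "(\<lambda>n. of_real (pr' (Suc n)) * (1 - z ^ Suc n)) sums (1 - pas z)"
    by (subst sums_Suc_iff) simp
  then have "(\<lambda>n. (1 - z ^ Suc n) * of_real (pr n)) sums (1 - pas z)"
    by (simp add: mult.commute)
  then show ?thesis using integral_first_one_sums[of "\<lambda>n. 1 - z ^ Suc n", OF b] by (rule sums_unique2)
qed

definition \<eta> :: "complex \<Rightarrow> real" where
  "\<eta> z = (\<Sum>n. pr' n * norm (1 - z ^ n))"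

lemma eta_summable:
  assumes z: "norm z \<le> 1"
  shows "summable (\<lambda>n. norm (1 - z ^ Suc n) * pr n)" "\<eta> z = (\<Sum>n. norm (1 - z ^ Suc n) * pr n)" "0 \<le> \<eta> z"
proof -
  have sm: "summable (\<lambda>n. pr' n * norm (1 - z ^ n))"
  proof (rule summable_comparison_test'[OF summable_mult2[OF sums_summable[OF pr'_sums], of 2], of 0])
    show "norm (pr' n * norm (1 - z ^ n)) \<le> pr' n * 2" for n
      using norm_one_minus_power_le(3)[OF z] pr'_bounds(1)[of n] by (auto simp: abs_mult intro: mult_left_mono)
  qed
  then show sm1: "summable (\<lambda>n. norm (1 - z ^ Suc n) * pr n)"
    by (subst (asm) summable_Suc_iff[symmetric]) (simp add: mult.commute)
  show e: "\<eta> z = (\<Sum>n. norm (1 - z ^ Suc n) * pr n)"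
    unfolding \<eta>_def using suminf_split_head[OF sm] by (simp add: mult.commute)
  show "0 \<le> \<eta> z" unfolding e using pr_pos by (intro suminf_nonneg sm1) (auto simp: less_imp_le)
qed

lemma integral_norm_defect:
  assumes z: "norm z \<le> 1"
  shows "integrable \<nu> (\<lambda>x. norm (1 - z ^ Suc (first_one x)))" "(\<integral>x. norm (1 - z ^ Suc (first_one x)) \<partial>\<nu>) \<le> \<eta> z / hmin"
proof -
  let ?g = "\<lambda>n. complex_of_real (norm (1 - z ^ Suc n))"
  have b: "norm (?g n) \<le> 2" for n using norm_one_minus_power_le(3)[OF z, of "Suc n"] by simp
  have one: "(\<lambda>x. ?g (first_one x) * 1) \<in> F_theta \<theta>"
    by (rule F_theta_first_one_mult[OF _ b theta]) (auto simp: F_theta_def intro!: exI[of _ 1])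
  show i1: "integrable \<nu> (\<lambda>x. norm (1 - z ^ Suc (first_one x)))"
    using integrable_Re[OF F_theta_integrable[OF one]] by simp
  have i2: "integrable \<nu> (\<lambda>x. norm (1 - z ^ Suc (first_one x)) * h x)"
    using integrable_Re[OF F_theta_integrable[OF bounded_first_one_h[of ?g, OF b]]] by simp
  have "(\<lambda>n. complex_of_real (norm (1 - z ^ Suc n) * pr n)) sums (\<integral>x. complex_of_real (norm (1 - z ^ Suc (first_one x)) * h x) \<partial>\<nu>)"
    using integral_first_one_sums[of ?g, OF b] by (simp only: of_real_mult)
  then have "(\<lambda>n. norm (1 - z ^ Suc n) * pr n) sums (\<integral>x. norm (1 - z ^ Suc (first_one x)) * h x \<partial>\<nu>)"
    by (simp only: integral_complex_of_real sums_of_real_iff)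
  then have "(\<integral>x. norm (1 - z ^ Suc (first_one x)) * h x \<partial>\<nu>) = \<eta> z"
    unfolding eta_summable(2)[OF z] by (simp only: sums_iff)
  moreover have "(\<integral>x. hmin * norm (1 - z ^ Suc (first_one x)) \<partial>\<nu>) \<le> (\<integral>x. norm (1 - z ^ Suc (first_one x)) * h x \<partial>\<nu>)"
    by (rule integral_mono) (use i1 i2 hmin space_nu in \<open>auto simp: mult.commute[of hmin] intro: mult_left_mono\<close>)
  ultimately show "(\<integral>x. norm (1 - z ^ Suc (first_one x)) \<partial>\<nu>) \<le> \<eta> z / hmin"
    using hmin_pos by (simp add: field_simps)
qed

text \<open>The factor between h and \<open>gen1\<close> in \<open>h_eq_gen1\<close>; it becomes the
  limit of (1 - P) / (1 - a) at 1.\<close>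

definition "\<kappa> = c * h ones"

lemma kappa_pos: "0 < \<kappa>"
  using c_bounds h_pos[of ones] by (simp add: \<kappa>_def)

text \<open>By \<open>h_eq_gen1\<close> both defects are integrals of the same factor
  \<open>1 - z ^ Suc (first_one x)\<close>, once against gen 1 and once against gen z. The integral
  of that factor's norm and the uniform size of gen 1 - gen z are each O(\<eta> z), whence the
  square.\<close>

lemma renewal_vs_passage:
  "\<exists>K. \<forall>z. norm z \<le> 1 \<longrightarrow>
    norm ((1 - pas z) / of_real \<kappa> - (1 - ren z)) \<le> K * (\<eta> z)\<^sup>2"
proof (intro exI allI impI)
  fix z :: complex assume z: "norm z \<le> 1"
  define Q where "Q = (\<Sum>p. (real p + 1) ^ Suc 0 * r ^ p)"
  have Q: "0 \<le> Q" unfolding Q_def using r_bounds by (intro suminf_nonneg summable_linear_times_power) auto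
  define D where "D = Q * (exp B / hmin * \<eta> z) * hmax / hmin"
  have hm: "0 \<le> hmax" using hmin_pos hmin[of ones] hmax[of ones] by simp
  have D0: "0 \<le> D" unfolding D_def using Q hmin_pos hm eta_summable(3)[OF z] by (intro divide_nonneg_pos mult_nonneg_nonneg) auto
  have gd: "norm (gen 1 x - gen z x) \<le> D" if x: "x \<in> Omega_star" for x
  proof -
    have m: "(\<Sum>n<K. norm (1 - z ^ Suc n) * Lop n h x) \<le> exp B / hmin * \<eta> z * h x" if "x \<in> Omega_star" for K x
      using weighted_Lop_le[of "\<lambda>n. norm (1 - z ^ n)" x K] eta_summable[OF z] that by simp
    have "norm (gen 1 x - gen z x) \<le> Q * (exp B / hmin * \<eta> z) * h x / hmin"
      unfolding Q_def by (rule gen_diff_le[OF x z m]) (use hmin_pos eta_summable(3)[OF z] in auto)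
    also have "\<dots> \<le> D" unfolding D_def using Q hmin_pos hmax[OF x] eta_summable(3)[OF z]
      by (intro divide_right_mono mult_left_mono mult_nonneg_nonneg) auto
    finally show ?thesis .
  qed
  have b: "norm (1 - z ^ Suc n) \<le> 2" for n by (rule norm_one_minus_power_le(3)[OF z])
  have i1: "integrable \<nu> (\<lambda>x. (1 - z ^ Suc (first_one x)) * gen 1 x)"
    by (rule F_theta_integrable[OF F_theta_first_one_mult[OF gen_in_F_theta b theta]]) simp
  have iz: "integrable \<nu> (\<lambda>x. (1 - z ^ Suc (first_one x)) * gen z x)"
    by (rule F_theta_integrable[OF F_theta_first_one_mult[OF gen_in_F_theta[OF z] b theta]])
  have "(1 - pas z) / of_real \<kappa> = (\<integral>x. (1 - z ^ Suc (first_one x)) * complex_of_real (h x) / of_real \<kappa> \<partial>\<nu>)"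
    unfolding one_minus_passage[OF z] by simp
  also have "\<dots> = (\<integral>x. (1 - z ^ Suc (first_one x)) * gen 1 x \<partial>\<nu>)"
    by (rule Bochner_Integration.integral_cong)
      (use h_eq_gen1 gen_one kappa_pos space_nu in \<open>auto simp: \<kappa>_def[symmetric]\<close>)
  finally have "(1 - pas z) / of_real \<kappa> - (1 - ren z) =
      (\<integral>x. (1 - z ^ Suc (first_one x)) * gen 1 x - (1 - z ^ Suc (first_one x)) * gen z x \<partial>\<nu>)"
    unfolding one_minus_renewal[OF z] using Bochner_Integration.integral_diff[OF i1 iz] by simp
  then have "norm ((1 - pas z) / of_real \<kappa> - (1 - ren z)) \<le>
      (\<integral>x. norm ((1 - z ^ Suc (first_one x)) * gen 1 x - (1 - z ^ Suc (first_one x)) * gen z x) \<partial>\<nu>)"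
    by (simp only: integral_norm_bound)
  also have "\<dots> \<le> (\<integral>x. D * norm (1 - z ^ Suc (first_one x)) \<partial>\<nu>)"
  proof (rule integral_mono)
    show "integrable \<nu> (\<lambda>x. norm ((1 - z ^ Suc (first_one x)) * gen 1 x - (1 - z ^ Suc (first_one x)) * gen z x))"
      using i1 iz by (intro integrable_norm Bochner_Integration.integrable_diff)
    show "integrable \<nu> (\<lambda>x. D * norm (1 - z ^ Suc (first_one x)))" using integral_norm_defect(1)[OF z] by (rule integrable_mult_right)
    fix x assume "x \<in> space \<nu>"
    then have "norm (1 - z ^ Suc (first_one x)) * norm (gen 1 x - gen z x) \<le> norm (1 - z ^ Suc (first_one x)) * D"
      using gd space_nu by (intro mult_left_mono) auto
    then show "norm ((1 - z ^ Suc (first_one x)) * gen 1 x - (1 - z ^ Suc (first_one x)) * gen z x) \<le> D * norm (1 - z ^ Suc (first_one x))"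
      by (simp only: right_diff_distrib[symmetric] norm_mult mult.commute[of D])
  qed
  also have "\<dots> = D * (\<integral>x. norm (1 - z ^ Suc (first_one x)) \<partial>\<nu>)" by (rule integral_mult_right_zero)
  also have "\<dots> \<le> D * (\<eta> z / hmin)" using D0 by (intro mult_left_mono integral_norm_defect(2)[OF z])
  also have "\<dots> = (Q * exp B * hmax / hmin ^ 3) * (\<eta> z)\<^sup>2"
    unfolding D_def using hmin_pos by (simp add: power2_eq_square power3_eq_cube)
  finally show "norm ((1 - pas z) / of_real \<kappa> - (1 - ren z)) \<le>
      ((\<Sum>p. (real p + 1) ^ Suc 0 * r ^ p) * exp B * hmax / hmin ^ 3) * (\<eta> z)\<^sup>2"
    by (simp only: Q_def)
qed

end

section \<open>The zeta function on the closed disc\<close>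

text \<open>With n the largest letter, \<open>tot u\<close> is at most n + 1 times the length, while
  the power of x only decreases as the exponent grows to \<open>tot u\<close>; so a single summand
  on the right is enough.\<close>

lemma power_tot_le:
  assumes x: "0 \<le> x" "x \<le> (1::real)" and u: "u \<noteq> []"
  shows "real (tot u) ^ j * x ^ tot u \<le> (real (length u) + 1) ^ j * (\<Sum>n\<leftarrow>u. real (Suc n) ^ j * x ^ Suc n)"
proof -
  define n where "n = Max (set u)"
  have n: "n \<in> set u" "\<And>m. m \<in> set u \<Longrightarrow> m \<le> n" using u by (auto simp: n_def)
  have "tot v \<le> length v * Suc n" if "\<And>m. m \<in> set v \<Longrightarrow> m \<le> n" for v
    using that
  proof (induction v)
    case (Cons a v)
    then have "a \<le> n" "tot v \<le> length v * Suc n" by auto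
    then show ?case by simp
  qed simp
  then have "tot u \<le> length u * Suc n" using n by blast
  also have "\<dots> \<le> (length u + 1) * Suc n" by (intro mult_le_mono) auto
  finally have "real (tot u) \<le> (real (length u) + 1) * real (Suc n)"
    by (metis of_nat_1 of_nat_add of_nat_le_iff of_nat_mult)
  then have "real (tot u) ^ j \<le> ((real (length u) + 1) * real (Suc n)) ^ j" by (intro power_mono) auto
  moreover have "x ^ tot u \<le> x ^ Suc n" using letter_less_tot[OF n(1)] x by (intro power_decreasing) auto
  ultimately have "real (tot u) ^ j * x ^ tot u \<le> ((real (length u) + 1) * real (Suc n)) ^ j * x ^ Suc n"
    using x by (intro mult_mono) auto
  also have "\<dots> = (real (length u) + 1) ^ j * (real (Suc n) ^ j * x ^ Suc n)"
    by (simp only: power_mult_distrib mult.assoc)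
  also have "\<dots> \<le> (real (length u) + 1) ^ j * (\<Sum>n\<leftarrow>u. real (Suc n) ^ j * x ^ Suc n)"
  proof (intro mult_left_mono)
    have elem: "f n \<le> (\<Sum>n\<leftarrow>v. f n)" if "n \<in> set v" "\<And>n. 0 \<le> f n" for v and f :: "nat \<Rightarrow> real"
      using that
    proof (induction v)
      case (Cons m v)
      have "0 \<le> (\<Sum>n\<leftarrow>v. f n)" using Cons.prems(2) by (intro sum_list_nonneg) auto
      then show ?case using Cons by (cases "n = m") (auto intro: order_trans)
    qed simp
    show "real (Suc n) ^ j * x ^ Suc n \<le> (\<Sum>n\<leftarrow>u. real (Suc n) ^ j * x ^ Suc n)"
      by (rule elem[OF n(1)]) (intro mult_nonneg_nonneg zero_le_power of_nat_0_le_iff x)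
  qed simp
  finally show ?thesis .
qed

context measure_system
begin

text \<open>One constant for all x: at x = 1 it transfers finite moments, and for x < 1 it bounds
  the growth when the moment diverges.\<close>

lemma regular_coeff_moments:
  "\<exists>K. \<forall>x N. 0 \<le> x \<longrightarrow> x \<le> 1 \<longrightarrow> summable (\<lambda>n. real n ^ j * pr' n * x ^ n) \<longrightarrow>
    (\<Sum>n<N. real n ^ j * norm (regular_coeff n) * x ^ n) \<le> K * (\<Sum>n. real n ^ j * pr' n * x ^ n)"
proof (intro exI allI impI)
  fix x :: real and N assume x: "0 \<le> x" "x \<le> 1" and sm: "summable (\<lambda>n. real n ^ j * pr' n * x ^ n)"
  let ?W = "\<lambda>n. real n ^ j * x ^ n"
  have W0: "0 \<le> ?W n" for n using x by simp
  have sm': "summable (\<lambda>n. ?W (Suc n) * pr n)"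
    using sm by (subst (asm) summable_Suc_iff[symmetric]) (simp add: mult_ac)
  have eq: "(\<Sum>n. ?W (Suc n) * pr n) = (\<Sum>n. real n ^ j * pr' n * x ^ n)"
    using suminf_split_head[OF sm] by (simp add: mult_ac)
  have "(\<Sum>n<N. ?W n * norm (regular_coeff n)) \<le>
      2 * trace_const * (\<Sum>p. (real p + 1) ^ Suc j * s ^ p) * h ones * (exp B / hmin * (\<Sum>n. ?W (Suc n) * pr n))"
  proof (rule weighted_regular_le[OF W0])
    show "?W (tot u) \<le> (real (length u) + 1) ^ j * (\<Sum>n\<leftarrow>u. ?W (Suc n))" if "u \<noteq> []" for u
      using power_tot_le[OF x that] .
    show "(\<Sum>n<K. ?W (Suc n) * Lop n h y) \<le> exp B / hmin * (\<Sum>n. ?W (Suc n) * pr n) * h y" if "y \<in> Omega_star" for K y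
      by (rule weighted_Lop_le[OF W0 sm' that])
    show "0 \<le> exp B / hmin * (\<Sum>n. ?W (Suc n) * pr n)"
      using hmin_pos pr_pos x by (intro mult_nonneg_nonneg suminf_nonneg sm') (auto simp: less_imp_le)
  qed
  then show "(\<Sum>n<N. real n ^ j * norm (regular_coeff n) * x ^ n) \<le>
      (2 * trace_const * (\<Sum>p. (real p + 1) ^ Suc j * s ^ p) * h ones * (exp B / hmin)) * (\<Sum>n. real n ^ j * pr' n * x ^ n)"
    unfolding eq by (simp add: mult_ac)
qed

lemma summable_regular_coeff:
  assumes "summable (\<lambda>n. real n ^ j * pr' n)"
  shows "summable (\<lambda>n. real n ^ j * norm (regular_coeff n))"
proof -
  obtain K where "\<forall>x N. 0 \<le> x \<longrightarrow> x \<le> 1 \<longrightarrow> summable (\<lambda>n. real n ^ j * pr' n * x ^ n) \<longrightarrow>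
    (\<Sum>n<N. real n ^ j * norm (regular_coeff n) * x ^ n) \<le> K * (\<Sum>n. real n ^ j * pr' n * x ^ n)"
    using regular_coeff_moments[of j] by blast
  from spec[OF this, of 1] show ?thesis
    using assms by (intro summableI_nonneg_bounded[of _ "K * (\<Sum>n. real n ^ j * pr' n)"]) auto
qed

lemma regular_coeff_summable: "summable (\<lambda>n. norm (regular_coeff n))"
  using summable_regular_coeff[of 0] pr'_sums by (simp add: sums_iff)

lemma regular_coeff_power_le:
  "\<exists>K. \<forall>x. 0 < x \<longrightarrow> x < 1 \<longrightarrow>
    (\<Sum>n. real n ^ k * norm (regular_coeff n) * x ^ n) \<le> K * (\<Sum>n. real n ^ k * pr' n * x ^ n)"
proof -
  obtain K where K: "\<And>x N. 0 \<le> x \<Longrightarrow> x \<le> 1 \<Longrightarrow> summable (\<lambda>n. real n ^ k * pr' n * x ^ n) \<Longrightarrow>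
      (\<Sum>n<N. real n ^ k * norm (regular_coeff n) * x ^ n) \<le> K * (\<Sum>n. real n ^ k * pr' n * x ^ n)"
    using regular_coeff_moments[of k] by blast
  obtain M where M: "\<And>n. norm (norm (regular_coeff n)) \<le> M"
    using summable_imp_bounded[OF regular_coeff_summable] unfolding bounded_iff by blast
  show ?thesis
  proof (intro exI allI impI)
    fix x :: real assume x: "0 < x" "x < 1"
    have "summable (\<lambda>n. real n ^ k * norm (regular_coeff n) * x ^ n)"
      by (rule summable_power_times[of _ _ M]) (use x M in auto)
    moreover have "summable (\<lambda>n. real n ^ k * pr' n * x ^ n)"
      by (rule summable_power_times[of _ _ 1]) (use x pr'_bounds in auto)
    ultimately show "(\<Sum>n. real n ^ k * norm (regular_coeff n) * x ^ n) \<le> K * (\<Sum>n. real n ^ k * pr' n * x ^ n)"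
      using x by (intro suminf_le_const K) auto
  qed
qed

lemma renewal_coeff_1: "0 < renewal_coeff 1"
  using renewal_coeff_ge[of 1] M0_pos pr'_bounds(2) by (meson less_le_trans mult_pos_pos)

lemma ren_ne_1: "norm z \<le> 1 \<Longrightarrow> z \<noteq> 1 \<Longrightarrow> ren z \<noteq> 1"
  by (rule psum_ne_1[OF renewal_coeff_sums renewal_coeff_nonneg renewal_coeff_1])

lemma pas_ne_1: "norm z \<le> 1 \<Longrightarrow> z \<noteq> 1 \<Longrightarrow> pas z \<noteq> 1"
  by (rule psum_ne_1[OF pr'_sums pr'_bounds(1,2)])

text \<open>The error in \<open>renewal_vs_passage\<close> is o(|1 - P(z)|) by
  \<open>moment_square_over_defect_tendsto\<close>; the limit is taken in the whole closed disc, not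
  only radially.\<close>

lemma ratio_tendsto: "((\<lambda>z. (1 - pas z) / (1 - ren z)) \<longlongrightarrow> of_real \<kappa>) (at 1 within cball 0 1)"
proof -
  let ?F = "at (1::complex) within cball 0 1"
  obtain K where K: "\<And>z. norm z \<le> 1 \<Longrightarrow> norm ((1 - pas z) / of_real \<kappa> - (1 - ren z)) \<le> K * (\<eta> z)\<^sup>2"
    using renewal_vs_passage by blast
  have "((\<lambda>z. (\<eta> z)\<^sup>2 / norm (1 - pas z)) \<longlongrightarrow> 0) ?F"
    using moment_square_over_defect_tendsto[OF pr'_sums pr'_bounds(1,2)] unfolding \<eta>_def .
  then have "((\<lambda>z. K * ((\<eta> z)\<^sup>2 / norm (1 - pas z))) \<longlongrightarrow> K * 0) ?F" by (intro tendsto_intros)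
  then have lim: "((\<lambda>z. K * ((\<eta> z)\<^sup>2 / norm (1 - pas z))) \<longlongrightarrow> 0) ?F" by simp
  have ev: "\<forall>\<^sub>F z in ?F. z \<in> cball 0 1 \<and> z \<noteq> 1" by (simp add: eventually_at_filter)
  have "((\<lambda>z. (1 - ren z) / (1 - pas z) - 1 / of_real \<kappa>) \<longlongrightarrow> 0) ?F"
  proof (rule Lim_null_comparison[OF _ lim])
    show "\<forall>\<^sub>F z in ?F. norm ((1 - ren z) / (1 - pas z) - 1 / of_real \<kappa>) \<le> K * ((\<eta> z)\<^sup>2 / norm (1 - pas z))"
      using ev
    proof eventually_elim
      case (elim z)
      then have z: "norm z \<le> 1" "1 - pas z \<noteq> 0" using pas_ne_1[of z] by auto
      have "(1 - ren z) / (1 - pas z) - 1 / of_real \<kappa> = - ((1 - pas z) / of_real \<kappa> - (1 - ren z)) / (1 - pas z)"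
        using z kappa_pos by (simp add: field_simps)
      then have "norm ((1 - ren z) / (1 - pas z) - 1 / of_real \<kappa>) = norm ((1 - pas z) / of_real \<kappa> - (1 - ren z)) / norm (1 - pas z)"
        by (simp only: norm_divide norm_minus_cancel)
      also have "\<dots> \<le> K * (\<eta> z)\<^sup>2 / norm (1 - pas z)" by (intro divide_right_mono K z) simp
      finally show ?case by simp
    qed
  qed
  then have "((\<lambda>z. (1 - ren z) / (1 - pas z)) \<longlongrightarrow> 1 / of_real \<kappa>) ?F" by (rule LIM_zero_cancel)
  then have "((\<lambda>z. inverse ((1 - ren z) / (1 - pas z))) \<longlongrightarrow> inverse (1 / of_real \<kappa>)) ?F"
    by (rule tendsto_inverse) (use kappa_pos in simp)
  then show ?thesis by simp
qed

text \<open>The quotient of the defects converts the factor 1 / (1 - a) of the zeta function into 1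
  / (1 - P). It is 0 / 0 at 1, and \<open>\<kappa>\<close> is its limit there.\<close>

definition limit_factor :: "complex \<Rightarrow> complex" where
  "limit_factor z = exp (psum regular_coeff z) * (if z = 1 then of_real \<kappa> else (1 - pas z) / (1 - ren z))"

lemma continuous_on_ren: "continuous_on (cball 0 1) ren"
  by (rule continuous_on_psum) (use renewal_coeff_sums renewal_coeff_nonneg in \<open>simp add: sums_iff\<close>)

lemma continuous_on_pas: "continuous_on (cball 0 1) pas"
  by (rule continuous_on_psum) (use pr'_sums pr'_bounds(1) in \<open>simp add: sums_iff\<close>)

lemma continuous_on_reg: "continuous_on (cball 0 1) (psum regular_coeff)"
  by (rule continuous_on_psum[OF regular_coeff_summable])

lemma continuous_on_limit_factor: "continuous_on (cball 0 1) limit_factor"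
  unfolding limit_factor_def
proof (rule continuous_on_mult)
  show "continuous_on (cball 0 1) (\<lambda>z. exp (psum regular_coeff z))"
    by (intro continuous_intros continuous_on_reg)
  show "continuous_on (cball 0 1) (\<lambda>z. if z = 1 then of_real \<kappa> else (1 - pas z) / (1 - ren z))"
    unfolding continuous_on_def
  proof
    fix z :: complex assume z: "z \<in> cball 0 1"
    let ?F = "at z within cball 0 1"
    let ?q = "\<lambda>z. (1 - pas z) / (1 - ren z)"
    show "((\<lambda>z. if z = 1 then of_real \<kappa> else ?q z) \<longlongrightarrow> (if z = 1 then of_real \<kappa> else ?q z)) ?F"
    proof (cases "z = 1")
      case True
      have "\<forall>\<^sub>F w in at 1 within cball 0 1. ?q w = (if w = 1 then of_real \<kappa> else ?q w)"
        by (simp add: eventually_at_filter)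
      then show ?thesis using Lim_transform_eventually[OF ratio_tendsto] True by simp
    next
      case False
      have "(?q \<longlongrightarrow> ?q z) ?F"
        using continuous_on_pas continuous_on_ren z ren_ne_1[of z] False
        by (intro tendsto_intros) (auto simp: continuous_on_def)
      moreover have "\<forall>\<^sub>F w in ?F. ?q w = (if w = 1 then of_real \<kappa> else ?q w)"
      proof -
        have "\<forall>\<^sub>F w in ?F. w \<in> - {1}"
          by (rule topological_tendstoD[OF tendsto_ident_at]) (use False in auto)
        then show ?thesis by eventually_elim simp
      qed
      ultimately show ?thesis using False by (simp add: Lim_transform_eventually)
    qed
  qed
qed

text \<open>As k \<ge> d + 1, the k-th moment dominates the infinite one of order d + 1, whereas k -
  1 < d + 1 falls among the finite ones; d > -1 ensures k \<ge> 1.\<close>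

lemma ergodic_degree_moments:
  assumes deg: "ergodic_degree (density \<nu> (\<lambda>x. ennreal (h x))) d" and d: "d > -1"
  defines "k \<equiv> nat \<lceil>d + 1\<rceil>"
  shows "k \<ge> 1" "\<not> summable (\<lambda>n. real n ^ k * pr' n)" "summable (\<lambda>n. real n ^ (k - 1) * pr' n)"
proof -
  show k1: "k \<ge> 1" using d unfolding k_def by linarith
  have kd: "d + 1 \<le> real k" "real (k - 1) < d + 1"
    using d unfolding k_def by linarith+
  have pm: "passage_moment (density \<nu> (\<lambda>x. ennreal (h x))) \<gamma> = (\<Sum>n. ennreal (real (Suc n) powr \<gamma> * pr n))" for \<gamma>
    unfolding passage_moment_def passage_prob_eq ..
  have iff: "summable (\<lambda>n. real n ^ j * pr' n) \<longleftrightarrow> summable (\<lambda>n. real (Suc n) ^ j * pr n)" for j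
    using summable_Suc_iff[of "\<lambda>n. real n ^ j * pr' n"] by (simp only: pr'_simps)
  show "\<not> summable (\<lambda>n. real n ^ k * pr' n)"
  proof
    assume "summable (\<lambda>n. real n ^ k * pr' n)"
    then have sm: "summable (\<lambda>n. real (Suc n) ^ k * pr n)" unfolding iff .
    have "(\<Sum>n. ennreal (real (Suc n) powr (d + 1) * pr n)) \<le> (\<Sum>n. ennreal (real (Suc n) ^ k * pr n))"
    proof (rule suminf_le)
      fix n
      have "real (Suc n) powr (d + 1) \<le> real (Suc n) powr real k" using kd by (intro powr_mono) auto
      also have "\<dots> = real (Suc n) ^ k" by (rule powr_realpow) simp
      finally show "ennreal (real (Suc n) powr (d + 1) * pr n) \<le> ennreal (real (Suc n) ^ k * pr n)"
        using pr_pos[of n] by (intro ennreal_leI mult_right_mono) auto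
    qed auto
    also have "\<dots> = ennreal (\<Sum>n. real (Suc n) ^ k * pr n)"
      by (rule suminf_ennreal2[OF _ sm]) (use pr_pos in \<open>auto simp: less_imp_le\<close>)
    also have "\<dots> < \<infinity>" by simp
    finally show False using deg by (simp add: ergodic_degree_def pm)
  qed
  have "passage_moment (density \<nu> (\<lambda>x. ennreal (h x))) (d + 1 - (d + 1 - real (k - 1))) < \<infinity>"
    using deg kd unfolding ergodic_degree_def by (metis diff_gt_0_iff_gt)
  then have "(\<Sum>n. ennreal (real (Suc n) powr real (k - 1) * pr n)) \<noteq> top" unfolding pm by simp
  then have "summable (\<lambda>n. real (Suc n) powr real (k - 1) * pr n)"
    by (rule summable_suminf_not_top[rotated]) (use pr_pos in \<open>auto simp: less_imp_le\<close>)
  then have "summable (\<lambda>n. real (Suc n) ^ (k - 1) * pr n)"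
    by (simp add: powr_realpow)
  then show "summable (\<lambda>n. real n ^ (k - 1) * pr' n)" unfolding iff .
qed

lemma zeta_nonpolar:
  assumes \<zeta>: "\<And>z. norm z < 1 \<Longrightarrow> \<zeta> z * (1 - z) * (1 - ren z) = exp (psum regular_coeff z)"
    and k: "k \<ge> 1" "\<not> summable (\<lambda>n. real n ^ k * pr' n)" "summable (\<lambda>n. real n ^ (k - 1) * pr' n)"
  shows "nonpolar_singularity \<zeta> (ball 0 1) 1"
  unfolding nonpolar_singularity_def
proof
  let ?F = "at_left (1::real)" and ?r = "complex_of_real"
  have ev: "\<forall>\<^sub>F x in ?F. x \<in> {0<..<1}" by (rule eventually_at_left_real) simp
  have lim1: "(?r \<longlongrightarrow> 1) ?F"
    using tendsto_of_real[OF tendsto_ident_at[of "1::real" "{..<1}"], where 'a=complex] by simp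
  have evc: "\<forall>\<^sub>F x in ?F. ?r x \<in> cball 0 1" using ev by eventually_elim auto
  have ren1: "ren 1 = 1"
    using renewal_coeff_sums by (simp add: psum_def sums_iff flip: suminf_of_real)
  show "\<not> continues_regularly \<zeta> (ball 0 1) 1"
  proof
    \<comment> \<open>A regular g would stay bounded while (1 - z) (1 - ren z) tends to 0 along the
      radius, but the product tends to a value of exp, which is never 0.\<close>
    assume "continues_regularly \<zeta> (ball 0 1) 1"
    then obtain g \<rho> where g: "\<rho> > 0" "g holomorphic_on ball 1 \<rho>" "\<And>z. z \<in> ball 0 1 \<inter> ball 1 \<rho> \<Longrightarrow> g z = \<zeta> z"
      unfolding continues_regularly_def by blast
    have "isCont g 1" using holomorphic_on_imp_continuous_on[OF g(2)] g(1)
      by (simp add: continuous_on_eq_continuous_at)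
    then have lg: "((\<lambda>x. g (?r x)) \<longlongrightarrow> g 1) ?F" using lim1 by (rule isCont_tendsto_compose)
    have la: "((\<lambda>x. ren (?r x)) \<longlongrightarrow> ren 1) ?F"
      by (rule continuous_on_tendsto_compose[OF continuous_on_ren lim1]) (use evc in auto)
    have lG: "((\<lambda>x. psum regular_coeff (?r x)) \<longlongrightarrow> psum regular_coeff 1) ?F"
      by (rule continuous_on_tendsto_compose[OF continuous_on_reg lim1]) (use evc in auto)
    have l1: "((\<lambda>x. g (?r x) * (1 - ?r x) * (1 - ren (?r x))) \<longlongrightarrow> g 1 * (1 - 1) * (1 - ren 1)) ?F"
      by (intro tendsto_intros lg lim1 la)
    have l2: "((\<lambda>x. exp (psum regular_coeff (?r x))) \<longlongrightarrow> exp (psum regular_coeff 1)) ?F"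
      by (intro tendsto_intros lG)
    have "\<forall>\<^sub>F x in ?F. ?r x \<in> ball 1 \<rho>" using lim1 g(1) by (intro topological_tendstoD) auto
    with ev have "\<forall>\<^sub>F x in ?F. g (?r x) * (1 - ?r x) * (1 - ren (?r x)) = exp (psum regular_coeff (?r x))"
      by eventually_elim (use g(3) \<zeta> in simp)
    note l3 = Lim_transform_eventually[OF l1 this]
    have "exp (psum regular_coeff 1) = g 1 * (1 - 1) * (1 - ren 1)"
      by (rule tendsto_unique[OF _ l2 l3]) simp
    then show False by simp
  qed
  show "\<not> continues_with_pole \<zeta> (ball 0 1) 1"
  proof
    assume "continues_with_pole \<zeta> (ball 0 1) 1"
    then obtain g \<rho> where g: "\<rho> > 0" "g holomorphic_on (ball 1 \<rho> - {1})" "is_pole g 1"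
      "\<And>z. z \<in> ball 0 1 \<inter> ball 1 \<rho> \<Longrightarrow> g z = \<zeta> z"
      unfolding continues_with_pole_def by blast
    obtain e where e: "e > 0" "\<And>w. w \<noteq> 1 \<Longrightarrow> dist w 1 < e \<Longrightarrow> g w \<noteq> 0"
      using non_zero_neighbour_pole[OF g(3)] unfolding eventually_at by auto
    define R where "R = min e \<rho>"
    have R: "R > 0" using e g by (simp add: R_def)
    define q0 where "q0 = (\<lambda>x. if x = 1 then 0 else inverse (g x))"
    have holq0: "q0 holomorphic_on ball 1 R" unfolding q0_def
    proof (rule is_pole_inverse_holomorphic[OF open_ball _ g(3)])
      show "g holomorphic_on ball 1 R - {1}" by (rule holomorphic_on_subset[OF g(2)]) (auto simp: R_def)
      show "\<forall>x\<in>ball 1 R - {1}. g x \<noteq> 0" using e by (auto simp: R_def dist_commute)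
    qed
    \<comment> \<open>\<open>q0\<close> is the reciprocal of g with its zero at 1 filled in, so the
      singularity of the quotient is removable; the sign turns z - 1 into 1 - z.\<close>
    define q where "q z = - (if z = 1 then deriv q0 1 else (q0 z - q0 1) / (z - 1))" for z
    have holq: "q holomorphic_on ball 1 R"
      unfolding q_def by (intro holomorphic_on_minus pole_lemma_open holq0 open_ball)
    have eq: "q z = (1 - ren z) * exp (- psum regular_coeff z)" if z: "z \<in> ball 0 1 \<inter> ball 1 R" for z
    proof -
      have z1: "z \<noteq> 1" "norm z < 1" using z by auto
      have gz: "g z * (1 - z) * (1 - ren z) = exp (psum regular_coeff z)"
        using g(4)[of z] z \<zeta>[OF z1(2)] by (simp add: R_def)
      then have nz: "g z \<noteq> 0" using exp_not_eq_zero[of "psum regular_coeff z"] by auto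
      have "q z = inverse (g z) / (1 - z)"
        using z1 by (simp add: q_def q0_def divide_simps)
      also have "\<dots> = (1 - ren z) * inverse (g z * (1 - z) * (1 - ren z))"
        using z1 ren_ne_1[of z] by (simp add: inverse_mult_distrib divide_inverse)
      finally show ?thesis unfolding gz exp_minus .
    qed
    obtain K where K: "\<And>x. 0 < x \<Longrightarrow> x < 1 \<Longrightarrow>
        (\<Sum>n. real n ^ k * norm (regular_coeff n) * x ^ n) \<le> K * (\<Sum>n. real n ^ k * pr' n * x ^ n)"
      using regular_coeff_power_le[of k] by blast
    show False
      by (rule no_holomorphic_continuation[OF pr'_bounds(1,3) k(1,2) renewal_coeff_sums renewal_coeff_ge
            renewal_coeff_nonneg M0_pos regular_coeff_summable summable_regular_coeff[OF k(3)] K R holq eq])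
  qed
qed

lemma zeta_conclusion:
  assumes V0: "V zero_point = 0" and d: "d > -1"
    and deg: "ergodic_degree (density \<nu> (\<lambda>x. ennreal (h x))) d"
  defines "\<phi> \<equiv> (\<lambda>\<omega>. exp (V \<omega>))" and "\<rho> \<equiv> density \<nu> (\<lambda>x. ennreal (h x))"
  shows "(\<forall>z\<in>ball 0 1. summable (\<lambda>n. zeta_term \<phi> z (Suc n)))
    \<and> dyn_zeta \<phi> holomorphic_on ball 0 1
    \<and> nonpolar_singularity (dyn_zeta \<phi>) (ball 0 1) 1
    \<and> (\<exists>Z. continuous_on (cball 0 1 - {1}) Z
          \<and> (\<forall>z\<in>ball 0 1. Z z = dyn_zeta \<phi> z)
          \<and> (\<forall>z\<in>cball 0 1 - {1}. passage_gf \<rho> z \<noteq> 1)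
          \<and> (\<exists>L. continuous_on (cball 0 1) L \<and> L 1 \<noteq> 0
                \<and> (\<forall>z\<in>cball 0 1 - {1}. Z z = renewal_factor \<rho> z * L z / (1 - z))))"
proof -
  \<comment> \<open>Every ingredient is continuous on the closed disc and the denominator vanishes
    there at 1 only, so solving the identity for the zeta function gives its extension.\<close>
  define Z where "Z z = exp (psum regular_coeff z) / ((1 - z) * (1 - ren z))" for z
  have nz: "(1 - z) * (1 - ren z) \<noteq> 0" if "norm z \<le> 1" "z \<noteq> 1" for z
    using ren_ne_1[OF that] that by simp
  have \<zeta>: "dyn_zeta \<phi> z * (1 - z) * (1 - ren z) = exp (psum regular_coeff z)" if "norm z < 1" for z
    unfolding \<phi>_def by (rule zeta_eq(2)[OF V0 that])
  have Zeq: "Z z = dyn_zeta \<phi> z" if "z \<in> ball 0 1" for z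
  proof -
    have "norm z < 1" "z \<noteq> 1" using that by auto
    then have 1: "dyn_zeta \<phi> z * ((1 - z) * (1 - ren z)) = exp (psum regular_coeff z)" "(1 - z) * (1 - ren z) \<noteq> 0"
      using \<zeta>[of z] nz[of z] by (simp_all only: mult.assoc less_imp_le not_False_eq_True)
    show ?thesis unfolding Z_def 1(1)[symmetric] by (rule nonzero_mult_div_cancel_right[OF 1(2)])
  qed
  have rensm: "summable (\<lambda>n. norm (complex_of_real (renewal_coeff n)))"
    using renewal_coeff_sums renewal_coeff_nonneg by (simp add: sums_iff)
  have holZ: "Z holomorphic_on ball 0 1"
    unfolding Z_def
    by (intro holomorphic_intros holomorphic_on_psum summable_in_disc[OF rensm] summable_in_disc[OF regular_coeff_summable] nz) auto
  have "dyn_zeta \<phi> holomorphic_on ball 0 1"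
    using holomorphic_transform[OF holZ Zeq] .
  moreover have "nonpolar_singularity (dyn_zeta \<phi>) (ball 0 1) 1"
    using zeta_nonpolar[OF \<zeta> ergodic_degree_moments[OF deg d]] .
  moreover have "continuous_on (cball 0 1 - {1}) Z" unfolding Z_def
    by (intro continuous_intros continuous_on_subset[OF continuous_on_reg] continuous_on_subset[OF continuous_on_ren]) (use nz in auto)
  moreover have "passage_gf \<rho> z \<noteq> 1" if "z \<in> cball 0 1 - {1}" for z
    using passage_gf_eq[of z] pas_ne_1[of z] that unfolding \<rho>_def by simp
  moreover have "limit_factor 1 \<noteq> 0" using kappa_pos by (simp add: limit_factor_def)
  moreover have "Z z = renewal_factor \<rho> z * limit_factor z / (1 - z)" if "z \<in> cball 0 1 - {1}" for z
  proof -
    have z: "norm z \<le> 1" "z \<noteq> 1" using that by auto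
    have "renewal_factor \<rho> z = inverse (1 - pas z)"
      unfolding renewal_factor_def \<rho>_def using passage_gf_eq[OF z(1)] by simp
    moreover have "E / (w * b) = inverse a * (E * (a / b)) / w" if "a \<noteq> 0" "b \<noteq> 0" "w \<noteq> 0" for E a b w :: complex
      using that by (simp add: field_simps)
    ultimately show ?thesis
      using z pas_ne_1[OF z] ren_ne_1[OF z] by (simp add: Z_def limit_factor_def)
  qed
  moreover have "\<forall>z\<in>ball 0 1. summable (\<lambda>n. zeta_term \<phi> z (Suc n))"
    unfolding \<phi>_def using zeta_eq(1)[OF V0] by simp
  ultimately show ?thesis using Zeq continuous_on_limit_factor by blast
qed

end

theorem theorem8:
  fixes V :: "point \<Rightarrow> real" and \<theta> C1 C2 C3 d :: real
    and h :: "point \<Rightarrow> real" and \<nu> \<rho> :: "point measure"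
  defines "W \<equiv> induced_potential V"
    and "\<phi> \<equiv> (\<lambda>\<omega>. exp (V \<omega>))"
    and "\<rho> \<equiv> density \<nu> (\<lambda>\<omega>. ennreal (h \<omega>))"
  assumes V_cont: "continuous_on UNIV V"
    and C1_pos: "C1 > 0"
    and V_bounds: "\<And>\<omega>. - C1 \<le> V \<omega> \<and> V \<omega> \<le> 0"
    and V_zero: "V zero_point = 0"
    and W_summable: "summable (\<lambda>n. exp (SUP \<omega>\<in>level_set (Suc n). W \<omega>))"
    and W_sum_bound: "(\<Sum>n. exp (SUP \<omega>\<in>level_set (Suc n). W \<omega>)) < C2"
    and theta: "0 < \<theta>" "\<theta> < 1"
    and C3_pos: "C3 > 0"
    and W_variation: "\<And>n. n \<ge> 1 \<Longrightarrow> variation n W \<le> ereal (C3 * \<theta> ^ n)"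
    and pressure_zero: "(\<lambda>n. (1 / real n) * ln (partition_sum V n)) \<longlonglongrightarrow> 0"
    and h_in: "(\<lambda>\<omega>. complex_of_real (h \<omega>)) \<in> F_theta \<theta>"
    and h_pos: "\<And>\<omega>. \<omega> \<in> Omega_star \<Longrightarrow> h \<omega> > 0"
    and h_eigen: "\<And>\<omega>. \<omega> \<in> Omega_star \<Longrightarrow>
                    induced_operator V (\<lambda>\<omega>'. complex_of_real (h \<omega>')) \<omega> = complex_of_real (h \<omega>)"
    and nu_prob: "prob_space \<nu>"
    and nu_sets: "sets \<nu> = sets (restrict_space borel Omega_star)"
    and nu_eigen: "\<And>f. f \<in> F_theta \<theta> \<Longrightarrow>
                     (\<integral>\<omega>. induced_operator V f \<omega> \<partial>\<nu>) = (\<integral>\<omega>. f \<omega> \<partial>\<nu>)"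
    and h_norm: "(\<integral>\<omega>. h \<omega> \<partial>\<nu>) = 1"
    and d_gt: "d > -1"
    and degree: "ergodic_degree \<rho> d"
  shows "(\<forall>z\<in>ball 0 1. summable (\<lambda>n. zeta_term \<phi> z (Suc n)))
    \<and> dyn_zeta \<phi> holomorphic_on ball 0 1
    \<and> nonpolar_singularity (dyn_zeta \<phi>) (ball 0 1) 1
    \<and> (\<exists>Z. continuous_on (cball 0 1 - {1}) Z
          \<and> (\<forall>z\<in>ball 0 1. Z z = dyn_zeta \<phi> z)
          \<and> (\<forall>z\<in>cball 0 1 - {1}. passage_gf \<rho> z \<noteq> 1)
          \<and> (\<exists>L. continuous_on (cball 0 1) L \<and> L 1 \<noteq> 0
                \<and> (\<forall>z\<in>cball 0 1 - {1}. Z z = renewal_factor \<rho> z * L z / (1 - z))))"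
proof -
  interpret renewal_system V \<theta> C1 C3 h
    by unfold_locales (fact V_bounds W_summable[unfolded W_def] theta C3_pos W_variation[unfolded W_def] h_in h_pos h_eigen)+
  obtain B where B: "B > 0" "cone B h" "(B + C3) * \<theta> < B" using ex_cone_h by blast
  obtain hmin where hmin: "hmin > 0" "\<And>x. x \<in> Omega_star \<Longrightarrow> hmin \<le> h x" using ex_h_lower by blast
  obtain hmax Lh where hmax: "\<And>x. x \<in> Omega_star \<Longrightarrow> h x \<le> hmax" by (rule ex_h_bounds) iprover
  have "cone_system V \<theta> C1 C3 h B hmin hmax"
    by unfold_locales (fact B hmin hmax)+
  then interpret measure_system V \<theta> C1 C3 h B hmin hmax \<nu>
    by (rule measure_system.intro) (rule measure_system_axioms.intro[OF nu_prob nu_sets nu_eigen h_norm])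
  show ?thesis
    unfolding \<phi>_def \<rho>_def by (rule zeta_conclusion[OF V_zero d_gt degree[unfolded \<rho>_def]])
qed

end
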